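(* Let $R:\mathbb{C}_\infty\to\mathbb{C}_\infty$ be a rational function of degree at least $2$ such that its Julia set $J(R)$ has no buried points and no component of the Fatou set $F(R^2)$ is completely invariant under $R^2 = R\circ R$. Then $J(R)$ is an indecomposable continuum.
   Context: $\mathbb{C}_\infty$ is the Riemann sphere. The Fatou set $F(R)$ is the domain of normality of the family of iterates $\{R^i : i\in\mathbb{N}\}$; the Julia set is $J(R)=\mathbb{C}_\infty\setminus F(R)$. A connected component of $F(R)$ is called a Fatou component. One has $F(R^n)=F(R)$ and $J(R^n)=J(R)$ for all $n\ge 1$. A point of $J(R)$ is buried if it does not belong to the boundary of any Fatou component. A set $X$ is completely invariant under a map $f$ if $f(X)=X=f^{-1}(X)$. A continuum is a (nonempty) compact connected metrizable space; it is decomposable if it is the union of two proper subcontinua, and indecomposable otherwise. *)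

theory Defs
  imports "HOL-Analysis.Analysis" "HOL-Computational_Algebra.Polynomial"
begin

datatype riemann_sphere = Fin complex | Infty

text \<open>The Riemann sphere carries the chordal metric, i.e. the Euclidean metric of
  \<open>complex \<times> real\<close> (a copy of three-dimensional space) pulled back along the inverse of
  stereographic projection from the north pole \<open>(0, 1)\<close> of the unit sphere.\<close>

fun stereo :: "riemann_sphere \<Rightarrow> complex \<times> real" where
  "stereo (Fin z) =
     (of_real (2 / (1 + (cmod z)\<^sup>2)) * z, ((cmod z)\<^sup>2 - 1) / ((cmod z)\<^sup>2 + 1))"
| "stereo Infty = (0, 1)"

lemma one_plus_cmod_sq_pos: "1 + (cmod z)\<^sup>2 > 0"
  by (simp add: add_pos_nonneg)

lemma snd_stereo_Fin: "snd (stereo (Fin z)) = 1 - 2 / (1 + (cmod z)\<^sup>2)"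
  using one_plus_cmod_sq_pos[of z] by (simp add: field_simps)

lemma inj_stereo: "inj stereo"
proof (rule injI)
  fix x y assume eq: "stereo x = stereo y"
  have ne: "snd (stereo (Fin z)) \<noteq> 1" for z
    unfolding snd_stereo_Fin using one_plus_cmod_sq_pos[of z] by simp
  show "x = y"
  proof (cases x; cases y)
    fix z w assume x: "x = Fin z" and y: "y = Fin w"
    have "2 / (1 + (cmod z)\<^sup>2) = 2 / (1 + (cmod w)\<^sup>2)"
      using arg_cong[OF eq, of snd] unfolding x y snd_stereo_Fin by simp
    moreover have "of_real (2 / (1 + (cmod z)\<^sup>2)) * z = of_real (2 / (1 + (cmod w)\<^sup>2)) * w"
      using arg_cong[OF eq, of fst] unfolding x y by simp
    moreover have "2 / (1 + (cmod w)\<^sup>2) \<noteq> 0"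
      using one_plus_cmod_sq_pos[of w] by simp
    ultimately have "z = w"
      by (metis mult_left_cancel of_real_eq_0_iff)
    then show ?thesis using x y by simp
  next
    fix z assume "x = Fin z" and "y = Infty"
    then show ?thesis using eq ne[of z] by (metis snd_conv stereo.simps(2))
  next
    fix w assume "x = Infty" and "y = Fin w"
    then show ?thesis using eq ne[of w] by (metis snd_conv stereo.simps(2))
  qed auto
qed

lemma range_stereo: "range stereo = sphere 0 1"
proof (intro equalityI subsetI)
  fix v assume "v \<in> range stereo"
  then obtain x where v: "v = stereo x" by auto
  have "(norm v)\<^sup>2 = 1"
  proof (cases x)
    case (Fin z)
    define a where "a = (cmod z)\<^sup>2"
    have a: "1 + a > 0" using one_plus_cmod_sq_pos[of z] by (simp add: a_def)
    have "(norm v)\<^sup>2 = (2 / (1 + a) * cmod z)\<^sup>2 + ((a - 1) / (a + 1))\<^sup>2"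
    proof -
      have "cmod (fst v) = 2 / (1 + a) * cmod z"
        unfolding v Fin stereo.simps fst_conv norm_mult norm_of_real using a by (simp add: a_def)
      moreover have "snd v = (a - 1) / (a + 1)" by (simp add: v Fin a_def)
      ultimately show ?thesis by (simp only: norm_prod_def real_norm_def power2_abs) simp
    qed
    also have "\<dots> = (4 * a + (a - 1)\<^sup>2) / (1 + a)\<^sup>2"
      by (simp add: power_mult_distrib power_divide a_def add_divide_distrib add.commute)
    also have "4 * a + (a - 1)\<^sup>2 = (1 + a)\<^sup>2" by (simp add: power2_eq_square algebra_simps)
    finally show ?thesis using a by simp
  qed (simp add: v)
  then have "norm v = 1" using norm_ge_zero[of v] unfolding power2_eq_1_iff by linarith
  then show "v \<in> sphere 0 1" by simp
next
  fix v :: "complex \<times> real" assume v1: "v \<in> sphere 0 1"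
  obtain w t where v: "v = (w, t)" by (cases v)
  have n: "(cmod w)\<^sup>2 + t\<^sup>2 = 1" using v1 by (simp add: v norm_prod_def)
  show "v \<in> range stereo"
  proof (cases "t = 1")
    case True
    then have "v = stereo Infty" using n v by simp
    then show ?thesis by blast
  next
    case False
    define z where "z = w / of_real (1 - t)"
    have t: "1 - t \<noteq> 0" using False by simp
    have "(cmod z)\<^sup>2 = (cmod w)\<^sup>2 / (1 - t)\<^sup>2"
      unfolding z_def norm_divide norm_of_real power_divide power2_abs ..
    also have "(cmod w)\<^sup>2 = (1 + t) * (1 - t)"
      using n by (simp add: power2_eq_square algebra_simps)
    finally have z: "(cmod z)\<^sup>2 = (1 + t) / (1 - t)"
      using t by (simp add: power2_eq_square)
    have "1 + (cmod z)\<^sup>2 = (1 - t) / (1 - t) + (1 + t) / (1 - t)"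
      unfolding z divide_self[OF t] ..
    also have "\<dots> = 2 / (1 - t)" unfolding add_divide_distrib[symmetric] by simp
    finally have c: "2 / (1 + (cmod z)\<^sup>2) = 1 - t" by simp
    have "fst (stereo (Fin z)) = of_real (1 - t) * (w / of_real (1 - t))"
      unfolding stereo.simps fst_conv c by (simp only: z_def)
    also have "\<dots> = w"
      using t by (metis nonzero_mult_div_cancel_left of_real_eq_0_iff times_divide_eq_right)
    finally have "fst (stereo (Fin z)) = w" .
    moreover have "snd (stereo (Fin z)) = t" unfolding snd_stereo_Fin c by simp
    ultimately have "v = stereo (Fin z)" using v by (metis prod.collapse)
    then show ?thesis by blast
  qed
qed

instantiation riemann_sphere :: metric_space
begin

definition dist_riemann_sphere :: "riemann_sphere \<Rightarrow> riemann_sphere \<Rightarrow> real" where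
  "dist_riemann_sphere x y = dist (stereo x) (stereo y)"

definition uniformity_riemann_sphere :: "(riemann_sphere \<times> riemann_sphere) filter" where
  "uniformity_riemann_sphere = (INF e\<in>{0<..}. principal {(x, y). dist x y < e})"

definition open_riemann_sphere :: "riemann_sphere set \<Rightarrow> bool" where
  "open_riemann_sphere U \<longleftrightarrow> (\<forall>x\<in>U. \<forall>\<^sub>F (x', y) in uniformity. x' = x \<longrightarrow> y \<in> U)"

instance
proof
  fix x y z :: riemann_sphere
  show "dist x y = 0 \<longleftrightarrow> x = y"
    using inj_stereo by (auto simp: dist_riemann_sphere_def dest: injD)
  show "dist x y \<le> dist x z + dist y z"
    unfolding dist_riemann_sphere_def by (rule dist_triangle2)
qed (simp_all only: uniformity_riemann_sphere_def open_riemann_sphere_def)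

end

text \<open>For coprime \<open>p\<close>, \<open>q\<close>, the value at infinity is the limit of \<open>p(z) / q(z)\<close> as \<open>z\<close> tends
  to infinity.\<close>

fun rational_map :: "complex poly \<Rightarrow> complex poly \<Rightarrow> riemann_sphere \<Rightarrow> riemann_sphere" where
  "rational_map p q (Fin z) = (if poly q z = 0 then Infty else Fin (poly p z / poly q z))"
| "rational_map p q Infty =
     (if degree p > degree q then Infty else Fin (coeff p (degree q) / lead_coeff q))"

definition rational_function_of_degree :: "(riemann_sphere \<Rightarrow> riemann_sphere) \<Rightarrow> nat \<Rightarrow> bool" where
  "rational_function_of_degree R d \<longleftrightarrow>
     (\<exists>p q. q \<noteq> 0 \<and> coprime p q \<and> R = rational_map p q \<and> d = max (degree p) (degree q))"

definition normal_family_on :: "('a::metric_space \<Rightarrow> 'b::metric_space) set \<Rightarrow> 'a set \<Rightarrow> bool" where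
  "normal_family_on \<F> U \<longleftrightarrow>
     (\<forall>f :: nat \<Rightarrow> 'a \<Rightarrow> 'b. range f \<subseteq> \<F> \<longrightarrow>
        (\<exists>r g. strict_mono r \<and>
           (\<forall>K. compact K \<and> K \<subseteq> U \<longrightarrow> uniform_limit K (f \<circ> r) g sequentially)))"

definition fatou_set :: "(riemann_sphere \<Rightarrow> riemann_sphere) \<Rightarrow> riemann_sphere set" where
  "fatou_set R = \<Union>{U. open U \<and> normal_family_on (range (\<lambda>i. R ^^ i)) U}"

definition julia_set :: "(riemann_sphere \<Rightarrow> riemann_sphere) \<Rightarrow> riemann_sphere set" where
  "julia_set R = - fatou_set R"

definition buried_point :: "(riemann_sphere \<Rightarrow> riemann_sphere) \<Rightarrow> riemann_sphere \<Rightarrow> bool" where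
  "buried_point R x \<longleftrightarrow>
     x \<in> julia_set R \<and> \<not> (\<exists>C \<in> components (fatou_set R). x \<in> frontier C)"

definition completely_invariant :: "('a \<Rightarrow> 'a) \<Rightarrow> 'a set \<Rightarrow> bool" where
  "completely_invariant f X \<longleftrightarrow> f ` X = X \<and> f -` X = X"

definition continuum :: "'a::metric_space set \<Rightarrow> bool" where
  "continuum S \<longleftrightarrow> S \<noteq> {} \<and> compact S \<and> connected S"

definition decomposable :: "'a::metric_space set \<Rightarrow> bool" where
  "decomposable S \<longleftrightarrow> (\<exists>A B. continuum A \<and> continuum B \<and> A \<subset> S \<and> B \<subset> S \<and> S = A \<union> B)"

definition indecomposable_continuum :: "'a::metric_space set \<Rightarrow> bool" where
  "indecomposable_continuum S \<longleftrightarrow> continuum S \<and> \<not> decomposable S"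

end

theory Submission
  imports Defs "HOL-Complex_Analysis.Complex_Analysis"
begin

text \<open>Let \<open>J\<close> be the Julia set. By Montel's theorem, iterates of any open set meeting \<open>J\<close>
  eventually cover \<open>J\<close>. Since there are no buried points, Baire's theorem gives a Fatou component whose
  boundary contains a relatively open piece of \<open>J\<close>, and an iterate \<open>D\<close> of it has boundary \<open>J\<close>. By
  unicoherence of the sphere, \<open>J\<close> is connected, for otherwise no other component could map onto \<open>D\<close>, and
  \<open>D\<close> would be completely invariant. Moreover some relatively open piece \<open>O\<close> of \<open>J\<close> lies in the boundaries of
  three components: otherwise at most two components have \<open>J\<close> as boundary, \<open>R\<close> permutes them, and they have no
  other preimages, so \<open>R \<circ> R\<close> leaves each of them completely invariant.

  Suppose now that \<open>J = A \<union> B\<close> with proper subcontinua. The components of the preimages of \<open>A\<close> and \<open>B\<close> under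
  iterates of \<open>R\<close> can be merged to a cyclic arrangement of three or four continua covering \<open>J\<close>, such that the union
  of two neighbours in the cycle misses a point of \<open>O\<close>. For points \<open>p\<^sub>1\<close>, \<open>p\<^sub>2\<close>, \<open>p\<^sub>3\<close> of the three components, the
  functions \<open>f\<^sub>j = (z - p\<^sub>j) / (z - p\<^sub>1)\<close>, \<open>j = 2, 3\<close>, therefore have continuous logarithms on the union of two
  neighbours, and the obstruction to gluing these logarithms is a single integer for each of \<open>f\<^sub>2\<close>, \<open>f\<^sub>3\<close>. Hence some
  nontrivial product of powers of \<open>f\<^sub>2\<close> and \<open>f\<^sub>3\<close> has a continuous logarithm on \<open>J\<close>, which is impossible since
  \<open>J\<close> separates the three points.\<close>

section \<open>Homogeneous coordinates\<close>

text \<open>If no iterate of an open set covers \<open>J\<close>, the omitted point changes with the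
  iterate, so Montel's theorem with fixed omitted values does not apply. Pulling the omitted points
  back along one suitable iterate, the same for a whole subsequence, gives three omitted values that
  still move but stay uniformly apart; compactness of the sphere then replaces fixed values.
  Homogeneous coordinates avoid most case distinctions at infinity in this argument. In the crossing
  argument a single function would leave one integer that need not vanish. Two functions leave two
  integers, and two integers always satisfy a nontrivial linear relation over the integers. Two
  functions require three complementary components with a common boundary piece. With only two such
  components \<open>R\<close> may exchange them, which is the origin of \<open>R \<circ> R\<close>
  in the hypothesis.\<close>

type_synonym C2 = "complex \<times> complex"

text \<open>The value \<open>proj 0 = Infty\<close> is junk.\<close>

definition proj :: "C2 \<Rightarrow> riemann_sphere" where
  "proj X = (if snd X = 0 then Infty else Fin (fst X / snd X))"

text \<open>The determinant with columns \<open>X\<close> and \<open>Y\<close>. On nonzero vectors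
  it vanishes exactly when both represent the same point, so it plays the role of the difference of
  two points.\<close>

definition br :: "C2 \<Rightarrow> C2 \<Rightarrow> complex" where
  "br X Y = fst X * snd Y - snd X * fst Y"

definition scl :: "complex \<Rightarrow> C2 \<Rightarrow> C2" where
  "scl c X = (c * fst X, c * snd X)"

lemma scl_0 [simp]: "scl 0 X = 0" by (simp add: scl_def zero_prod_def)
lemma scl_scl [simp]: "scl a (scl b X) = scl (a * b) X" by (simp add: scl_def mult.assoc)
lemma scl_1 [simp]: "scl 1 X = X" by (simp add: scl_def)
lemma scl_eq_0_iff [simp]: "scl c X = 0 \<longleftrightarrow> c = 0 \<or> X = 0"
  by (auto simp: scl_def zero_prod_def prod_eq_iff)
lemma br_scl_left [simp]: "br (scl c X) Y = c * br X Y" by (simp add: br_def scl_def algebra_simps)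
lemma br_scl_right [simp]: "br X (scl c Y) = c * br X Y" by (simp add: br_def scl_def algebra_simps)
lemma br_add_left: "br (X + X') Y = br X Y + br X' Y" by (simp add: br_def algebra_simps)
lemma br_add_right: "br X (Y + Y') = br X Y + br X Y'" by (simp add: br_def algebra_simps)
lemma br_diff_left: "br (X - X') Y = br X Y - br X' Y" by (simp add: br_def algebra_simps)
lemma br_self [simp]: "br X X = 0" by (simp add: br_def)
lemma br_swap: "br X Y = - br Y X" by (simp add: br_def)
lemma br_0_left [simp]: "br 0 Y = 0" by (simp add: br_def zero_prod_def)

lemma norm_C2: "(norm (X::C2))\<^sup>2 = (cmod (fst X))\<^sup>2 + (cmod (snd X))\<^sup>2"
  by (simp add: norm_prod_def)

lemma norm_scl [simp]: "norm (scl c X) = cmod c * norm X"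
proof -
  have "(norm (scl c X))\<^sup>2 = (cmod c * norm X)\<^sup>2"
    unfolding norm_C2 power_mult_distrib by (simp add: scl_def norm_mult power_mult_distrib algebra_simps)
  then show ?thesis by (simp add: power2_eq_iff_nonneg)
qed

lemma proj_scl [simp]: "c \<noteq> 0 \<Longrightarrow> proj (scl c X) = proj X"
  by (simp add: proj_def scl_def)

lemma proj_Fin: "proj (z, 1) = Fin z" by (simp add: proj_def)
lemma proj_Infty: "proj (1, 0) = Infty" by (simp add: proj_def)

text \<open>This is the Hopf map; unlike the affine formula it has no separate case at
  infinity.\<close>

lemma stereo_proj:
  assumes "X \<noteq> 0"
  shows "stereo (proj X) = (2 * fst X * cnj (snd X) / of_real ((norm X)\<^sup>2),
           ((cmod (fst X))\<^sup>2 - (cmod (snd X))\<^sup>2) / (norm X)\<^sup>2)"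
proof (cases "snd X = 0")
  case True
  then have "fst X \<noteq> 0" using assms by (auto simp: prod_eq_iff)
  then show ?thesis using True by (simp add: proj_def norm_C2)
next
  case False
  define x y where "x = fst X" and "y = snd X"
  have y: "y \<noteq> 0" using False by (simp add: y_def)
  have yc: "of_real ((cmod y)\<^sup>2) = y * cnj y" by (rule complex_norm_square)
  have q: "(cmod (x / y))\<^sup>2 = (cmod x)\<^sup>2 / (cmod y)\<^sup>2" by (simp add: norm_divide power_divide)
  have N: "(norm X)\<^sup>2 = (cmod x)\<^sup>2 + (cmod y)\<^sup>2" by (simp add: norm_C2 x_def y_def)
  have N0: "(cmod x)\<^sup>2 + (cmod y)\<^sup>2 \<noteq> 0" using y by (simp add: sum_power2_eq_zero_iff)
  have "2 / (1 + (cmod (x / y))\<^sup>2) = 2 * (cmod y)\<^sup>2 / ((cmod x)\<^sup>2 + (cmod y)\<^sup>2)"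
    unfolding q using y N0 by (simp add: field_simps)
  then have "of_real (2 / (1 + (cmod (x / y))\<^sup>2)) * (x / y)
      = of_real (2 * (cmod y)\<^sup>2 / ((cmod x)\<^sup>2 + (cmod y)\<^sup>2)) * (x / y)" by simp
  also have "\<dots> = 2 * (y * cnj y) / of_real ((cmod x)\<^sup>2 + (cmod y)\<^sup>2) * (x / y)"
    by (simp only: of_real_divide of_real_mult yc of_real_numeral)
  also have "\<dots> = 2 * x * cnj y / of_real ((cmod x)\<^sup>2 + (cmod y)\<^sup>2)" using y by simp
  finally have 1: "of_real (2 / (1 + (cmod (x / y))\<^sup>2)) * (x / y) = \<dots>" .
  have 2: "((cmod (x / y))\<^sup>2 - 1) / ((cmod (x / y))\<^sup>2 + 1) = ((cmod x)\<^sup>2 - (cmod y)\<^sup>2) / ((cmod x)\<^sup>2 + (cmod y)\<^sup>2)"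
  proof -
    have y2: "(cmod y)\<^sup>2 \<noteq> 0" using y by simp
    have "(cmod x)\<^sup>2 / (cmod y)\<^sup>2 - 1 = ((cmod x)\<^sup>2 - (cmod y)\<^sup>2) / (cmod y)\<^sup>2"
      "(cmod x)\<^sup>2 / (cmod y)\<^sup>2 + 1 = ((cmod x)\<^sup>2 + (cmod y)\<^sup>2) / (cmod y)\<^sup>2"
      using y2 by (simp_all add: diff_divide_distrib add_divide_distrib)
    then show ?thesis unfolding q using y2 by simp
  qed
  show ?thesis using 1 2 y unfolding N
    by (simp add: proj_def x_def[symmetric] y_def[symmetric])
qed

text \<open>The squared distance of two unit vectors is 2 minus twice their inner product, and
  Lagrange's identity expresses that inner product by the determinant. Metric estimates on the
  sphere thereby become estimates of \<open>br\<close>.\<close>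

lemma dist_proj:
  assumes "X \<noteq> 0" "Y \<noteq> 0"
  shows "dist (proj X) (proj Y) = 2 * cmod (br X Y) / (norm X * norm Y)"
proof -
  obtain x1 y1 x2 y2 where XY: "X = (x1, y1)" "Y = (x2, y2)" by (cases X; cases Y)
  define N M where "N = (norm X)\<^sup>2" and "M = (norm Y)\<^sup>2"
  have N: "N = (cmod x1)\<^sup>2 + (cmod y1)\<^sup>2" "M = (cmod x2)\<^sup>2 + (cmod y2)\<^sup>2"
    by (simp_all add: N_def M_def norm_C2 XY)
  have N0: "N > 0" "M > 0" using assms by (simp_all add: N_def M_def)
  have sq: "(norm (stereo x))\<^sup>2 = 1" for x
  proof -
    have "stereo x \<in> sphere 0 1" using range_stereo by blast
    then show ?thesis by simp
  qed
  define u v where "u = stereo (proj X)" and "v = stereo (proj Y)"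
  have "(dist (proj X) (proj Y))\<^sup>2 = (norm (u - v))\<^sup>2"
    by (simp add: dist_riemann_sphere_def dist_norm u_def v_def)
  also have "\<dots> = 2 - 2 * (u \<bullet> v)"
    using sq[of "proj X"] sq[of "proj Y"]
    by (simp add: power2_norm_eq_inner inner_diff inner_commute u_def v_def)
  also have "u \<bullet> v = 4 * Re (x1 * cnj y1 * cnj (x2 * cnj y2)) / (N * M)
      + ((cmod x1)\<^sup>2 - (cmod y1)\<^sup>2) * ((cmod x2)\<^sup>2 - (cmod y2)\<^sup>2) / (N * M)"
  proof -
    have uc: "fst u = (2 / N) *\<^sub>R (x1 * cnj y1)" "fst v = (2 / M) *\<^sub>R (x2 * cnj y2)"
      unfolding u_def v_def stereo_proj[OF assms(1)] stereo_proj[OF assms(2)]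
      by (simp_all add: XY N_def M_def scaleR_conv_of_real)
    have us: "snd u = ((cmod x1)\<^sup>2 - (cmod y1)\<^sup>2) / N" "snd v = ((cmod x2)\<^sup>2 - (cmod y2)\<^sup>2) / M"
      unfolding u_def v_def stereo_proj[OF assms(1)] stereo_proj[OF assms(2)]
      by (simp_all add: XY N_def M_def)
    have "u \<bullet> v = fst u \<bullet> fst v + snd u * snd v" by (simp add: inner_prod_def)
    also have "fst u \<bullet> fst v = 4 / (N * M) * ((x1 * cnj y1) \<bullet> (x2 * cnj y2))"
      unfolding uc by simp
    also have "(x1 * cnj y1) \<bullet> (x2 * cnj y2) = Re (x1 * cnj y1 * cnj (x2 * cnj y2))"
    proof -
      have "a \<bullet> b = Re (a * cnj b)" for a b :: complex by (simp add: inner_complex_def)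
      then show ?thesis by blast
    qed
    finally show ?thesis unfolding us by simp
  qed
  also have "2 - 2 * \<dots> = (2 * cmod (br X Y) / (norm X * norm Y))\<^sup>2"
  proof -
    have b: "(cmod (br X Y))\<^sup>2 = (cmod x1)\<^sup>2 * (cmod y2)\<^sup>2 + (cmod x2)\<^sup>2 * (cmod y1)\<^sup>2
        - 2 * Re (x1 * cnj y1 * cnj (x2 * cnj y2))"
      unfolding XY br_def cmod_power2 fst_conv snd_conv mult.assoc complex_cnj_mult complex_cnj_cnj
        minus_complex.simps times_complex.simps cnj.simps by algebra
    have "4 * Re (x1 * cnj y1 * cnj (x2 * cnj y2)) / (N * M)
      + ((cmod x1)\<^sup>2 - (cmod y1)\<^sup>2) * ((cmod x2)\<^sup>2 - (cmod y2)\<^sup>2) / (N * M)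
      = (N * M - 2 * (cmod (br X Y))\<^sup>2) / (N * M)"
      unfolding b add_divide_distrib[symmetric] unfolding N by (simp add: algebra_simps)
    also have "\<dots> = 1 - 2 * (cmod (br X Y))\<^sup>2 / (N * M)"
      using N0 by (simp add: diff_divide_distrib)
    finally have e: "4 * Re (x1 * cnj y1 * cnj (x2 * cnj y2)) / (N * M)
      + ((cmod x1)\<^sup>2 - (cmod y1)\<^sup>2) * ((cmod x2)\<^sup>2 - (cmod y2)\<^sup>2) / (N * M) = \<dots>" .
    show ?thesis unfolding e by (simp add: N_def M_def power_divide power_mult_distrib)
  qed
  finally show ?thesis by (subst (asm) power2_eq_iff_nonneg) auto
qed

lemma proj_eq_iff:
  assumes "X \<noteq> 0" "Y \<noteq> 0"
  shows "proj X = proj Y \<longleftrightarrow> br X Y = 0"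
  using dist_proj[OF assms] assms by (metis dist_eq_0_iff divide_eq_0_iff mult_eq_0_iff norm_eq_zero zero_neq_numeral)

lemma continuous_on_stereo_iff:
  fixes f :: "'a::metric_space \<Rightarrow> riemann_sphere"
  shows "continuous_on S f \<longleftrightarrow> continuous_on S (\<lambda>x. stereo (f x))"
  unfolding continuous_on_iff dist_riemann_sphere_def by (rule refl)

lemma continuous_on_stereo: "continuous_on S stereo"
  using continuous_on_stereo_iff[of S "\<lambda>x. x"] by simp

lemma continuous_on_proj: "continuous_on (- {0}) proj"
proof -
  have "continuous_on (- {0}) (\<lambda>X::C2. (2 * fst X * cnj (snd X) / of_real ((norm X)\<^sup>2),
           ((cmod (fst X))\<^sup>2 - (cmod (snd X))\<^sup>2) / (norm X)\<^sup>2))"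
    by (intro continuous_intros) auto
  then have "continuous_on (- {0}) (\<lambda>X. stereo (proj X))"
    by (rule continuous_on_eq) (simp add: stereo_proj)
  then show ?thesis by (simp add: continuous_on_stereo_iff)
qed

lemma proj_surj: "\<exists>X. norm X = 1 \<and> proj X = x"
proof -
  have "\<exists>X. X \<noteq> 0 \<and> proj X = x"
    by (cases x) (metis proj_Fin prod.sel(2) snd_zero zero_neq_one, metis proj_Infty fst_conv fst_zero zero_neq_one)
  then obtain X where X: "X \<noteq> 0" "proj X = x" by blast
  have "norm (scl (of_real (1 / norm X)) X) = 1" using X by (simp add: norm_divide)
  moreover have "proj (scl (of_real (1 / norm X)) X) = x" using X by simp
  ultimately show ?thesis by blast
qed

section \<open>Topology of the sphere\<close>

lemma proj_sphere: "proj ` sphere 0 1 = UNIV"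
proof -
  have "x \<in> proj ` sphere 0 1" for x using proj_surj[of x] by (metis image_eqI mem_sphere_0)
  then show ?thesis by auto
qed

lemma compact_riemann_sphere: "compact (UNIV :: riemann_sphere set)"
  unfolding proj_sphere[symmetric]
  by (intro compact_continuous_image continuous_on_subset[OF continuous_on_proj]) auto

lemma closed_imp_compact_rs: "closed (S :: riemann_sphere set) \<Longrightarrow> compact S"
  using compact_Int_closed[OF compact_riemann_sphere, of S] by simp

lemma connected_riemann_sphere: "connected (UNIV :: riemann_sphere set)"
  unfolding proj_sphere[symmetric]
  by (intro connected_continuous_image continuous_on_subset[OF continuous_on_proj] connected_sphere) auto

text \<open>The unit sphere is compact, so \<open>proj\<close> is a closed map on it and therefore a
  quotient map.\<close>

lemma continuous_on_proj_quotient: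
  fixes f :: "riemann_sphere \<Rightarrow> 'a::metric_space"
  assumes "continuous_on (sphere 0 1) (\<lambda>X. f (proj X))"
  shows "continuous_on UNIV f"
  unfolding continuous_on_closed_vimage[OF closed_UNIV]
proof (intro allI impI)
  fix B :: "'a set" assume B: "closed B"
  have "closed ((\<lambda>X. f (proj X)) -` B \<inter> sphere 0 1)"
    using assms B continuous_on_closed_vimage[OF closed_sphere, of 0 1 "\<lambda>X. f (proj X)"] by blast
  then have "compact ((\<lambda>X. f (proj X)) -` B \<inter> sphere 0 1)"
    by (metis compact_Int_closed compact_sphere inf_commute inf_left_idem)
  then have "compact (proj ` ((\<lambda>X. f (proj X)) -` B \<inter> sphere 0 1))"
    by (intro compact_continuous_image continuous_on_subset[OF continuous_on_proj]) auto
  moreover have "proj ` ((\<lambda>X. f (proj X)) -` B \<inter> sphere 0 1) = f -` B \<inter> UNIV"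
  proof -
    have "x \<in> proj ` ((\<lambda>X. f (proj X)) -` B \<inter> sphere 0 1)" if x: "x \<in> f -` B" for x
    proof -
      obtain X where "norm X = 1" "proj X = x" using proj_surj by blast
      then show ?thesis using x by (intro image_eqI[of _ _ X]) auto
    qed
    then show ?thesis by auto
  qed
  ultimately show "closed (f -` B \<inter> UNIV)" by (metis compact_imp_closed)
qed

lemma closure_image_rs:
  fixes f :: "riemann_sphere \<Rightarrow> riemann_sphere"
  assumes "continuous_on UNIV f"
  shows "closure (f ` A) = f ` closure A"
proof
  have "compact (f ` closure A)"
    by (rule compact_continuous_image[OF continuous_on_subset[OF assms subset_UNIV] closed_imp_compact_rs[OF closed_closure]])
  then show "closure (f ` A) \<subseteq> f ` closure A"
    using closure_subset[of A] by (intro closure_minimal image_mono compact_imp_closed)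
  show "f ` closure A \<subseteq> closure (f ` A)"
    by (rule image_closure_subset[OF continuous_on_subset[OF assms] closed_closure closure_subset]) simp
qed

lemma homeomorphism_stereo: "\<exists>g. homeomorphism (UNIV :: riemann_sphere set) (sphere 0 1) stereo g"
  using homeomorphism_compact[OF compact_riemann_sphere continuous_on_stereo range_stereo inj_stereo]
  by blast

lemma locally_connected_rs: "locally connected (UNIV :: riemann_sphere set)"
proof -
  have "(UNIV :: riemann_sphere set) homeomorphic (sphere 0 1 :: (complex \<times> real) set)"
    using homeomorphism_stereo homeomorphic_def by blast
  then show ?thesis
    using homeomorphic_locally[of UNIV _ connected connected] homeomorphic_connectedness locally_connected_sphere by blast
qed

lemma open_components_rs:
  fixes S :: "riemann_sphere set"
  assumes "open S" "C \<in> components S"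
  shows "open C"
proof -
  have "locally connected S"
    using locally_open_subset[OF locally_connected_rs, of S] assms by simp
  then have "openin (top_of_set S) C"
    using assms(2) openin_components_locally_connected by blast
  then show ?thesis using assms(1) openin_open_eq by blast
qed

text \<open>Unicoherence is transported along \<open>stereo\<close> from the round sphere, which has
  it because it is Borsukian.\<close>

lemma unicoherent_rs:
  fixes S T :: "riemann_sphere set"
  assumes "closed S" "closed T" "connected S" "connected T" "S \<union> T = UNIV"
  shows "connected (S \<inter> T)"
proof -
  obtain g where g: "homeomorphism (UNIV :: riemann_sphere set) (sphere 0 1) stereo g"
    using homeomorphism_stereo by blast
  have gs: "g (stereo x) = x" for x using g by (simp add: homeomorphism_def)
  have cl: "closed A \<Longrightarrow> closedin (top_of_set (sphere 0 1)) (stereo ` A)" for A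
    using closed_imp_compact_rs[of A] range_stereo
    by (intro closed_subset compact_imp_closed compact_continuous_image continuous_on_stereo) auto
  have co: "connected A \<Longrightarrow> connected (stereo ` A)" for A
    by (intro connected_continuous_image continuous_on_stereo)
  have "unicoherent (sphere (0 :: complex \<times> real) 1)"
    by (intro Borsukian_imp_unicoherent Borsukian_sphere) simp
  moreover have "stereo ` S \<union> stereo ` T = sphere 0 1"
    using assms(5) range_stereo by (metis image_Un)
  ultimately have "connected (stereo ` S \<inter> stereo ` T)"
    using cl[OF assms(1)] cl[OF assms(2)] co[OF assms(3)] co[OF assms(4)]
    by (auto intro: unicoherentD)
  then have "connected (g ` (stereo ` S \<inter> stereo ` T))"
    by (rule connected_continuous_image[OF continuous_on_subset[OF homeomorphism_cont2[OF g]], rotated])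
      (use range_stereo in auto)
  also have "g ` (stereo ` S \<inter> stereo ` T) = S \<inter> T"
    unfolding image_Int[OF inj_stereo, symmetric] image_image gs by simp
  finally show ?thesis .
qed

section \<open>Charts at finite points and at infinity\<close>

lemma continuous_on_Fin: "continuous_on S Fin"
proof -
  have "continuous_on UNIV (\<lambda>z. proj (z, 1))"
    by (intro continuous_on_compose2[OF continuous_on_proj] continuous_intros) (auto simp: prod_eq_iff)
  then have "continuous_on UNIV Fin" by (simp add: proj_Fin)
  then show ?thesis by (rule continuous_on_subset) simp
qed

text \<open>The inverse of \<open>Fin\<close>; the value at \<open>Infty\<close> is a
  default.\<close>

definition coord :: "riemann_sphere \<Rightarrow> complex" where
  "coord x = (case x of Fin z \<Rightarrow> z | Infty \<Rightarrow> 0)"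

lemma coord_Fin [simp]: "coord (Fin z) = z" by (simp add: coord_def)

lemma range_Fin: "range Fin = - {Infty}"
proof -
  have "x \<in> range Fin" if "x \<noteq> Infty" for x using that by (cases x) auto
  then show ?thesis by auto
qed

lemma continuous_on_coord: "continuous_on (- {Infty}) coord"
proof -
  have e: "coord x = fst (stereo x) / of_real (1 - snd (stereo x))" and n: "1 - snd (stereo x) \<noteq> 0" if "x \<noteq> Infty" for x
  proof -
    obtain z where z: "x = Fin z" using \<open>x \<noteq> Infty\<close> by (cases x) auto
    have s: "1 - snd (stereo x) = 2 / (1 + (cmod z)\<^sup>2)"
      unfolding z snd_stereo_Fin by simp
    have p: "2 / (1 + (cmod z)\<^sup>2) \<noteq> 0" using one_plus_cmod_sq_pos[of z] by simp
    show "1 - snd (stereo x) \<noteq> 0" using s p by simp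
    have "fst (stereo x) = of_real (2 / (1 + (cmod z)\<^sup>2)) * z" by (simp add: z)
    then show "coord x = fst (stereo x) / of_real (1 - snd (stereo x))"
      unfolding s using p by (metis coord_Fin z nonzero_mult_div_cancel_left of_real_eq_0_iff)
  qed
  have "continuous_on (- {Infty}) (\<lambda>x. fst (stereo x) / of_real (1 - snd (stereo x)))"
    by (intro continuous_intros continuous_on_stereo) (use n in auto)
  then show ?thesis by (rule continuous_on_eq) (use e in auto)
qed

lemma open_Fin_image: "open W \<Longrightarrow> open (Fin ` W)"
proof -
  assume W: "open W"
  have "open (- {Infty} :: riemann_sphere set)" by (simp add: open_Compl)
  then have "open (coord -` W \<inter> - {Infty})"
    using continuous_on_coord W by (simp add: continuous_on_open_vimage)
  moreover have "coord -` W \<inter> - {Infty} = Fin ` W"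
    by (auto simp: range_Fin[symmetric] image_iff)
  ultimately show ?thesis by simp
qed

text \<open>The inversion of the sphere. It exchanges the homogeneous coordinates, is an isometry of
  the chordal metric, and serves to move poles to finite points.\<close>

definition swapS :: "riemann_sphere \<Rightarrow> riemann_sphere" where
  "swapS x = (case x of Infty \<Rightarrow> Fin 0 | Fin z \<Rightarrow> if z = 0 then Infty else Fin (1 / z))"

lemma swapS_proj: "X \<noteq> 0 \<Longrightarrow> swapS (proj X) = proj (snd X, fst X)"
  by (auto simp: swapS_def proj_def prod_eq_iff)

lemma swapS_swapS [simp]: "swapS (swapS x) = x"
  by (cases x) (auto simp: swapS_def)

lemma dist_swapS [simp]: "dist (swapS x) (swapS y) = dist x y"
proof -
  obtain X Y where "norm X = 1" "proj X = x" "norm Y = 1" "proj Y = y" using proj_surj by metis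
  moreover have "cmod (br (snd X, fst X) (snd Y, fst Y)) = cmod (br X Y)"
    unfolding br_def by simp (metis norm_minus_commute mult.commute)
  moreover have "norm (snd Z, fst Z) = norm Z" for Z :: C2
    by (metis norm_ge_zero norm_C2 fst_conv snd_conv add.commute power2_eq_iff_nonneg)
  moreover have "X \<noteq> 0" "Y \<noteq> 0" "(snd X, fst X) \<noteq> 0" "(snd Y, fst Y) \<noteq> 0"
    using calculation by (metis norm_zero zero_neq_one)+
  ultimately show ?thesis using dist_proj[of X Y] dist_proj[of "(snd X, fst X)" "(snd Y, fst Y)"]
    swapS_proj[of X] swapS_proj[of Y] by simp
qed

lemma continuous_on_swapS: "continuous_on S swapS"
  unfolding continuous_on_iff by auto

lemma open_swapS_image: "open W \<Longrightarrow> open (swapS ` W)"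
proof -
  assume "open W"
  then have "open (swapS -` W \<inter> UNIV)"
    using continuous_on_open_vimage[of UNIV swapS] continuous_on_swapS by (metis open_UNIV)
  moreover have "swapS -` W \<inter> UNIV = swapS ` W"
    by (auto simp: image_iff) (metis swapS_swapS)+
  ultimately show ?thesis by simp
qed

text \<open>Charts are affine lines \<open>A + scl t B\<close> that avoid the origin, because a
  homogeneous lift restricts to such a line as a pair of polynomials, whether or not
  \<open>x\<close> is \<open>Infty\<close>.\<close>

lemma local_chart:
  obtains A B t0 where "\<And>t. A + scl t B \<noteq> 0" "proj (A + scl t0 B) = x" "br A B \<noteq> 0"
    "\<And>W. open W \<Longrightarrow> open ((\<lambda>t. proj (A + scl t B)) ` W)"
proof (cases x)
  case (Fin z)
  have "(\<lambda>t. proj ((0, 1) + scl t (1, 0))) = Fin" by (simp add: scl_def proj_def fun_eq_iff)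
  then show ?thesis
    by (intro that[of "(0,1)" "(1,0)" z]) (auto simp: scl_def prod_eq_iff br_def Fin proj_def open_Fin_image)
next
  case Infty
  have "proj ((1, 0) + scl t (0, 1)) = swapS (Fin t)" for t by (simp add: scl_def proj_def swapS_def)
  then have "(\<lambda>t. proj ((1, 0) + scl t (0, 1))) ` W = swapS ` (Fin ` W)" for W by (simp add: image_image)
  then show ?thesis
    by (intro that[of "(1,0)" "(0,1)" 0]) (auto simp: scl_def prod_eq_iff br_def Infty proj_def open_Fin_image open_swapS_image)
qed

lemma continuous_on_chart:
  assumes "\<And>t. A + scl t B \<noteq> 0"
  shows "continuous_on S (\<lambda>t. proj (A + scl t B))"
  by (rule continuous_on_compose2[OF continuous_on_proj])
    (use assms in \<open>auto simp: scl_def intro!: continuous_intros\<close>)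

section \<open>Homogeneous lifts of rational maps\<close>

text \<open>The last clause says that \<open>H\<close> is polynomial, in a form that is visibly stable under composition.\<close>

definition hom_lift :: "(C2 \<Rightarrow> C2) \<Rightarrow> nat \<Rightarrow> (riemann_sphere \<Rightarrow> riemann_sphere) \<Rightarrow> bool" where
  "hom_lift H D R \<longleftrightarrow> continuous_on UNIV H \<and> (\<forall>c X. H (scl c X) = scl (c ^ D) (H X)) \<and>
     (\<forall>X. X \<noteq> 0 \<longrightarrow> H X \<noteq> 0 \<and> R (proj X) = proj (H X)) \<and>
     (\<forall>a b. \<exists>p q. \<forall>t. H (poly a t, poly b t) = (poly p t, poly q t))"

lemma hom_lift_id: "hom_lift (\<lambda>X. X) 1 (\<lambda>x. x)"
  by (auto simp: hom_lift_def)

lemma hom_lift_comp: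
  assumes "hom_lift H D R" "hom_lift G E Q"
  shows "hom_lift (\<lambda>X. H (G X)) (D * E) (\<lambda>x. R (Q x))"
  unfolding hom_lift_def
proof (intro conjI allI impI)
  show "continuous_on UNIV (\<lambda>X. H (G X))"
    using assms by (auto simp: hom_lift_def intro: continuous_on_compose2)
  show "H (G (scl c X)) = scl (c ^ (D * E)) (H (G X))" for c X
  proof -
    have "\<And>c X. H (scl c X) = scl (c ^ D) (H X)" "\<And>c X. G (scl c X) = scl (c ^ E) (G X)"
      using assms unfolding hom_lift_def by blast+
    then show ?thesis by (simp add: power_mult[symmetric] mult.commute)
  qed
  show "H (G X) \<noteq> 0" "R (Q (proj X)) = proj (H (G X))" if "X \<noteq> 0" for X
    using assms that unfolding hom_lift_def by metis+
  show "\<exists>p q. \<forall>t. H (G (poly a t, poly b t)) = (poly p t, poly q t)" for a b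
    using assms unfolding hom_lift_def by metis
qed

lemma hom_lift_funpow:
  assumes "hom_lift H D R"
  shows "\<exists>H'. hom_lift H' (D ^ n) (R ^^ n)"
proof (induction n)
  case 0
  show ?case using hom_lift_id by (auto simp: id_def)
next
  case (Suc n)
  then obtain H' where "hom_lift H' (D ^ n) (R ^^ n)" by blast
  from hom_lift_comp[OF assms this] show ?case by (auto simp: comp_def)
qed

definition homogenize :: "complex poly \<Rightarrow> nat \<Rightarrow> complex \<Rightarrow> complex \<Rightarrow> complex" where
  "homogenize p d x y = (\<Sum>i\<le>d. coeff p i * x ^ i * y ^ (d - i))"

lemma homogenize_nonzero:
  assumes "degree p \<le> d" "y \<noteq> 0"
  shows "homogenize p d x y = y ^ d * poly p (x / y)"
proof -
  have "poly p (x / y) = (\<Sum>i\<le>d. coeff p i * (x / y) ^ i)"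
    unfolding poly_altdef using assms(1) by (intro sum.mono_neutral_left) (auto simp: coeff_eq_0)
  then show ?thesis
    using assms(2) unfolding homogenize_def
    by (auto simp: sum_distrib_left power_divide power_diff intro!: sum.cong)
qed

lemma homogenize_0: "homogenize p d x 0 = coeff p d * x ^ d"
proof -
  have "homogenize p d x 0 = (\<Sum>i\<le>d. if i = d then coeff p d * x ^ d else 0)"
    unfolding homogenize_def by (intro sum.cong) auto
  then show ?thesis by simp
qed

text \<open>Common zeros are excluded by coprimality where the second coordinate is nonzero, and at
  infinity because one of \<open>p\<close>, \<open>q\<close> has degree exactly
  \<open>d\<close>.\<close>

lemma rational_map_hom_lift:
  assumes "q \<noteq> 0" "coprime p q" "d = max (degree p) (degree q)"
  shows "hom_lift (\<lambda>X. (homogenize p d (fst X) (snd X), homogenize q d (fst X) (snd X))) d (rational_map p q)"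
  unfolding hom_lift_def
proof (intro conjI allI impI)
  have cp: "coprime p q \<Longrightarrow> poly p z \<noteq> 0 \<or> poly q z \<noteq> 0" for z
    by (rule coprime_poly_0)
  show "continuous_on UNIV (\<lambda>X. (homogenize p d (fst X) (snd X), homogenize q d (fst X) (snd X)))"
    unfolding homogenize_def by (intro continuous_intros)
  show "(homogenize p d (fst (scl c X)) (snd (scl c X)), homogenize q d (fst (scl c X)) (snd (scl c X))) =
      scl (c ^ d) (homogenize p d (fst X) (snd X), homogenize q d (fst X) (snd X))" for c X
  proof -
    have "homogenize r d (c * x) (c * y) = c ^ d * homogenize r d x y" for r x y
      unfolding homogenize_def sum_distrib_left
    proof (intro sum.cong refl)
      fix i assume "i \<in> {..d}"
      then have "c ^ d = c ^ i * c ^ (d - i)" by (simp add: power_add[symmetric])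
      then show "coeff r i * (c * x) ^ i * (c * y) ^ (d - i) = c ^ d * (coeff r i * x ^ i * y ^ (d - i))"
        by (simp add: power_mult_distrib)
    qed
    then show ?thesis by (simp add: scl_def)
  qed
  show "\<exists>p' q'. \<forall>t. (homogenize p d (fst (poly a t, poly b t)) (snd (poly a t, poly b t)),
         homogenize q d (fst (poly a t, poly b t)) (snd (poly a t, poly b t))) = (poly p' t, poly q' t)" for a b
  proof -
    have "homogenize r d (poly a t) (poly b t) = poly (\<Sum>i\<le>d. smult (coeff r i) (a ^ i * b ^ (d - i))) t" for r t
      by (simp add: homogenize_def poly_sum mult.assoc)
    then show ?thesis by auto
  qed
  fix X :: C2 assume X: "X \<noteq> 0"
  obtain x y where xy: "X = (x, y)" by (cases X)
  have dp: "degree p \<le> d" "degree q \<le> d" using assms by auto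
  show "(homogenize p d (fst X) (snd X), homogenize q d (fst X) (snd X)) \<noteq> 0"
  proof (cases "y = 0")
    case True
    then have x: "x \<noteq> 0" using X xy by (auto simp: prod_eq_iff)
    have "coeff p d \<noteq> 0 \<or> coeff q d \<noteq> 0"
      using assms by (cases "degree p > degree q") (auto simp: max_def)
    then have "homogenize p d x 0 \<noteq> 0 \<or> homogenize q d x 0 \<noteq> 0"
      using x by (simp add: homogenize_0)
    then show ?thesis using True by (auto simp: xy prod_eq_iff)
  next
    case False
    then show ?thesis using cp[OF assms(2), of "x / y"] dp
      by (auto simp: xy homogenize_nonzero prod_eq_iff)
  qed
  show "rational_map p q (proj X) = proj (homogenize p d (fst X) (snd X), homogenize q d (fst X) (snd X))"
  proof (cases "y = 0")
    case True
    then have x: "x \<noteq> 0" using X xy by (auto simp: prod_eq_iff)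
    show ?thesis
    proof (cases "degree p > degree q")
      case True
      then show ?thesis using \<open>y = 0\<close> x assms by (simp add: xy proj_def homogenize_0 coeff_eq_0)
    next
      case False
      then have "d = degree q" using assms by simp
      then show ?thesis using \<open>y = 0\<close> x assms False by (simp add: xy proj_def homogenize_0)
    qed
  next
    case False
    then show ?thesis using dp by (simp add: xy proj_def homogenize_nonzero)
  qed
qed

lemma hom_lift_scl: "hom_lift H D R \<Longrightarrow> H (scl c X) = scl (c ^ D) (H X)"
  unfolding hom_lift_def by blast

lemma hom_lift_nz: "hom_lift H D R \<Longrightarrow> X \<noteq> 0 \<Longrightarrow> H X \<noteq> 0"
  unfolding hom_lift_def by blast

lemma hom_lift_proj: "hom_lift H D R \<Longrightarrow> X \<noteq> 0 \<Longrightarrow> R (proj X) = proj (H X)"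
  unfolding hom_lift_def by blast

lemma hom_lift_line:
  assumes "hom_lift H D R"
  shows "\<exists>p q. \<forall>t. H (A + scl t B) = (poly p t, poly q t)"
proof -
  have "A + scl t B = (poly [:fst A, fst B:] t, poly [:snd A, snd B:] t)" for t
    by (simp add: scl_def prod_eq_iff)
  then show ?thesis using assms unfolding hom_lift_def by presburger
qed

lemma hom_lift_continuous:
  assumes "hom_lift H D R"
  shows "continuous_on S R"
proof -
  have H: "continuous_on UNIV H" using assms unfolding hom_lift_def by blast
  have "X \<noteq> 0" if "X \<in> sphere 0 1" for X :: C2
    using that by (metis mem_sphere_0 norm_zero zero_neq_one)
  then have nz: "X \<noteq> 0" "H X \<noteq> 0" if "X \<in> sphere 0 1" for X using that hom_lift_nz[OF assms] by blast+
  have "continuous_on (sphere 0 1) (\<lambda>X. proj (H X))"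
  proof (rule continuous_on_compose2[OF continuous_on_proj])
    show "continuous_on (sphere 0 1) H" using continuous_on_subset[OF H subset_UNIV] .
    show "H ` sphere 0 1 \<subseteq> - {0}" using nz(2) by (intro image_subsetI) simp
  qed
  then have "continuous_on (sphere 0 1) (\<lambda>X. R (proj X))"
    by (rule continuous_on_eq) (use hom_lift_proj[OF assms] nz in metis)
  then show ?thesis using continuous_on_proj_quotient continuous_on_subset by blast
qed

section \<open>Open mapping and finite fibres\<close>

text \<open>A disc is uncountable, so finite fibres exclude a constant function and the holomorphic
  open mapping theorem applies.\<close>

lemma open_mapping_at:
  fixes f :: "complex \<Rightarrow> complex"
  assumes "f holomorphic_on ball t r" "r > 0" and fin: "\<And>w. finite {s \<in> ball t r. f s = w}" and "open U" "t \<in> U"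
  shows "\<exists>V. open V \<and> f t \<in> V \<and> V \<subseteq> f ` (U \<inter> ball t r)"
proof (intro exI conjI)
  show "open (f ` (U \<inter> ball t r))"
  proof (rule open_mapping_thm[OF assms(1)])
    show "\<not> f constant_on ball t r"
    proof
      assume "f constant_on ball t r"
      then obtain w where w: "\<And>s. s \<in> ball t r \<Longrightarrow> f s = w" unfolding constant_on_def by blast
      then have sub: "ball t r \<subseteq> {s \<in> ball t r. f s = w}" by blast
      have "finite (ball t r)" by (rule finite_subset[OF sub fin])
      then have "countable (ball t r)" by (rule countable_finite)
      then show False using uncountable_ball[OF \<open>r > 0\<close>, of t] by simp
    qed
  qed (use assms in auto)
qed (use assms in auto)

lemma proj_pair_open_at:
  assumes holo: "f holomorphic_on UNIV" "g holomorphic_on UNIV" and nz: "g t \<noteq> 0"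
    and fin: "\<And>w. finite {s. proj (f s, g s) = w}" and U: "open U" "t \<in> U"
  shows "\<exists>V. open V \<and> proj (f t, g t) \<in> V \<and> V \<subseteq> (\<lambda>s. proj (f s, g s)) ` U"
proof -
  have "open (g -` (- {0}) \<inter> UNIV)"
    using holomorphic_on_imp_continuous_on[OF holo(2)]
    by (simp add: continuous_on_open_vimage open_Compl)
  then obtain r where r: "r > 0" "\<And>s. s \<in> ball t r \<Longrightarrow> g s \<noteq> 0"
    using nz unfolding open_contains_ball subset_eq by (metis ComplD IntI UNIV_I Int_iff singletonI vimageD vimageI ComplI singletonD)
  have e: "proj (f s, g s) = Fin (f s / g s)" if "s \<in> ball t r" for s
    using r(2)[OF that] by (simp add: proj_def)
  have "\<exists>V. open V \<and> f t / g t \<in> V \<and> V \<subseteq> (\<lambda>s. f s / g s) ` (U \<inter> ball t r)"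
  proof (rule open_mapping_at)
    show "(\<lambda>s. f s / g s) holomorphic_on ball t r"
      using holo r(2) by (intro holomorphic_intros) (auto intro: holomorphic_on_subset)
    show "finite {s \<in> ball t r. f s / g s = w}" for w
      by (rule finite_subset[OF _ fin[of "Fin w"]]) (use e in auto)
  qed (use r U in auto)
  then obtain V where V: "open V" "f t / g t \<in> V" "V \<subseteq> (\<lambda>s. f s / g s) ` (U \<inter> ball t r)" by blast
  have "Fin ` V \<subseteq> (\<lambda>s. proj (f s, g s)) ` U"
  proof
    fix y assume "y \<in> Fin ` V"
    then obtain s where "s \<in> U" "s \<in> ball t r" "y = Fin (f s / g s)" using V(3) by blast
    then show "y \<in> (\<lambda>s. proj (f s, g s)) ` U" using e[of s] by (intro image_eqI[of _ _ s]) simp_all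
  qed
  moreover have "proj (f t, g t) \<in> Fin ` V" using V(2) e[of t] r(1) by auto
  ultimately show ?thesis using open_Fin_image[OF V(1)] by blast
qed

lemma chart_inj:
  assumes "br A B \<noteq> 0" "\<And>t. A + scl t B \<noteq> 0" "proj (A + scl t B) = proj (A + scl s B)"
  shows "t = s"
proof -
  have "br (A + scl t B) (A + scl s B) = 0" using assms proj_eq_iff by blast
  then have "(s - t) * br A B = 0" using br_swap[of B A] by (simp add: br_add_left br_add_right algebra_simps)
  then show ?thesis using assms(1) by simp
qed

text \<open>In a chart \<open>R\<close> becomes a quotient of two polynomials with finite fibres, to
  which the open mapping theorem applies; at a pole the quotient is first inverted by
  \<open>swapS\<close>.\<close>

lemma hom_lift_open:
  assumes H: "hom_lift H D R" and fin: "\<And>y. finite (R -` {y})" and U: "open U"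
  shows "open (R ` U)"
  unfolding open_subopen[of "R ` U"]
proof
  fix y assume "y \<in> R ` U"
  then obtain x where x: "x \<in> U" "y = R x" by blast
  obtain A B t0 where c: "\<And>t. A + scl t B \<noteq> 0" "proj (A + scl t0 B) = x" "br A B \<noteq> 0"
    using local_chart by metis
  define \<phi> where "\<phi> t = proj (A + scl t B)" for t
  obtain p q where pq: "\<And>t. H (A + scl t B) = (poly p t, poly q t)"
    using hom_lift_line[OF H] by blast
  have R\<phi>: "R (\<phi> t) = proj (poly p t, poly q t)" for t
    unfolding \<phi>_def hom_lift_proj[OF H c(1)] pq by simp
  have "continuous_on UNIV \<phi>" unfolding \<phi>_def by (rule continuous_on_chart) (rule c(1))
  then have W: "open (\<phi> -` U)" using U by (simp add: continuous_on_open_vimage)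
  have t0: "t0 \<in> \<phi> -` U" using x c(2) by (simp add: \<phi>_def)
  have "finite {s. R (\<phi> s) = w}" for w
  proof (rule finite_imageD[of \<phi>])
    show "finite (\<phi> ` {s. R (\<phi> s) = w})" by (rule finite_subset[OF _ fin[of w]]) auto
    show "inj_on \<phi> {s. R (\<phi> s) = w}"
      using chart_inj[OF c(3) c(1)] unfolding \<phi>_def inj_on_def by blast
  qed
  then have fin': "finite {s. proj (poly p s, poly q s) = w}" for w by (simp add: R\<phi>)
  have "\<exists>V. open V \<and> R (\<phi> t0) \<in> V \<and> V \<subseteq> (\<lambda>s. R (\<phi> s)) ` (\<phi> -` U)"
  proof (cases "poly q t0 = 0")
    case False
    then show ?thesis unfolding R\<phi>
      by (intro proj_pair_open_at W t0 fin') (auto intro!: holomorphic_intros)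
  next
    case True
    have nz: "(poly p s, poly q s) \<noteq> 0" for s using hom_lift_nz[OF H c(1)] pq by metis
    then have sw: "swapS (proj (poly p s, poly q s)) = proj (poly q s, poly p s)" for s
      using swapS_proj by fastforce
    have "poly p t0 \<noteq> 0" using nz[of t0] True by (auto simp: prod_eq_iff)
    moreover have "finite {s. proj (poly q s, poly p s) = w}" for w
      by (rule finite_subset[OF _ fin'[of "swapS w"]]) (auto simp flip: sw)
    ultimately have "\<exists>V. open V \<and> proj (poly q t0, poly p t0) \<in> V \<and> V \<subseteq> (\<lambda>s. proj (poly q s, poly p s)) ` (\<phi> -` U)"
      by (intro proj_pair_open_at W t0) (auto intro!: holomorphic_intros)
    then obtain V where V: "open V" "proj (poly q t0, poly p t0) \<in> V" "V \<subseteq> (\<lambda>s. proj (poly q s, poly p s)) ` (\<phi> -` U)"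
      by blast
    have "proj (poly p t0, poly q t0) \<in> swapS ` V"
      using V(2) by (metis image_eqI sw swapS_swapS)
    moreover have "swapS ` V \<subseteq> (\<lambda>s. proj (poly p s, poly q s)) ` (\<phi> -` U)"
      using V(3) by (auto simp: image_iff subset_iff) (metis sw swapS_swapS)
    ultimately show ?thesis unfolding R\<phi> using open_swapS_image[OF V(1)] by blast
  qed
  then show "\<exists>T. open T \<and> y \<in> T \<and> T \<subseteq> R ` U"
    using x c(2) unfolding \<phi>_def by blast
qed

text \<open>Preimages in the plane are roots of \<open>q\<close> or of \<open>p - smult w q\<close>,
  polynomials of degree at most \<open>max (degree p) (degree q)\<close>; the summand 1 accounts for
  \<open>Infty\<close>.\<close>

lemma rational_map_fibre:
  assumes "q \<noteq> 0" "coprime p q" "max (degree p) (degree q) \<ge> 1"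
  shows "finite (rational_map p q -` {y}) \<and> card (rational_map p q -` {y}) \<le> max (degree p) (degree q) + 1"
proof -
  define d where "d = max (degree p) (degree q)"
  have gen: "finite (rational_map p q -` {y}) \<and> card (rational_map p q -` {y}) \<le> d + 1"
    if r: "r \<noteq> 0" "degree r \<le> d" "\<And>z. rational_map p q (Fin z) = y \<Longrightarrow> poly r z = 0" for r
  proof -
    let ?Z = "{z. poly r z = 0}"
    have f: "finite ?Z" "card ?Z \<le> d" using poly_roots_finite[OF r(1)] card_poly_roots_bound[OF r(1)] r(2) by auto
    have sub: "rational_map p q -` {y} \<subseteq> insert Infty (Fin ` ?Z)"
    proof
      fix x assume "x \<in> rational_map p q -` {y}"
      then show "x \<in> insert Infty (Fin ` ?Z)" using r(3) by (cases x) auto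
    qed
    have "card (insert Infty (Fin ` ?Z)) \<le> Suc (card (Fin ` ?Z))" using f by (simp add: card_insert_if)
    also have "card (Fin ` ?Z) \<le> card ?Z" using f by (simp add: card_image_le)
    finally have "card (insert Infty (Fin ` ?Z)) \<le> d + 1" using f by simp
    then show ?thesis using sub f by (meson card_mono finite_imageI finite_insert finite_subset order_trans)
  qed
  show ?thesis
  proof (cases y)
    case Infty
    show ?thesis unfolding d_def[symmetric]
      by (rule gen[of q]) (use assms Infty d_def in \<open>auto split: if_splits\<close>)
  next
    case (Fin w)
    show ?thesis unfolding d_def[symmetric]
    proof (rule gen[of "p - smult w q"])
      show "p - smult w q \<noteq> 0"
      proof
        assume "p - smult w q = 0"
        then have p: "p = smult w q" by simp
        then have "q dvd p" by (simp add: dvd_smult)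
        then have "is_unit q" using assms(2) by (metis coprime_absorb_right coprime_commute)
        then have "degree q = 0" using assms(1) by (simp add: is_unit_iff_degree)
        moreover have "degree p \<le> degree q" unfolding p by (rule degree_smult_le)
        ultimately show False using assms(3) by simp
      qed
      show "degree (p - smult w q) \<le> d"
        unfolding d_def by (meson degree_diff_le degree_smult_le max.cobounded1 max.cobounded2 order_trans)
      show "poly (p - smult w q) z = 0" if "rational_map p q (Fin z) = y" for z
        using that Fin by (auto split: if_splits simp: field_simps)
    qed
  qed
qed

lemma open_map_surj:
  fixes R :: "riemann_sphere \<Rightarrow> riemann_sphere"
  assumes "continuous_on UNIV R" "\<And>U. open U \<Longrightarrow> open (R ` U)"
  shows "surj R"
proof -
  have "open (range R)" using assms(2) by simp
  moreover have "closed (range R)"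
    using compact_continuous_image[OF assms(1) compact_riemann_sphere] by (rule compact_imp_closed)
  ultimately show ?thesis using connected_riemann_sphere connected_clopen[of UNIV]
    by (metis UNIV_not_empty closed_closedin image_is_empty open_openin subtopology_UNIV)
qed

text \<open>The dynamical part sees the rational function only through a homogeneous lift of degree
  at least 2 and through its finite fibres of bounded size.\<close>

locale rational_dyn =
  fixes R :: "riemann_sphere \<Rightarrow> riemann_sphere" and H :: "C2 \<Rightarrow> C2" and d :: nat
  assumes lift: "hom_lift H d R" and d2: "d \<ge> 2"
    and fibre: "\<And>y. finite (R -` {y})" and fibre_card: "\<And>y. card (R -` {y}) \<le> d + 1"
begin

lemma contR: "continuous_on S R" by (rule hom_lift_continuous[OF lift])
lemma openR: "open U \<Longrightarrow> open (R ` U)" by (rule hom_lift_open[OF lift fibre])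
lemma surjR: "surj R" by (rule open_map_surj[OF contR openR])

lemma contRn: "continuous_on S (R ^^ n)"
  by (metis hom_lift_continuous hom_lift_funpow lift)

lemma openRn: "open U \<Longrightarrow> open ((R ^^ n) ` U)"
proof (induction n)
  case (Suc n)
  then show ?case using openR[of "(R ^^ n) ` U"] by (simp add: image_image)
qed auto

lemma surjRn: "surj (R ^^ n)"
proof (induction n)
  case (Suc n)
  then show ?case using comp_surj[OF Suc surjR] by simp
qed auto

lemma open_vimageRn: "open U \<Longrightarrow> open ((R ^^ n) -` U)"
  using contRn[of UNIV n] by (simp add: continuous_on_open_vimage)

lemma closed_vimageRn: "closed U \<Longrightarrow> closed ((R ^^ n) -` U)"
  using contRn[of UNIV n] by (simp add: continuous_on_closed_vimage)

lemma fibreRn: "finite ((R ^^ n) -` {y})"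
proof (induction n arbitrary: y)
  case (Suc n)
  have "(R ^^ Suc n) -` {y} = (\<Union>z \<in> R -` {y}. (R ^^ n) -` {z})" by auto
  then show ?case using Suc fibre by (metis finite_UN)
qed auto

end

lemma rational_dyn_exists:
  assumes "rational_function_of_degree R d" "d \<ge> 2"
  shows "\<exists>H. rational_dyn R H d"
proof -
  obtain p q where pq: "q \<noteq> 0" "coprime p q" "R = rational_map p q" "d = max (degree p) (degree q)"
    using assms(1) unfolding rational_function_of_degree_def by blast
  have "d \<ge> 1" using assms(2) by simp
  then have "rational_dyn R (\<lambda>X. (homogenize p d (fst X) (snd X), homogenize q d (fst X) (snd X))) d"
    using rational_map_hom_lift[OF pq(1,2,4)] rational_map_fibre[OF pq(1,2)] assms(2)
    unfolding pq(3) pq(4) by unfold_locales auto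
  then show ?thesis by blast
qed

section \<open>Normality and the Fatou set\<close>

text \<open>Sequences of exponents replace sequences of maps, and convergence is uniform on all of
  \<open>U\<close>, which is easier to transport along \<open>R\<close>. By \<open>fatou_iff\<close>
  the Fatou set is the same, since every point of an open set has a compact ball inside it.\<close>

definition iterates_normal :: "(riemann_sphere \<Rightarrow> riemann_sphere) \<Rightarrow> riemann_sphere set \<Rightarrow> bool" where
  "iterates_normal R U \<longleftrightarrow> (\<forall>\<sigma> :: nat \<Rightarrow> nat. \<exists>r g. strict_mono (r :: nat \<Rightarrow> nat) \<and>
     uniform_limit U (\<lambda>i. R ^^ \<sigma> (r i)) g sequentially)"

lemma fatou_iff: "a \<in> fatou_set R \<longleftrightarrow> (\<exists>U. open U \<and> a \<in> U \<and> iterates_normal R U)"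
proof
  assume "a \<in> fatou_set R"
  then obtain U where U: "open U" "a \<in> U" "normal_family_on (range (\<lambda>i. R ^^ i)) U"
    unfolding fatou_set_def by blast
  obtain e where e: "e > 0" "cball a e \<subseteq> U" using U open_contains_cball_eq by blast
  have "compact (cball a e)" by (intro closed_imp_compact_rs closed_cball)
  have "\<exists>r g. strict_mono (r :: nat \<Rightarrow> nat) \<and> uniform_limit (ball a e) (\<lambda>i. R ^^ \<sigma> (r i)) g sequentially" for \<sigma>
  proof -
    have "range (\<lambda>i. R ^^ \<sigma> i) \<subseteq> range (\<lambda>i. R ^^ i)" by blast
    then obtain r g where "strict_mono (r :: nat \<Rightarrow> nat)"
      "\<And>K. compact K \<Longrightarrow> K \<subseteq> U \<Longrightarrow> uniform_limit K ((\<lambda>i. R ^^ \<sigma> i) \<circ> r) g sequentially"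
      using U(3) unfolding normal_family_on_def by metis
    then have "strict_mono r" "uniform_limit (cball a e) (\<lambda>i. R ^^ \<sigma> (r i)) g sequentially"
      using \<open>compact (cball a e)\<close> e by (auto simp: comp_def)
    then show ?thesis using uniform_limit_on_subset[OF _ ball_subset_cball] by blast
  qed
  then have "iterates_normal R (ball a e)" unfolding iterates_normal_def by blast
  then show "\<exists>U. open U \<and> a \<in> U \<and> iterates_normal R U" using e by (intro exI[of _ "ball a e"]) auto
next
  assume "\<exists>U. open U \<and> a \<in> U \<and> iterates_normal R U"
  then obtain U where U: "open U" "a \<in> U" "iterates_normal R U" by blast
  have "normal_family_on (range (\<lambda>i. R ^^ i)) U"
    unfolding normal_family_on_def
  proof (intro allI impI)
    fix f :: "nat \<Rightarrow> riemann_sphere \<Rightarrow> riemann_sphere"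
    assume "range f \<subseteq> range (\<lambda>i. R ^^ i)"
    then have "\<forall>i. \<exists>n. f i = R ^^ n" by blast
    then obtain \<sigma> where \<sigma>: "\<And>i. f i = R ^^ \<sigma> i" by metis
    obtain r g where "strict_mono (r :: nat \<Rightarrow> nat)" "uniform_limit U (\<lambda>i. R ^^ \<sigma> (r i)) g sequentially"
      using U(3) unfolding iterates_normal_def by blast
    then show "\<exists>r g. strict_mono r \<and> (\<forall>K. compact K \<and> K \<subseteq> U \<longrightarrow> uniform_limit K (f \<circ> r) g sequentially)"
      by (intro exI[of _ r] exI[of _ g]) (auto simp: comp_def \<sigma> intro: uniform_limit_on_subset)
  qed
  then show "a \<in> fatou_set R" using U unfolding fatou_set_def by blast
qed

lemma open_fatou: "open (fatou_set R)"
  unfolding fatou_set_def by blast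

lemma closed_julia: "closed (julia_set R)"
  unfolding julia_set_def using open_fatou by (simp add: closed_Compl)

lemma infinite_subseq:
  assumes "infinite {i::nat. P i}"
  shows "\<exists>r. strict_mono (r :: nat \<Rightarrow> nat) \<and> (\<forall>i. P (r i))"
  using infinite_enumerate[OF assms] by auto

text \<open>Either some value is taken infinitely often, or every bound is exceeded from some index
  on and a subsequence can be chosen recursively.\<close>

lemma nat_seq_subseq:
  fixes \<sigma> :: "nat \<Rightarrow> nat"
  shows "\<exists>r. strict_mono (r :: nat \<Rightarrow> nat) \<and> ((\<exists>c. \<forall>i. \<sigma> (r i) = c) \<or> (\<forall>i. i \<le> \<sigma> (r i)))"
proof (cases "\<exists>c. infinite {i. \<sigma> i = c}")
  case True
  then obtain c where "infinite {i. \<sigma> i = c}" by blast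
  from infinite_subseq[OF this] show ?thesis by blast
next
  case False
  have fin: "finite {i. \<sigma> i < n}" for n
  proof -
    have "{i. \<sigma> i < n} = (\<Union>c<n. {i. \<sigma> i = c})" by auto
    then show ?thesis using False by simp
  qed
  have ex: "\<exists>y>x. n \<le> \<sigma> y" for n x
  proof (rule ccontr)
    assume "\<not> ?thesis"
    then have "\<And>y. y > x \<Longrightarrow> \<sigma> y < n" by (meson not_le)
    then have "{x<..} \<subseteq> {i. \<sigma> i < n}" by auto
    then show False using fin[of n] finite_subset infinite_Ioi by blast
  qed
  have "\<exists>r. \<forall>n. n \<le> \<sigma> (r n) \<and> r n < r (Suc n)"
    by (rule dependent_nat_choice) (use ex in blast)+
  then show ?thesis using strict_mono_Suc_iff by blast
qed

text \<open>A subsequence with constant exponent converges trivially. The remaining condition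
  \<open>i \<le> \<sigma> i\<close> lets later proofs take a fixed number of iterates off the
  exponents.\<close>

lemma iterates_normalI:
  assumes "\<And>\<sigma>. (\<And>i. i \<le> \<sigma> i) \<Longrightarrow> \<exists>r g. strict_mono (r :: nat \<Rightarrow> nat) \<and>
     uniform_limit U (\<lambda>i. R ^^ \<sigma> (r i)) g sequentially"
  shows "iterates_normal R U"
  unfolding iterates_normal_def
proof
  fix \<sigma> :: "nat \<Rightarrow> nat"
  obtain r where r: "strict_mono (r :: nat \<Rightarrow> nat)" "(\<exists>c. \<forall>i. \<sigma> (r i) = c) \<or> (\<forall>i. i \<le> \<sigma> (r i))"
    using nat_seq_subseq by blast
  from r(2) show "\<exists>r g. strict_mono (r :: nat \<Rightarrow> nat) \<and> uniform_limit U (\<lambda>i. R ^^ \<sigma> (r i)) g sequentially"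
  proof
    assume "\<exists>c. \<forall>i. \<sigma> (r i) = c"
    then obtain c where "\<And>i. \<sigma> (r i) = c" by blast
    then have "uniform_limit U (\<lambda>i. R ^^ \<sigma> (r i)) (R ^^ c) sequentially"
      by (simp add: uniform_limit_const)
    then show ?thesis using r(1) by blast
  next
    assume "\<forall>i. i \<le> \<sigma> (r i)"
    then obtain s g where "strict_mono (s :: nat \<Rightarrow> nat)" "uniform_limit U (\<lambda>i. R ^^ \<sigma> (r (s i))) g sequentially"
      using assms[of "\<lambda>i. \<sigma> (r i)"] by blast
    then show ?thesis using strict_mono_o[OF r(1), of s]
      by (intro exI[of _ "r \<circ> s"] exI[of _ g]) auto
  qed
qed

text \<open>On the whole ball the \<open>n\<close>-th iterate is within
  \<open>c ^ n * \<rho>\<close> of \<open>y\<close>, so iterates with exponents tending to infinity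
  converge uniformly to the constant \<open>y\<close>.\<close>

lemma fatou_contractionI:
  assumes "\<rho> > 0" "0 \<le> c" "c < 1" and con: "\<And>x. dist x y < \<rho> \<Longrightarrow> dist (Q x) y \<le> c * dist x y"
  shows "y \<in> fatou_set Q"
  unfolding fatou_iff
proof (intro exI conjI)
  have b: "dist ((Q ^^ n) x) y \<le> c ^ n * dist x y \<and> dist ((Q ^^ n) x) y < \<rho>" if "dist x y < \<rho>" for n x
  proof (induction n)
    case (Suc n)
    have "dist (Q ((Q ^^ n) x)) y \<le> c * dist ((Q ^^ n) x) y" using con Suc by blast
    also have "\<dots> \<le> c * (c ^ n * dist x y)" using Suc assms(2) by (intro mult_left_mono) auto
    finally have 1: "dist ((Q ^^ Suc n) x) y \<le> c ^ Suc n * dist x y" by (simp add: mult.assoc)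
    also have "\<dots> \<le> 1 * dist x y" using assms(2,3) by (intro mult_right_mono power_le_one) auto
    finally show ?case using 1 that by simp
  qed (use that in auto)
  show "iterates_normal Q (ball y \<rho>)"
  proof (rule iterates_normalI)
    fix \<sigma> :: "nat \<Rightarrow> nat" assume \<sigma>: "\<And>i. i \<le> \<sigma> i"
    have "uniform_limit (ball y \<rho>) (\<lambda>i. Q ^^ \<sigma> i) (\<lambda>_. y) sequentially"
      unfolding uniform_limit_iff
    proof (intro allI impI)
      fix e :: real assume e: "e > 0"
      have "(\<lambda>n. c ^ n * \<rho>) \<longlonglongrightarrow> 0 * \<rho>"
        using assms by (intro tendsto_mult LIMSEQ_power_zero tendsto_const) auto
      then have "\<forall>\<^sub>F n in sequentially. c ^ n * \<rho> < e"
        using e by (intro order_tendstoD(2)) auto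
      then show "\<forall>\<^sub>F n in sequentially. \<forall>x\<in>ball y \<rho>. dist ((Q ^^ \<sigma> n) x) y < e"
      proof eventually_elim
        case (elim n)
        show ?case
        proof
          fix x assume "x \<in> ball y \<rho>"
          then have x: "dist x y < \<rho>" by (simp add: dist_commute)
          have "dist ((Q ^^ \<sigma> n) x) y \<le> c ^ \<sigma> n * dist x y" using b[OF x] by blast
          also have "\<dots> \<le> c ^ n * \<rho>"
            using \<sigma>[of n] assms x by (intro mult_mono power_decreasing) auto
          finally show "dist ((Q ^^ \<sigma> n) x) y < e" using elim by simp
        qed
      qed
    qed
    then show "\<exists>r g. strict_mono (r :: nat \<Rightarrow> nat) \<and> uniform_limit (ball y \<rho>) (\<lambda>i. Q ^^ \<sigma> (r i)) g sequentially"
      by (intro exI[of _ "\<lambda>i. i"] exI[of _ "\<lambda>_. y"]) (auto simp: strict_mono_def)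
  qed
qed (use assms in auto)

section \<open>Invariance of the Fatou set\<close>

context rational_dyn
begin

lemma uniform_limit_Rn_comp:
  assumes "uniform_limit U f g sequentially"
  shows "uniform_limit U (\<lambda>i x. (R ^^ n) (f i x)) (\<lambda>x. (R ^^ n) (g x)) sequentially"
  using uniform_limit_compose[OF assms compact_uniformly_continuous[OF contRn compact_riemann_sphere, of n]]
  by (simp add: comp_def)

lemma fatou_R_iff: "R x \<in> fatou_set R \<longleftrightarrow> x \<in> fatou_set R"
proof
  assume "R x \<in> fatou_set R"
  then obtain V where V: "open V" "R x \<in> V" "iterates_normal R V" unfolding fatou_iff by blast
  have "iterates_normal R (R -` V)"
  proof (rule iterates_normalI)
    fix \<sigma> :: "nat \<Rightarrow> nat" assume \<sigma>: "\<And>i. i \<le> \<sigma> i"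
    \<comment> \<open>The index is shifted to \<open>Suc\<close>, where \<open>\<sigma>\<close> is
      at least 1, so that one factor \<open>R\<close> can be split off.\<close>
    obtain r g where r: "strict_mono (r :: nat \<Rightarrow> nat)"
      "uniform_limit V (\<lambda>i. R ^^ (\<sigma> (Suc (r i)) - 1)) g sequentially"
      using V(3)[unfolded iterates_normal_def, rule_format, of "\<lambda>i. \<sigma> (Suc i) - 1"] by blast
    have "uniform_limit (R -` V) (\<lambda>i x. (R ^^ (\<sigma> (Suc (r i)) - 1)) (R x)) (\<lambda>x. g (R x)) sequentially"
      by (rule uniform_limit_compose'[OF r(2)]) auto
    moreover have "(R ^^ (\<sigma> (Suc (r i)) - 1)) (R x) = (R ^^ \<sigma> (Suc (r i))) x" for i x
    proof -
      have "\<sigma> (Suc (r i)) = Suc (\<sigma> (Suc (r i)) - 1)" using \<sigma>[of "Suc (r i)"] by simp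
      then show ?thesis by (metis comp_apply funpow_Suc_right)
    qed
    ultimately have "uniform_limit (R -` V) (\<lambda>i. R ^^ \<sigma> (Suc (r i))) (\<lambda>x. g (R x)) sequentially"
      by simp
    moreover have "strict_mono (\<lambda>i. Suc (r i))" using r(1) by (simp add: strict_mono_def)
    ultimately show "\<exists>r g. strict_mono (r :: nat \<Rightarrow> nat) \<and> uniform_limit (R -` V) (\<lambda>i. R ^^ \<sigma> (r i)) g sequentially"
      by (intro exI[of _ "\<lambda>i. Suc (r i)"] exI[of _ "\<lambda>x. g (R x)"]) auto
  qed
  moreover have "open (R -` V)" using open_vimageRn[OF V(1), of 1] by simp
  ultimately show "x \<in> fatou_set R" unfolding fatou_iff using V(2) by blast
next
  assume "x \<in> fatou_set R"
  then obtain U where U: "open U" "x \<in> U" "iterates_normal R U" unfolding fatou_iff by blast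
  \<comment> \<open>Any right inverse of \<open>R\<close> serves, as uniform convergence survives
    composition with an arbitrary map on the inside.\<close>
  define h where "h = inv_into U R"
  have h: "h y \<in> U" "R (h y) = y" if "y \<in> R ` U" for y
    using that unfolding h_def by (auto intro: inv_into_into f_inv_into_f)
  have "iterates_normal R (R ` U)"
    unfolding iterates_normal_def
  proof
    fix \<sigma> :: "nat \<Rightarrow> nat"
    obtain r g where r: "strict_mono (r :: nat \<Rightarrow> nat)" "uniform_limit U (\<lambda>i. R ^^ (Suc (\<sigma> (r i)))) g sequentially"
      using U(3)[unfolded iterates_normal_def, rule_format, of "\<lambda>i. Suc (\<sigma> i)"] by blast
    have "uniform_limit (R ` U) (\<lambda>i y. (R ^^ (Suc (\<sigma> (r i)))) (h y)) (\<lambda>y. g (h y)) sequentially"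
      by (rule uniform_limit_compose'[OF r(2)]) (use h in auto)
    moreover have "(R ^^ (Suc (\<sigma> (r i)))) (h y) = (R ^^ (\<sigma> (r i))) y" if "y \<in> R ` U" for i y
      using h(2)[OF that] by (simp add: funpow_Suc_right del: funpow.simps)
    ultimately have "uniform_limit (R ` U) (\<lambda>i. R ^^ (\<sigma> (r i))) (\<lambda>y. g (h y)) sequentially"
      by (simp cong: uniform_limit_cong')
    then show "\<exists>r g. strict_mono (r :: nat \<Rightarrow> nat) \<and> uniform_limit (R ` U) (\<lambda>i. R ^^ \<sigma> (r i)) g sequentially"
      using r(1) by blast
  qed
  then show "R x \<in> fatou_set R" unfolding fatou_iff using U openR by blast
qed

lemma fatou_Rn_iff: "(R ^^ n) x \<in> fatou_set R \<longleftrightarrow> x \<in> fatou_set R"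
  by (induction n) (auto simp: fatou_R_iff)

lemma julia_Rn_iff: "(R ^^ n) x \<in> julia_set R \<longleftrightarrow> x \<in> julia_set R"
  using fatou_Rn_iff by (simp add: julia_set_def)

text \<open>Infinitely many exponents share the same parity \<open>e\<close>. Halving them gives
  iterates of \<open>R \<circ> R\<close>, and the missing factor \<open>R ^^ e\<close> is uniformly
  continuous on the compact sphere.\<close>

lemma fatou_RR: "fatou_set (R \<circ> R) = fatou_set R"
proof -
  have "R \<circ> R = R ^^ 2" by (simp add: numeral_2_eq_2)
  then have RR: "(R \<circ> R) ^^ n = R ^^ (2 * n)" for n by (simp add: funpow_mult)
  have "iterates_normal (R \<circ> R) U \<longleftrightarrow> iterates_normal R U" for U
  proof
    assume "iterates_normal R U"
    then show "iterates_normal (R \<circ> R) U"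
      unfolding iterates_normal_def RR by (intro allI) (drule_tac x = "\<lambda>i. 2 * \<sigma> i" in spec, assumption)
  next
    assume n: "iterates_normal (R \<circ> R) U"
    show "iterates_normal R U"
      unfolding iterates_normal_def
    proof
      fix \<sigma> :: "nat \<Rightarrow> nat"
      have "\<exists>e. infinite {i. \<sigma> i mod 2 = e}"
      proof (rule ccontr)
        assume "\<not> ?thesis"
        then have "finite ({i. \<sigma> i mod 2 = 0} \<union> {i. \<sigma> i mod 2 = 1})" by blast
        moreover have "{i. \<sigma> i mod 2 = 0} \<union> {i. \<sigma> i mod 2 = 1} = UNIV" by auto
        ultimately show False by (metis infinite_UNIV_nat)
      qed
      then obtain e where "infinite {i. \<sigma> i mod 2 = e}" by blast
      from infinite_subseq[OF this] obtain r where r: "strict_mono (r :: nat \<Rightarrow> nat)" "\<And>i. \<sigma> (r i) mod 2 = e"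
        by blast
      obtain s g where s: "strict_mono (s :: nat \<Rightarrow> nat)"
        "uniform_limit U (\<lambda>i. R ^^ (2 * (\<sigma> (r (s i)) div 2))) g sequentially"
        using n[unfolded iterates_normal_def RR, rule_format, of "\<lambda>i. \<sigma> (r i) div 2"] by blast
      have "(R ^^ e) ((R ^^ (2 * (\<sigma> (r (s i)) div 2))) x) = (R ^^ \<sigma> (r (s i))) x" for i x
        using r(2)[of "s i"] by (metis comp_apply funpow_add mod_mult_div_eq)
      then have "uniform_limit U (\<lambda>i. R ^^ \<sigma> (r (s i))) (\<lambda>x. (R ^^ e) (g x)) sequentially"
        using uniform_limit_Rn_comp[OF s(2), of e] by simp
      then show "\<exists>r g. strict_mono (r :: nat \<Rightarrow> nat) \<and> uniform_limit U (\<lambda>i. R ^^ \<sigma> (r i)) g sequentially"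
        using strict_mono_o[OF r(1) s(1)]
        by (intro exI[of _ "r \<circ> s"] exI[of _ "\<lambda>x. (R ^^ e) (g x)"]) auto
    qed
  qed
  then show ?thesis using fatou_iff by blast
qed

end

section \<open>A Montel theorem with moving omitted values\<close>

lemma uniform_limit_Pair:
  assumes "uniform_limit S f f' F" "uniform_limit S g g' F"
  shows "uniform_limit S (\<lambda>i x. (f i x, g i x)) (\<lambda>x. (f' x, g' x)) F"
  unfolding uniform_limit_iff
proof (intro allI impI)
  fix e :: real assume e: "e > 0"
  have "\<forall>\<^sub>F i in F. \<forall>x\<in>S. dist (f i x) (f' x) < e / 2" "\<forall>\<^sub>F i in F. \<forall>x\<in>S. dist (g i x) (g' x) < e / 2"
    using assms e unfolding uniform_limit_iff by (meson half_gt_zero)+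
  then show "\<forall>\<^sub>F i in F. \<forall>x\<in>S. dist (f i x, g i x) (f' x, g' x) < e"
  proof eventually_elim
    case (elim i)
    show ?case
    proof
      fix x assume "x \<in> S"
      have "dist (f i x, g i x) (f' x, g' x) \<le> dist (f i x) (f' x) + dist (g i x) (g' x)"
        unfolding dist_Pair_Pair by (rule sqrt_sum_squares_le_sum) auto
      then show "dist (f i x, g i x) (f' x, g' x) < e" using elim \<open>x \<in> S\<close> by fastforce
    qed
  qed
qed

lemma uniform_limit_seq_const: "(a \<longlongrightarrow> l) F \<Longrightarrow> uniform_limit S (\<lambda>i x. a i) (\<lambda>x. l) F"
  unfolding uniform_limit_iff tendsto_iff by (simp add: eventually_mono)

text \<open>The Pluecker relation. For the cross-ratio of \<open>F\<close>, \<open>X\<close>,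
  \<open>Y\<close>, \<open>W\<close> it says that, when \<open>X\<close> and \<open>W\<close> are
  distinct points, the value 1 is taken exactly when \<open>F\<close> represents the point of
  \<open>Y\<close>.\<close>

lemma br_plucker: "br F X * br Y W - br F W * br Y X = br F Y * br X W"
  by (simp add: br_def algebra_simps)

lemma continuous_on_br [continuous_intros]:
  assumes "continuous_on S f" "continuous_on S g"
  shows "continuous_on S (\<lambda>x. br (f x) (g x))"
  unfolding br_def using assms by (intro continuous_intros)

lemma continuous_on_scl [continuous_intros]:
  assumes "continuous_on S f" "continuous_on S g"
  shows "continuous_on S (\<lambda>x. scl (f x) (g x))"
  unfolding scl_def using assms by (intro continuous_intros)

text \<open>The cross-ratio \<open>h\<close> of \<open>F\<close> with the three omitted values omits 0, 1 and infinity,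
  so Montel's theorem applies to it; \<open>F\<close> is recovered from \<open>h\<close> and the three values.\<close>

lemma moving_montel_bounded:
  fixes F :: "nat \<Rightarrow> complex \<Rightarrow> C2"
  assumes hol: "\<And>i. (\<lambda>t. fst (F i t)) holomorphic_on ball t0 \<epsilon>" "\<And>i. (\<lambda>t. snd (F i t)) holomorphic_on ball t0 \<epsilon>"
    and nz: "\<And>i t. t \<in> ball t0 \<epsilon> \<Longrightarrow> F i t \<noteq> 0"
    and unit: "\<And>i. norm (X i) = 1" "\<And>i. norm (Y i) = 1" "\<And>i. norm (W i) = 1"
    and \<delta>: "\<delta> > 0" "\<And>i. \<delta> \<le> cmod (br (Y i) (X i))" "\<And>i. \<delta> \<le> cmod (br (Y i) (W i))" "\<And>i. \<delta> \<le> cmod (br (X i) (W i))"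
    and omit: "\<And>i t. t \<in> ball t0 \<epsilon> \<Longrightarrow> br (F i t) (X i) \<noteq> 0" "\<And>i t. t \<in> ball t0 \<epsilon> \<Longrightarrow> br (F i t) (Y i) \<noteq> 0"
      "\<And>i t. t \<in> ball t0 \<epsilon> \<Longrightarrow> br (F i t) (W i) \<noteq> 0"
    and h: "\<And>i t. h i t = br (F i t) (X i) * br (Y i) (W i) / (br (F i t) (W i) * br (Y i) (X i))"
    and h0: "\<And>i. cmod (h i t0) \<le> 1" and \<rho>: "0 < \<rho>" "\<rho> < \<epsilon>"
  shows "\<exists>r g. strict_mono (r :: nat \<Rightarrow> nat) \<and> uniform_limit (cball t0 \<rho>) (\<lambda>i t. proj (F (r i) t)) g sequentially"
proof -
  let ?S = "ball t0 \<epsilon>"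
  have bn: "br (Y i) (X i) \<noteq> 0" "br (Y i) (W i) \<noteq> 0" "br (X i) (W i) \<noteq> 0" for i
    using \<delta>(1) \<delta>(2,3,4)[of i] by auto
  have hhol: "h i holomorphic_on ?S" for i
  proof -
    have "(\<lambda>t. br (F i t) Z) holomorphic_on ?S" for Z
      unfolding br_def using hol by (intro holomorphic_intros)
    then show ?thesis unfolding h using omit bn by (intro holomorphic_intros) auto
  qed
  have h01: "h i t \<noteq> 0 \<and> h i t \<noteq> 1" if "t \<in> ?S" for i t
  proof -
    have "br (F i t) (X i) * br (Y i) (W i) \<noteq> br (F i t) (W i) * br (Y i) (X i)"
      using br_plucker[of "F i t" "X i" "Y i" "W i"] omit(2)[OF that] bn by auto
    then show ?thesis unfolding h using omit[OF that] bn by auto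
  qed
  have bounded: "\<exists>B. \<forall>k \<in> range h. \<forall>z \<in> K. norm (k z) \<le> B" if K: "compact K" "K \<subseteq> ?S" for K
  proof -
    have "t0 \<in> ?S" using \<rho> by auto
    \<comment> \<open>Schottky's theorem: the functions omit 0 and 1 and are bounded by 1 at
      \<open>t0\<close>, hence uniformly bounded on compact sets.\<close>
    obtain B where "\<And>k z. \<lbrakk>k \<in> range h; z \<in> K\<rbrakk> \<Longrightarrow> norm (k z) \<le> B"
      using GPicard3[OF open_ball connected_ball \<open>t0 \<in> ?S\<close> order_refl, of "range h" K] hhol h01 h0 K by blast
    then show ?thesis by blast
  qed
  define Sp where "Sp = sphere (0::C2) 1"
  have "compact (Sp \<times> Sp \<times> Sp)" by (simp add: Sp_def compact_Times)
  moreover have "\<forall>i. (X i, Y i, W i) \<in> Sp \<times> Sp \<times> Sp" using unit by (simp add: Sp_def)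
  ultimately obtain l r1 where r1: "l \<in> Sp \<times> Sp \<times> Sp" "strict_mono (r1 :: nat \<Rightarrow> nat)"
    "((\<lambda>i. (X i, Y i, W i)) \<circ> r1) \<longlonglongrightarrow> l"
    unfolding compact_def by meson
  have *: "range (\<lambda>i. h (r1 i)) \<subseteq> range h" by blast
  obtain g r2 where r2: "strict_mono (r2 :: nat \<Rightarrow> nat)"
    "\<And>K. \<lbrakk>compact K; K \<subseteq> ?S\<rbrakk> \<Longrightarrow> uniform_limit K ((\<lambda>i. h (r1 i)) \<circ> r2) g sequentially"
  proof (rule Montel[of ?S "range h" "\<lambda>i. h (r1 i)"])
    show "k holomorphic_on ?S" if "k \<in> range h" for k using that hhol by blast
  qed (use bounded * in \<open>blast+\<close>)
  define r where "r = r1 \<circ> r2"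
  have sub: "cball t0 \<rho> \<subseteq> ?S" using \<rho> by auto
  have ulh: "uniform_limit (cball t0 \<rho>) (\<lambda>i. h (r i)) g sequentially"
    using r2(2)[OF compact_cball sub] by (simp add: r_def comp_def)
  have "((\<lambda>i. (X i, Y i, W i)) \<circ> r1 \<circ> r2) \<longlonglongrightarrow> l"
    by (rule LIMSEQ_subseq_LIMSEQ[OF r1(3) r2(1)])
  then have lim: "(\<lambda>i. (X (r i), Y (r i), W (r i))) \<longlonglongrightarrow> l" by (simp add: r_def comp_def)
  obtain B where B: "\<And>i z. z \<in> cball t0 \<rho> \<Longrightarrow> norm (h i z) \<le> B"
    using bounded[OF compact_cball sub] by blast
  \<comment> \<open>A compact set that contains all omitted values together with the values of
    \<open>h\<close>, and on which the three points stay \<open>\<delta>\<close>-separated. It makes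
    the reconstruction of \<open>F\<close> uniformly continuous.\<close>
  define K where "K = ((Sp \<times> Sp \<times> Sp) \<times> cball (0::complex) B) \<inter>
     {p. \<delta> \<le> cmod (br (fst (snd (fst p))) (fst (fst p)))} \<inter> {p. \<delta> \<le> cmod (br (fst (snd (fst p))) (snd (snd (fst p))))}
     \<inter> {p. \<delta> \<le> cmod (br (fst (fst p)) (snd (snd (fst p))))}"
  have "compact K"
    unfolding K_def
    by (intro compact_Int_closed compact_Times closed_Collect_le continuous_intros) (simp_all add: Sp_def)
  \<comment> \<open>Solves the cross-ratio for \<open>F\<close> up to a scalar. Its pairing with
    \<open>w\<close> is \<open>br y w * br x w\<close>, so the separation keeps it nonzero.\<close>
  define \<Psi> where "\<Psi> p = (let ((x, y, w), z) = p in scl (br y w) x - scl (z * br y x) w)" for p :: "(C2 \<times> C2 \<times> C2) \<times> complex"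
  have \<Psi>: "\<Psi> p = scl (br (fst (snd (fst p))) (snd (snd (fst p)))) (fst (fst p))
      - scl (snd p * br (fst (snd (fst p))) (fst (fst p))) (snd (snd (fst p)))" for p
    by (simp add: \<Psi>_def case_prod_beta)
  have nzK: "\<Psi> p \<noteq> 0" if "p \<in> K" for p
  proof
    assume "\<Psi> p = 0"
    then have "br (\<Psi> p) (snd (snd (fst p))) = 0" by simp
    then have "br (fst (snd (fst p))) (snd (snd (fst p))) * br (fst (fst p)) (snd (snd (fst p))) = 0"
      unfolding \<Psi> by (simp add: br_diff_left)
    then show False using that \<delta>(1) by (auto simp: K_def)
  qed
  have "continuous_on K (\<lambda>p. proj (\<Psi> p))"
  proof (rule continuous_on_compose2[OF continuous_on_proj])
    show "continuous_on K \<Psi>" unfolding \<Psi> by (intro continuous_intros)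
    show "\<Psi> ` K \<subseteq> - {0}" using nzK by (intro image_subsetI) simp
  qed
  then have uc: "uniformly_continuous_on K (\<lambda>p. proj (\<Psi> p))"
    by (rule compact_uniformly_continuous[OF _ \<open>compact K\<close>])
  have inK: "((X (r i), Y (r i), W (r i)), h (r i) t) \<in> K" if "t \<in> cball t0 \<rho>" for i t
    using \<delta> unit B[OF that] by (simp add: K_def Sp_def)
  have "uniform_limit (cball t0 \<rho>) (\<lambda>i t. proj (\<Psi> ((X (r i), Y (r i), W (r i)), h (r i) t))) (\<lambda>t. proj (\<Psi> (l, g t))) sequentially"
    by (rule uniform_limit_compose_uniformly_continuous_on[OF uniform_limit_Pair[OF uniform_limit_seq_const[OF lim] ulh] uc])
      (use inK compact_imp_closed[OF \<open>compact K\<close>] in auto)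
  moreover have "proj (\<Psi> ((X i, Y i, W i), h i t)) = proj (F i t)" if "t \<in> ?S" for i t
  proof -
    let ?G = "scl (br (Y i) (W i)) (X i) - scl (h i t * br (Y i) (X i)) (W i)"
    have "br ?G (F i t) = 0"
      using omit[OF that] bn unfolding h
      by (simp add: br_diff_left br_swap[of "X i" "F i t"] br_swap[of "W i" "F i t"])
    moreover have "br ?G (W i) = br (Y i) (W i) * br (X i) (W i)" by (simp add: br_diff_left)
    then have "?G \<noteq> 0" using bn by (metis br_0_left mult_eq_0_iff)
    ultimately have "proj ?G = proj (F i t)" using proj_eq_iff nz[OF that] by blast
    then show ?thesis by (simp add: \<Psi>)
  qed
  then have e: "proj (F (r i) t) = proj (\<Psi> ((X (r i), Y (r i), W (r i)), h (r i) t))" if "t \<in> cball t0 \<rho>" for i t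
    using sub that by (metis subsetD)
  ultimately have "uniform_limit (cball t0 \<rho>) (\<lambda>i t. proj (F (r i) t)) (\<lambda>t. proj (\<Psi> (l, g t))) sequentially"
    by (subst uniform_limit_cong'[OF e refl])
  moreover have "strict_mono r" unfolding r_def using r1 r2 by (simp add: strict_mono_o)
  ultimately show ?thesis by blast
qed

text \<open>Exchanging \<open>X\<close> and \<open>W\<close> inverts the cross-ratio, so one of the
  two versions is bounded by 1 at \<open>t0\<close> for infinitely many indices.\<close>

lemma moving_montel:
  fixes F :: "nat \<Rightarrow> complex \<Rightarrow> C2"
  assumes hol: "\<And>i. (\<lambda>t. fst (F i t)) holomorphic_on ball t0 \<epsilon>" "\<And>i. (\<lambda>t. snd (F i t)) holomorphic_on ball t0 \<epsilon>"
    and nz: "\<And>i t. t \<in> ball t0 \<epsilon> \<Longrightarrow> F i t \<noteq> 0"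
    and unit: "\<And>i. norm (X i) = 1" "\<And>i. norm (Y i) = 1" "\<And>i. norm (W i) = 1"
    and \<delta>: "\<delta> > 0" "\<And>i. \<delta> \<le> cmod (br (Y i) (X i))" "\<And>i. \<delta> \<le> cmod (br (Y i) (W i))" "\<And>i. \<delta> \<le> cmod (br (X i) (W i))"
    and omit: "\<And>i t. t \<in> ball t0 \<epsilon> \<Longrightarrow> br (F i t) (X i) \<noteq> 0" "\<And>i t. t \<in> ball t0 \<epsilon> \<Longrightarrow> br (F i t) (Y i) \<noteq> 0"
      "\<And>i t. t \<in> ball t0 \<epsilon> \<Longrightarrow> br (F i t) (W i) \<noteq> 0"
    and \<rho>: "0 < \<rho>" "\<rho> < \<epsilon>"
  shows "\<exists>r g. strict_mono (r :: nat \<Rightarrow> nat) \<and> uniform_limit (cball t0 \<rho>) (\<lambda>i t. proj (F (r i) t)) g sequentially"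
proof -
  define h where "h i t = br (F i t) (X i) * br (Y i) (W i) / (br (F i t) (W i) * br (Y i) (X i))" for i t
  define k where "k i t = br (F i t) (W i) * br (Y i) (X i) / (br (F i t) (X i) * br (Y i) (W i))" for i t
  have hk: "cmod (h i t0) \<le> 1 \<or> cmod (k i t0) \<le> 1" for i
  proof -
    have "k i t0 = inverse (h i t0)" by (simp add: h_def k_def)
    then show ?thesis by (simp add: norm_inverse inverse_le_1_iff) linarith
  qed
  have \<delta>': "\<delta> \<le> cmod (br (W i) (X i))" for i
    using \<delta>(4)[of i] by (metis br_swap norm_minus_cancel)
  have sub: ?thesis if s: "strict_mono (s :: nat \<Rightarrow> nat)"
    and ex: "\<exists>r g. strict_mono (r :: nat \<Rightarrow> nat) \<and> uniform_limit (cball t0 \<rho>) (\<lambda>i t. proj (F (s (r i)) t)) g sequentially" for s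
  proof -
    obtain r g where "strict_mono (r :: nat \<Rightarrow> nat)" "uniform_limit (cball t0 \<rho>) (\<lambda>i t. proj (F (s (r i)) t)) g sequentially"
      using ex by blast
    then show ?thesis using strict_mono_o[OF s, of r] by (intro exI[of _ "s \<circ> r"] exI[of _ g]) simp
  qed
  show ?thesis
  proof (cases "infinite {i. cmod (h i t0) \<le> 1}")
    case True
    from infinite_subseq[OF this] obtain s where s: "strict_mono (s :: nat \<Rightarrow> nat)" "\<And>i. cmod (h (s i) t0) \<le> 1"
      by blast
    show ?thesis
      by (rule sub[OF s(1) moving_montel_bounded[of "\<lambda>i. F (s i)" t0 \<epsilon> "\<lambda>i. X (s i)" "\<lambda>i. Y (s i)" "\<lambda>i. W (s i)" \<delta> "\<lambda>i. h (s i)"]])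
        (use assms s h_def in auto)
  next
    case False
    have "infinite {i. cmod (k i t0) \<le> 1}"
    proof
      assume "finite {i. cmod (k i t0) \<le> 1}"
      then have "finite ({i. cmod (h i t0) \<le> 1} \<union> {i. cmod (k i t0) \<le> 1})" using False by simp
      moreover have "{i. cmod (h i t0) \<le> 1} \<union> {i. cmod (k i t0) \<le> 1} = UNIV" using hk by blast
      ultimately show False by (metis infinite_UNIV_nat)
    qed
    from infinite_subseq[OF this] obtain s where s: "strict_mono (s :: nat \<Rightarrow> nat)" "\<And>i. cmod (k (s i) t0) \<le> 1"
      by blast
    show ?thesis
      by (rule sub[OF s(1) moving_montel_bounded[of "\<lambda>i. F (s i)" t0 \<epsilon> "\<lambda>i. W (s i)" "\<lambda>i. Y (s i)" "\<lambda>i. X (s i)" \<delta> "\<lambda>i. k (s i)"]])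
        (use assms \<delta>' s k_def in auto)
  qed
qed

text \<open>\<open>V\<close> is the image of a chart disc of half the radius and depends only on
  \<open>U\<close> and \<open>a\<close>. Exponents and omitted points are quantified after it,
  because one neighbourhood has to serve all sequences of iterates.\<close>

lemma (in rational_dyn) omit_three_normal:
  assumes U: "open U" "a \<in> U"
  obtains V where "open V" "a \<in> V" "V \<subseteq> U"
    "\<And>\<sigma> x y w \<delta>. \<lbrakk>\<delta> > 0; \<And>i. \<delta> \<le> dist (x i) (y i); \<And>i. \<delta> \<le> dist (y i) (w i); \<And>i. \<delta> \<le> dist (x i) (w i);
       \<And>i. x i \<notin> (R ^^ \<sigma> i) ` U; \<And>i. y i \<notin> (R ^^ \<sigma> i) ` U; \<And>i. w i \<notin> (R ^^ \<sigma> i) ` U\<rbrakk>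
      \<Longrightarrow> \<exists>r g. strict_mono (r :: nat \<Rightarrow> nat) \<and> uniform_limit V (\<lambda>i. R ^^ \<sigma> (r i)) g sequentially"
proof -
  obtain A B t0 where c: "\<And>t. A + scl t B \<noteq> 0" "proj (A + scl t0 B) = a" "br A B \<noteq> 0"
    "\<And>W. open W \<Longrightarrow> open ((\<lambda>t. proj (A + scl t B)) ` W)"
    using local_chart by metis
  define \<phi> where "\<phi> t = proj (A + scl t B)" for t
  have "continuous_on UNIV \<phi>" unfolding \<phi>_def by (rule continuous_on_chart) (rule c(1))
  then have W: "open (\<phi> -` U)" using U by (simp add: continuous_on_open_vimage)
  moreover have "t0 \<in> \<phi> -` U" using U c(2) by (simp add: \<phi>_def)
  ultimately obtain \<epsilon> where \<epsilon>: "\<epsilon> > 0" "ball t0 \<epsilon> \<subseteq> \<phi> -` U" using openE by blast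
  define V where "V = \<phi> ` ball t0 (\<epsilon> / 2)"
  show thesis
  proof (rule that[of V])
    show "open V" unfolding V_def \<phi>_def by (rule c(4)) simp
    show "a \<in> V" unfolding V_def using c(2) \<epsilon> by (intro image_eqI[of _ _ t0]) (auto simp: \<phi>_def)
    have "ball t0 (\<epsilon> / 2) \<subseteq> ball t0 \<epsilon>" using \<epsilon> by auto
    then show "V \<subseteq> U" unfolding V_def using \<epsilon>(2) by blast
    fix \<sigma> :: "nat \<Rightarrow> nat" and x y w :: "nat \<Rightarrow> riemann_sphere" and \<delta> :: real
    assume \<delta>: "\<delta> > 0" "\<And>i. \<delta> \<le> dist (x i) (y i)" "\<And>i. \<delta> \<le> dist (y i) (w i)" "\<And>i. \<delta> \<le> dist (x i) (w i)"
      and om: "\<And>i. x i \<notin> (R ^^ \<sigma> i) ` U" "\<And>i. y i \<notin> (R ^^ \<sigma> i) ` U" "\<And>i. w i \<notin> (R ^^ \<sigma> i) ` U"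
    obtain rep where rep: "\<And>z. norm (rep z) = 1" "\<And>z. proj (rep z) = z" using proj_surj by metis
    have rep0: "rep z \<noteq> 0" for z using rep(1)[of z] by (metis norm_zero zero_neq_one)
    \<comment> \<open>For unit representatives the determinant is half the distance, hence the
      constant \<open>\<delta> / 2\<close> below.\<close>
    have dbr: "cmod (br (rep z) (rep z')) = dist z z' / 2" for z z'
      using dist_proj[OF rep0[of z] rep0[of z']] by (simp add: rep)
    obtain G where G: "\<And>n. hom_lift (G n) (d ^ n) (R ^^ n)" using hom_lift_funpow[OF lift] by metis
    define F where "F i t = G (\<sigma> i) (A + scl t B)" for i t
    have F0: "F i t \<noteq> 0" for i t unfolding F_def by (rule hom_lift_nz[OF G c(1)])
    have FR: "proj (F i t) = (R ^^ \<sigma> i) (\<phi> t)" for i t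
      unfolding F_def \<phi>_def by (rule hom_lift_proj[OF G c(1), symmetric])
    have hol: "(\<lambda>t. fst (F i t)) holomorphic_on S" "(\<lambda>t. snd (F i t)) holomorphic_on S" for i S
    proof -
      obtain p q where "\<And>t. F i t = (poly p t, poly q t)" using hom_lift_line[OF G] unfolding F_def by metis
      then show "(\<lambda>t. fst (F i t)) holomorphic_on S" "(\<lambda>t. snd (F i t)) holomorphic_on S"
        by (auto intro!: holomorphic_intros)
    qed
    have omit: "br (F i t) (rep z) \<noteq> 0" if "t \<in> ball t0 \<epsilon>" "z \<notin> (R ^^ \<sigma> i) ` U" for i t z
    proof
      assume "br (F i t) (rep z) = 0"
      then have "proj (F i t) = z" using proj_eq_iff[OF F0 rep0] rep by metis
      then show False using that \<epsilon>(2) FR by blast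
    qed
    have "\<exists>r g. strict_mono (r :: nat \<Rightarrow> nat) \<and> uniform_limit (cball t0 (\<epsilon> / 2)) (\<lambda>i t. proj (F (r i) t)) g sequentially"
      by (rule moving_montel[where X = "\<lambda>i. rep (x i)" and Y = "\<lambda>i. rep (y i)" and W = "\<lambda>i. rep (w i)" and \<delta> = "\<delta> / 2" and \<epsilon> = \<epsilon>])
        (use hol F0 rep dbr \<delta> om omit \<epsilon> in \<open>auto simp: dist_commute\<close>)
    then obtain r g where r: "strict_mono (r :: nat \<Rightarrow> nat)"
      "uniform_limit (cball t0 (\<epsilon> / 2)) (\<lambda>i t. (R ^^ \<sigma> (r i)) (\<phi> t)) g sequentially" unfolding FR by blast
    define s where "s = inv_into (ball t0 (\<epsilon> / 2)) \<phi>"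
    have s: "s v \<in> ball t0 (\<epsilon> / 2)" "\<phi> (s v) = v" if "v \<in> V" for v
      using that unfolding s_def V_def by (metis inv_into_into, metis f_inv_into_f)
    have "uniform_limit V (\<lambda>i v. (R ^^ \<sigma> (r i)) (\<phi> (s v))) (\<lambda>v. g (s v)) sequentially"
      by (rule uniform_limit_compose'[OF r(2)]) (use s(1) ball_subset_cball in blast)
    then have "uniform_limit V (\<lambda>i. R ^^ \<sigma> (r i)) (\<lambda>v. g (s v)) sequentially"
      using s(2) by (simp cong: uniform_limit_cong')
    then show "\<exists>r g. strict_mono (r :: nat \<Rightarrow> nat) \<and> uniform_limit V (\<lambda>i. R ^^ \<sigma> (r i)) g sequentially"
      using r(1) by blast
  qed
qed

section \<open>Backward orbits and topological exactness\<close>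

text \<open>The form \<open>br (H X) b\<close> vanishes only along the line of \<open>b'\<close>, so
  by the fundamental theorem of algebra it has no factor other than \<open>br X b'\<close>.\<close>

lemma totally_ramified_form:
  assumes H: "hom_lift H d R" and "d \<ge> 1" and b: "b \<noteq> 0" "b' \<noteq> 0" and R: "R -` {proj b} = {proj b'}"
  shows "\<exists>k. k \<noteq> 0 \<and> (\<forall>X. br (H X) b = k * br X b' ^ d)"
proof -
  \<comment> \<open>\<open>A\<close> lies off the line of \<open>b'\<close>, so
    \<open>A + scl t b'\<close> runs through representatives of every point other than
    \<open>proj b'\<close>.\<close>
  define A where "A = (cnj (snd b'), - cnj (fst b'))"
  have "br A b' = of_real ((norm b')\<^sup>2)"
    unfolding norm_C2 of_real_add complex_norm_square by (simp add: A_def br_def algebra_simps)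
  then have Ab: "br A b' \<noteq> 0" using b by simp
  have A0: "A + scl t b' \<noteq> 0" for t
  proof
    assume "A + scl t b' = 0"
    then have "br (A + scl t b') b' = 0" by simp
    then show False using Ab by (simp add: br_add_left)
  qed
  have Rb: "R (proj b') = proj b" using R by blast
  obtain p q where pq: "\<And>t. H (A + scl t b') = (poly p t, poly q t)" using hom_lift_line[OF H] by metis
  define P where "P = smult (snd b) p - smult (fst b) q"
  have P: "br (H (A + scl t b')) b = poly P t" for t
    unfolding pq P_def br_def by (simp add: mult.commute)
  have P0: "poly P t \<noteq> 0" for t
  proof
    assume "poly P t = 0"
    then have "proj (H (A + scl t b')) = proj b"
      using P[of t] proj_eq_iff[OF hom_lift_nz[OF H A0] b(1)] by simp
    then have "R (proj (A + scl t b')) = proj b" by (rule trans[OF hom_lift_proj[OF H A0]])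
    then have "proj (A + scl t b') \<in> R -` {proj b}" by simp
    then have "proj (A + scl t b') = proj b'" unfolding R by (rule singletonD)
    then have "br (A + scl t b') b' = 0" using proj_eq_iff[OF A0 b(2)] by blast
    then show False using Ab by (simp add: br_add_left)
  qed
  have "degree P = 0"
  proof (rule ccontr)
    assume n: "degree P \<noteq> 0"
    then have "coeff P 0 = 0 \<or> (\<exists>i\<in>{1..degree P}. coeff P i \<noteq> 0)"
      by (intro disjI2 bexI[of _ "degree P"]) auto
    then obtain z where "(\<Sum>i\<le>degree P. coeff P i * z ^ i) = 0"
      by (rule fundamental_theorem_of_algebra)
    then show False using P0[of z] by (simp add: poly_altdef)
  qed
  then obtain c where "P = [:c:]" by (rule degree_eq_zeroE)
  then have const: "poly P t = poly P 0" for t by simp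
  define k where "k = poly P 0 / br A b' ^ d"
  have "br (H X) b = k * br X b' ^ d" for X
  proof -
    define s t where "s = br X b' / br A b'" and "t = br A X / br A b'"
    have X: "X = scl s A + scl t b'"
    proof -
      have "scl (br A b') X = scl (br X b') A + scl (br A X) b'"
        by (simp add: scl_def br_def prod_eq_iff algebra_simps)
      then have "scl (1 / br A b') (scl (br A b') X) = scl (1 / br A b') (scl (br X b') A + scl (br A X) b')"
        by simp
      also have "\<dots> = scl s A + scl t b'" unfolding s_def t_def by (simp add: scl_def distrib_left)
      finally show ?thesis using Ab by simp
    qed
    show ?thesis
    proof (cases "s = 0")
      case True
      then have "br X b' = 0" using Ab by (simp add: s_def)
      moreover have "br (H X) b = 0"
      proof -
        have "X = scl t b'" using X True by simp
        then have "br (H X) b = t ^ d * br (H b') b" by (simp add: hom_lift_scl[OF H])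
        moreover have "br (H b') b = 0"
          using proj_eq_iff[OF hom_lift_nz[OF H b(2)] b(1)] hom_lift_proj[OF H b(2)] Rb by simp
        ultimately show ?thesis by simp
      qed
      ultimately show ?thesis using \<open>d \<ge> 1\<close> by simp
    next
      case False
      have "X = scl s (A + scl (t / s) b')" using False by (subst X) (simp add: scl_def distrib_left)
      then have "br (H X) b = s ^ d * poly P (t / s)" by (simp add: hom_lift_scl[OF H] P)
      also have "\<dots> = s ^ d * poly P 0" by (metis const)
      also have "\<dots> = k * br X b' ^ d" by (simp add: k_def s_def power_divide)
      finally show ?thesis .
    qed
  qed
  moreover have "k \<noteq> 0" using P0 Ab by (simp add: k_def)
  ultimately show ?thesis by blast
qed

text \<open>Along \<open>b1 + scl t b2\<close> the first term vanishes to order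
  \<open>d \<ge> 2\<close> and the second is constant, so the derivative at \<open>t = 0\<close>
  isolates the third.\<close>

lemma three_powers_independent:
  assumes "d \<ge> 2" and b: "br b1 b2 \<noteq> 0" "br b1 b3 \<noteq> 0" "br b2 b3 \<noteq> 0"
    and rel: "\<And>X. \<alpha> * br X b1 ^ d + \<beta> * br X b2 ^ d + \<gamma> * br X b3 ^ d = 0"
  shows "\<gamma> = 0"
proof -
  define u v where "u = br b1 b3" and "v = br b2 b3"
  let ?f = "\<lambda>t. \<alpha> * (t * br b2 b1) ^ d + \<beta> * br b1 b2 ^ d + \<gamma> * (u + t * v) ^ d"
  have "?f t = 0" for t
    using rel[of "b1 + scl t b2"] by (simp add: br_add_left u_def v_def)
  then have f0: "?f = (\<lambda>t. 0)" by blast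
  have "(?f has_field_derivative \<gamma> * (of_nat d * u ^ (d - 1) * v)) (at 0)"
    using assms(1) by (auto intro!: derivative_eq_intros simp: zero_power)
  moreover have "(?f has_field_derivative 0) (at 0)" unfolding f0 by simp
  ultimately have "\<gamma> * (of_nat d * u ^ (d - 1) * v) = 0" by (rule DERIV_unique)
  then show ?thesis using assms(1) b by (simp add: u_def v_def)
qed

context rational_dyn
begin

text \<open>A fixed point that is its own only preimage is totally ramified, so
  \<open>R \<circ> R\<close> contracts quadratically towards it.\<close>

lemma superattracting_fatou:
  assumes y: "(R \<circ> R) -` {y} = {y}"
  shows "y \<in> fatou_set R"
proof -
  obtain b where b: "norm b = 1" "proj b = y" using proj_surj by blast
  then have b0: "b \<noteq> 0" by (metis norm_zero zero_neq_one)
  define G where "G X = H (H X)" for X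
  define D where "D = d * d"
  have D: "D \<ge> 2" using mult_le_mono[OF d2 d2] by (simp add: D_def)
  have G: "hom_lift G D (R \<circ> R)"
    using hom_lift_comp[OF lift lift] by (simp add: G_def[abs_def] D_def comp_def)
  have "D \<ge> 1" using D by simp
  moreover have "(R \<circ> R) -` {proj b} = {proj b}" unfolding b(2) by (rule y)
  ultimately have "\<exists>k. k \<noteq> 0 \<and> (\<forall>X. br (G X) b = k * br X b ^ D)"
    by (rule totally_ramified_form[OF G _ b0 b0])
  then obtain k where "k \<noteq> 0 \<and> (\<forall>X. br (G X) b = k * br X b ^ D)" by (rule exE)
  then have k: "br (G X) b = k * br X b ^ D" for X by (rule conjunct2[THEN spec])
  have contG: "continuous_on (sphere 0 1) (\<lambda>X. norm (G X))"
    using G unfolding hom_lift_def by (blast intro: continuous_on_norm continuous_on_subset)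
  have "sphere (0::C2) 1 \<noteq> {}" using b(1) by force
  then obtain X0 where X0: "X0 \<in> sphere 0 1" "\<And>X. X \<in> sphere 0 1 \<Longrightarrow> norm (G X0) \<le> norm (G X)"
    using continuous_attains_inf[OF compact_sphere _ contG] by blast
  \<comment> \<open>The minimum of \<open>norm (G X)\<close> on the unit sphere bounds the
    denominator in \<open>dist_proj\<close> from below; it is positive because a lift has no zeros
    there.\<close>
  define m where "m = norm (G X0)"
  have "X0 \<noteq> 0" using X0(1) by (metis mem_sphere_0 norm_zero zero_neq_one)
  then have m: "m > 0" unfolding m_def using hom_lift_nz[OF G] by simp
  define C where "C = cmod k / (2 * m)"
  have C0: "C \<ge> 0" unfolding C_def using m by simp
  have sq: "dist ((R \<circ> R) x) y \<le> C * (dist x y)\<^sup>2" for x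
  proof -
    obtain X where X: "norm X = 1" "proj X = x" using proj_surj by blast
    then have X0': "X \<noteq> 0" by (metis norm_zero zero_neq_one)
    have dx: "cmod (br X b) = dist x y / 2" using dist_proj[OF X0' b0] X b by simp
    have "dist x y \<le> 2"
    proof -
      have "dist (stereo x) (stereo y) \<le> dist (stereo x) 0 + dist 0 (stereo y)" by (rule dist_triangle)
      moreover have "stereo x \<in> sphere 0 1" "stereo y \<in> sphere 0 1" using range_stereo by blast+
      ultimately show ?thesis by (simp add: dist_riemann_sphere_def)
    qed
    then have "cmod (br X b) ^ D \<le> (cmod (br X b))\<^sup>2" unfolding dx
      using D by (intro power_decreasing) auto
    then have pw: "cmod (br X b) ^ D \<le> (dist x y)\<^sup>2 / 4" unfolding dx by (simp add: power_divide)
    have GX: "m \<le> norm (G X)" unfolding m_def using X0(2) X(1) by simp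
    have "dist ((R \<circ> R) x) y = 2 * cmod (br (G X) b) / (norm (G X) * norm b)"
      using dist_proj[OF hom_lift_nz[OF G X0'] b0] hom_lift_proj[OF G X0'] X b by simp
    also have "\<dots> = 2 * (cmod k * cmod (br X b) ^ D) / norm (G X)"
      unfolding k by (simp add: norm_mult norm_power b)
    also have "\<dots> \<le> 2 * (cmod k * ((dist x y)\<^sup>2 / 4)) / m"
      using pw GX m by (intro frac_le mult_left_mono) auto
    also have "\<dots> = C * (dist x y)\<^sup>2" by (simp add: C_def)
    finally show ?thesis .
  qed
  have "y \<in> fatou_set (R \<circ> R)"
  proof (rule fatou_contractionI)
    \<comment> \<open>Within this radius \<open>C * dist x y \<le> 1 / 2\<close>, which turns the
      quadratic bound into a contraction by 1/2.\<close>
    show "1 / (2 * C + 2) > 0" using C0 by simp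
    show "dist ((R \<circ> R) x) y \<le> (1 / 2) * dist x y" if "dist x y < 1 / (2 * C + 2)" for x
    proof -
      have "C * dist x y \<le> C * (1 / (2 * C + 2))" using that C0 by (intro mult_left_mono) auto
      also have "\<dots> \<le> 1 / 2" using C0 by (simp add: field_simps)
      finally have "C * dist x y * dist x y \<le> 1 / 2 * dist x y" by (intro mult_right_mono) auto
      then show ?thesis using sq[of x] by (simp add: power2_eq_square mult.assoc)
    qed
  qed auto
  then show ?thesis by (simp add: fatou_RR)
qed

text \<open>Total ramification makes each \<open>br (H X) (b i)\<close> a multiple of the
  \<open>d\<close>-th power of \<open>br X (b (Suc i))\<close>. If no \<open>x i\<close> were its
  own only preimage under \<open>R \<circ> R\<close>, the linear relation between the pairings of
  \<open>H X\<close> with \<open>b 0\<close>, \<open>b 1\<close>, \<open>b 2\<close> would become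
  one between \<open>d\<close>-th powers of three pairwise independent linear forms.\<close>

lemma singleton_chain:
  assumes x: "\<And>i. R -` {x i} = {x (Suc i)}"
  shows "\<exists>i. (R \<circ> R) -` {x i} = {x i}"
proof (rule ccontr)
  assume no: "\<not> ?thesis"
  have RR: "(R \<circ> R) -` {x i} = {x (Suc (Suc i))}" for i
    unfolding vimage_comp[symmetric] x ..
  have ne2: "x i \<noteq> x (Suc (Suc i))" for i using no RR[of i] by auto
  have ne1: "x i \<noteq> x (Suc i)" for i
  proof
    assume e: "x i = x (Suc i)"
    have "x (Suc (Suc i)) = x (Suc i)" using x[of i] x[of "Suc i"] e by auto
    then show False using ne2[of i] e by simp
  qed
  obtain rep where rep: "\<And>z. norm (rep z) = 1" "\<And>z. proj (rep z) = z" using proj_surj by metis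
  have rep0: "rep z \<noteq> 0" for z using rep(1)[of z] by (metis norm_zero zero_neq_one)
  define b where "b i = rep (x i)" for i
  have bb: "br (b i) (b j) \<noteq> 0" if "x i \<noteq> x j" for i j
    using that proj_eq_iff[OF rep0 rep0] rep unfolding b_def by metis
  have "\<exists>k. k \<noteq> 0 \<and> (\<forall>X. br (H X) (b i) = k * br X (b (Suc i)) ^ d)" for i
    by (rule totally_ramified_form[OF lift]) (use d2 rep0 rep x in \<open>auto simp: b_def\<close>)
  then obtain k where k: "\<And>i. k i \<noteq> 0" "\<And>i X. br (H X) (b i) = k i * br X (b (Suc i)) ^ d" by metis
  have plk: "br Y (b 0) * br (b 1) (b 2) + br Y (b 1) * br (b 2) (b 0) + br Y (b 2) * br (b 0) (b 1) = 0" for Y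
    by (simp add: br_def algebra_simps)
  have rel: "(k 0 * br (b 1) (b 2)) * br X (b 1) ^ d + (k 1 * br (b 2) (b 0)) * br X (b 2) ^ d
      + (k 2 * br (b 0) (b 1)) * br X (b 3) ^ d = 0" for X
    using plk[of "H X"] unfolding k(2) by (simp add: numeral_2_eq_2 numeral_3_eq_3 algebra_simps)
  have "k 2 * br (b 0) (b 1) = 0"
    by (rule three_powers_independent[OF d2 _ _ _ rel])
      (use ne1[of 1] ne1[of 2] ne2[of 1] in \<open>auto intro!: bb simp: numeral_2_eq_2 numeral_3_eq_3\<close>)
  then show False using k(1)[of 2] bb[of 0 1] ne1[of 0] by simp
qed

text \<open>If all iterated fibres had at most two points, then from some preimage of
  \<open>a\<close> on every fibre would be a single point: once there are two points, neither branch
  can split again. The resulting chain contains a superattracting point, of which \<open>a\<close>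
  is a forward image.\<close>

lemma julia_three_preimages:
  assumes a: "a \<in> julia_set R"
  shows "\<exists>n. 3 \<le> card ((R ^^ n) -` {a})"
proof (rule ccontr)
  assume "\<not> ?thesis"
  then have le2: "card ((R ^^ n) -` {a}) \<le> 2" for n by (metis Suc_leI eval_nat_numeral(3) not_le_imp_less not_less_eq_eq)
  have ne: "(R ^^ n) -` {z} \<noteq> {}" for n z using surjRn[of n] by (metis UNIV_I empty_iff imageE singletonI vimageI)
  have "\<exists>n x. (R ^^ n) x = a \<and> (\<forall>m. \<exists>z. (R ^^ m) -` {x} = {z})"
  proof (cases "\<forall>n. card ((R ^^ n) -` {a}) = 1")
    case True
    then have "\<forall>m. \<exists>z. (R ^^ m) -` {a} = {z}" by (metis card_1_singletonE)
    then show ?thesis by (intro exI[of _ 0] exI[of _ a]) auto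
  next
    case False
    then obtain n where "card ((R ^^ n) -` {a}) \<noteq> 1" by blast
    moreover have "card ((R ^^ n) -` {a}) \<noteq> 0" using ne fibreRn by simp
    ultimately have "card ((R ^^ n) -` {a}) = 2" using le2[of n] by linarith
    then obtain x y where xy: "(R ^^ n) -` {a} = {x, y}" "x \<noteq> y" by (meson card_2_iff)
    have "\<exists>z. (R ^^ m) -` {x} = {z}" for m
    proof -
      have "(R ^^ (n + m)) -` {a} = (R ^^ m) -` {x} \<union> (R ^^ m) -` {y}"
        unfolding funpow_add vimage_comp[symmetric] xy(1) by auto
      moreover have "(R ^^ m) -` {x} \<inter> (R ^^ m) -` {y} = {}" using xy(2) by auto
      ultimately have "card ((R ^^ m) -` {x}) + card ((R ^^ m) -` {y}) \<le> 2"
        using le2[of "n + m"] card_Un_disjoint[OF fibreRn fibreRn] by metis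
      moreover have "card ((R ^^ m) -` {x}) \<noteq> 0" "card ((R ^^ m) -` {y}) \<noteq> 0"
        using ne fibreRn by simp_all
      ultimately have "card ((R ^^ m) -` {x}) = 1" by linarith
      then show ?thesis by (meson card_1_singletonE)
    qed
    then show ?thesis using xy(1) by (intro exI[of _ n] exI[of _ x]) auto
  qed
  then obtain n x z where x: "(R ^^ n) x = a" and z: "\<And>m. (R ^^ m) -` {x} = {z m}" by metis
  have "R -` {z m} = {z (Suc m)}" for m
  proof
    show "R -` {z m} \<subseteq> {z (Suc m)}"
    proof
      fix w assume "w \<in> R -` {z m}"
      then have "(R ^^ m) (R w) = x" using z[of m] by auto
      then have "w \<in> (R ^^ Suc m) -` {x}" by (simp add: funpow_Suc_right del: funpow.simps)
      then show "w \<in> {z (Suc m)}" using z[of "Suc m"] by blast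
    qed
    have "(R ^^ Suc m) (z (Suc m)) = x" using z[of "Suc m"] by blast
    then have "(R ^^ m) (R (z (Suc m))) = x" by (simp add: funpow_Suc_right del: funpow.simps)
    then show "{z (Suc m)} \<subseteq> R -` {z m}" using z[of m] by auto
  qed
  from singleton_chain[of z, OF this] obtain i where "(R \<circ> R) -` {z i} = {z i}" by blast
  then have "z i \<in> fatou_set R" by (rule superattracting_fatou)
  moreover have "(R ^^ i) (z i) = x" using z[of i] by blast
  ultimately have "a \<in> fatou_set R" using x fatou_Rn_iff by metis
  then show False using a by (simp add: julia_set_def)
qed

lemma julia_image: "(R ^^ n) ` julia_set R = julia_set R"
proof
  show "(R ^^ n) ` julia_set R \<subseteq> julia_set R" using julia_Rn_iff[of n] by blast
  show "julia_set R \<subseteq> (R ^^ n) ` julia_set R"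
  proof
    fix y assume y: "y \<in> julia_set R"
    obtain x where "y = (R ^^ n) x" using surjRn[of n] by (rule surjE)
    then show "y \<in> (R ^^ n) ` julia_set R" using y julia_Rn_iff by blast
  qed
qed

lemma julia_covered_mono:
  assumes "julia_set R \<subseteq> (R ^^ n) ` U" "n \<le> m"
  shows "julia_set R \<subseteq> (R ^^ m) ` U"
proof -
  have "(R ^^ (m - n)) ` julia_set R \<subseteq> (R ^^ (m - n)) ` ((R ^^ n) ` U)" using assms(1) by blast
  also have "\<dots> = (R ^^ m) ` U" using assms(2) by (simp add: image_comp funpow_add[symmetric])
  finally show ?thesis by (simp add: julia_image)
qed

text \<open>Let \<open>b\<close> be a limit of missed points. Some iterate \<open>R ^^ K\<close> has
  three points over \<open>b\<close>, and as it is open, the missed points have preimages close to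
  each of the three. On \<open>U\<close> these are omitted by the iterates with \<open>K\<close>
  steps fewer and stay uniformly apart, so the iterates would be normal near a Julia point.\<close>

theorem topologically_exact:
  assumes U: "open U" "U \<inter> julia_set R \<noteq> {}"
  shows "\<exists>n. julia_set R \<subseteq> (R ^^ n) ` U"
proof (rule ccontr)
  assume "\<not> ?thesis"
  then have "\<forall>n. \<exists>a. a \<in> julia_set R \<and> a \<notin> (R ^^ n) ` U" by blast
  then obtain a where a: "\<And>n. a n \<in> julia_set R" "\<And>n. a n \<notin> (R ^^ n) ` U" by metis
  obtain u where u: "u \<in> U" "u \<in> julia_set R" using U by blast
  obtain V where V: "open V" "u \<in> V" "V \<subseteq> U"
    "\<And>\<sigma> x y w \<delta>. \<lbrakk>\<delta> > 0; \<And>i. \<delta> \<le> dist (x i) (y i); \<And>i. \<delta> \<le> dist (y i) (w i); \<And>i. \<delta> \<le> dist (x i) (w i);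
       \<And>i. x i \<notin> (R ^^ \<sigma> i) ` U; \<And>i. y i \<notin> (R ^^ \<sigma> i) ` U; \<And>i. w i \<notin> (R ^^ \<sigma> i) ` U\<rbrakk>
      \<Longrightarrow> \<exists>r g. strict_mono (r :: nat \<Rightarrow> nat) \<and> uniform_limit V (\<lambda>i. R ^^ \<sigma> (r i)) g sequentially"
    using omit_three_normal[OF U(1) u(1)] by metis
  have "iterates_normal R V"
  proof (rule iterates_normalI)
    fix \<sigma> :: "nat \<Rightarrow> nat" assume \<sigma>: "\<And>i. i \<le> \<sigma> i"
    have "compact (julia_set R)" using closed_julia closed_imp_compact_rs by blast
    then obtain b s where s: "b \<in> julia_set R" "strict_mono (s :: nat \<Rightarrow> nat)" "((\<lambda>i. a (\<sigma> i)) \<circ> s) \<longlonglongrightarrow> b"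
      unfolding compact_def using a(1) by meson
    obtain K where "3 \<le> card ((R ^^ K) -` {b})" using julia_three_preimages[OF s(1)] by blast
    then obtain T where T: "T \<subseteq> (R ^^ K) -` {b}" "card T = 3" by (meson obtain_subset_with_card_n)
    then obtain x y w where xyw: "T = {x, y, w}" "x \<noteq> y" "y \<noteq> w" "x \<noteq> w" by (auto simp: card_3_iff)
    \<comment> \<open>The three centres are at least \<open>3 * \<delta>\<close> apart, so points
      closer than \<open>\<delta>\<close> to them remain at least \<open>\<delta>\<close>
      apart.\<close>
    define \<delta> where "\<delta> = Min {dist x y, dist y w, dist x w} / 3"
    have \<delta>: "\<delta> > 0" "3 * \<delta> \<le> dist x y" "3 * \<delta> \<le> dist y w" "3 * \<delta> \<le> dist x w"
      unfolding \<delta>_def using xyw(2-4) by auto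
    have ev: "\<forall>\<^sub>F i in sequentially. a (\<sigma> (s i)) \<in> (R ^^ K) ` ball z \<delta>" if "z \<in> T" for z
    proof -
      have "b \<in> (R ^^ K) ` ball z \<delta>" using that T(1) \<delta>(1) by (intro image_eqI[of _ _ z]) auto
      then show ?thesis using s(3) openRn[OF open_ball, of K z \<delta>] topological_tendstoD by fastforce
    qed
    have "\<forall>\<^sub>F i in sequentially. a (\<sigma> (s i)) \<in> (R ^^ K) ` ball x \<delta> \<and> a (\<sigma> (s i)) \<in> (R ^^ K) ` ball y \<delta>
       \<and> a (\<sigma> (s i)) \<in> (R ^^ K) ` ball w \<delta>"
      using ev xyw(1) by (intro eventually_conj) auto
    then obtain N where N: "\<And>i. i \<ge> N \<Longrightarrow> a (\<sigma> (s i)) \<in> (R ^^ K) ` ball x \<delta> \<and> a (\<sigma> (s i)) \<in> (R ^^ K) ` ball y \<delta>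
       \<and> a (\<sigma> (s i)) \<in> (R ^^ K) ` ball w \<delta>" unfolding eventually_sequentially by blast
    \<comment> \<open>The shift by \<open>N\<close> reaches the indices at which the nearby
      preimages exist; the shift by \<open>K\<close> makes the exponent at least
      \<open>K\<close>.\<close>
    define \<tau> where "\<tau> i = s (i + N + K)" for i
    have \<tau>: "strict_mono \<tau>" using s(2) by (simp add: \<tau>_def strict_mono_def)
    have big: "K \<le> \<sigma> (\<tau> i)" for i
    proof -
      have "K \<le> i + N + K" by simp
      also have "\<dots> \<le> \<tau> i" unfolding \<tau>_def by (rule strict_mono_imp_increasing[OF s(2)])
      also have "\<dots> \<le> \<sigma> (\<tau> i)" by (rule \<sigma>)
      finally show ?thesis .
    qed
    have "\<forall>i. \<exists>x' y' w'. dist x x' < \<delta> \<and> dist y y' < \<delta> \<and> dist w w' < \<delta> \<and>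
        (R ^^ K) x' = a (\<sigma> (\<tau> i)) \<and> (R ^^ K) y' = a (\<sigma> (\<tau> i)) \<and> (R ^^ K) w' = a (\<sigma> (\<tau> i))"
    proof
      fix i
      have "N \<le> i + N + K" by simp
      note n = N[OF this, folded \<tau>_def]
      from n obtain x' where "dist x x' < \<delta>" "(R ^^ K) x' = a (\<sigma> (\<tau> i))" by (auto simp: image_iff)
      moreover from n obtain y' where "dist y y' < \<delta>" "(R ^^ K) y' = a (\<sigma> (\<tau> i))" by (auto simp: image_iff)
      moreover from n obtain w' where "dist w w' < \<delta>" "(R ^^ K) w' = a (\<sigma> (\<tau> i))" by (auto simp: image_iff)
      ultimately show "\<exists>x' y' w'. dist x x' < \<delta> \<and> dist y y' < \<delta> \<and> dist w w' < \<delta> \<and>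
        (R ^^ K) x' = a (\<sigma> (\<tau> i)) \<and> (R ^^ K) y' = a (\<sigma> (\<tau> i)) \<and> (R ^^ K) w' = a (\<sigma> (\<tau> i))" by blast
    qed
    then obtain x' y' w' where l: "\<And>i. dist x (x' i) < \<delta>" "\<And>i. dist y (y' i) < \<delta>" "\<And>i. dist w (w' i) < \<delta>"
      "\<And>i. (R ^^ K) (x' i) = a (\<sigma> (\<tau> i))" "\<And>i. (R ^^ K) (y' i) = a (\<sigma> (\<tau> i))" "\<And>i. (R ^^ K) (w' i) = a (\<sigma> (\<tau> i))"
      by metis
    have sep: "\<delta> \<le> dist p' q'" if "dist p p' < \<delta>" "dist q q' < \<delta>" "3 * \<delta> \<le> dist p q" for p q p' q' :: riemann_sphere
      using that dist_triangle[of p q p'] dist_triangle[of p' q q'] by (simp add: dist_commute)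
    have om: "z \<notin> (R ^^ (\<sigma> (\<tau> i) - K)) ` U" if "(R ^^ K) z = a (\<sigma> (\<tau> i))" for z i
    proof
      assume "z \<in> (R ^^ (\<sigma> (\<tau> i) - K)) ` U"
      then have "(R ^^ K) z \<in> (R ^^ K) ` (R ^^ (\<sigma> (\<tau> i) - K)) ` U" by (rule imageI)
      also have "\<dots> = (R ^^ \<sigma> (\<tau> i)) ` U" using big[of i] by (simp add: image_comp funpow_add[symmetric])
      finally show False using that a(2) by metis
    qed
    have "\<exists>r g. strict_mono (r :: nat \<Rightarrow> nat) \<and> uniform_limit V (\<lambda>i. R ^^ (\<sigma> (\<tau> (r i)) - K)) g sequentially"
      by (rule V(4)[of \<delta> x' y' w' "\<lambda>i. \<sigma> (\<tau> i) - K"]) (use \<delta> l sep om in blast)+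
    then obtain r g where r: "strict_mono (r :: nat \<Rightarrow> nat)" "uniform_limit V (\<lambda>i. R ^^ (\<sigma> (\<tau> (r i)) - K)) g sequentially"
      by blast
    have "(R ^^ K) ((R ^^ (\<sigma> (\<tau> (r i)) - K)) x) = (R ^^ \<sigma> (\<tau> (r i))) x" for i x
      using big[of "r i"] by (metis comp_apply funpow_add le_add_diff_inverse)
    then have "uniform_limit V (\<lambda>i. R ^^ \<sigma> (\<tau> (r i))) (\<lambda>x. (R ^^ K) (g x)) sequentially"
      using uniform_limit_Rn_comp[OF r(2), of K] by simp
    then show "\<exists>r g. strict_mono (r :: nat \<Rightarrow> nat) \<and> uniform_limit V (\<lambda>i. R ^^ \<sigma> (r i)) g sequentially"
      using strict_mono_o[OF \<tau> r(1)] by (intro exI[of _ "\<tau> \<circ> r"] exI[of _ "\<lambda>x. (R ^^ K) (g x)"]) auto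
  qed
  then have "u \<in> fatou_set R" using V unfolding fatou_iff by blast
  then show False using u by (simp add: julia_set_def)
qed

end

section \<open>Fatou components\<close>

context rational_dyn
begin

abbreviation "F \<equiv> fatou_set R"
abbreviation "J \<equiv> julia_set R"

lemma F_J: "F = - J" by (simp add: julia_set_def)

lemma open_comp: "C \<in> components F \<Longrightarrow> open C"
  by (rule open_components_rs[OF open_fatou])

lemma comp_closure_F: "C \<in> components F \<Longrightarrow> closure C \<inter> F = C"
proof -
  assume C: "C \<in> components F"
  obtain T where T: "closed T" "C = F \<inter> T" using closedin_component[OF C] closedin_closed by metis
  then have "closure C \<subseteq> T" by (intro closure_minimal) auto
  then show ?thesis using T(2) closure_subset[of C] by blast
qed

lemma frontier_comp: "C \<in> components F \<Longrightarrow> frontier C = closure C \<inter> J"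
proof -
  assume C: "C \<in> components F"
  then have "frontier C = closure C - C" using open_comp by (simp add: frontier_def interior_open)
  then show ?thesis using comp_closure_F[OF C] F_J by blast
qed

lemma frontier_comp_subset: "C \<in> components F \<Longrightarrow> frontier C \<subseteq> J"
  using frontier_comp by blast

lemma comp_unique: "C \<in> components F \<Longrightarrow> C' \<in> components F \<Longrightarrow> x \<in> C \<Longrightarrow> x \<in> C' \<Longrightarrow> C = C'"
  using components_nonoverlap by blast

lemma comp_at: "x \<in> F \<Longrightarrow> \<exists>C \<in> components F. x \<in> C"
  using Union_components[of F] by blast

lemma closure_image: "closure (R ` A) = R ` closure A"
  by (rule closure_image_rs[OF contR])

lemma R_J_iff: "R x \<in> J \<longleftrightarrow> x \<in> J" using julia_Rn_iff[of 1] by simp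

text \<open>The image is open, and it is relatively closed in the component around it because
  boundary points of \<open>C\<close> are mapped into \<open>J\<close>.\<close>

lemma comp_image: assumes C: "C \<in> components F" shows "R ` C \<in> components F"
proof -
  have CF: "C \<subseteq> F" "C \<noteq> {}" using C in_components_subset in_components_nonempty by blast+
  have sub: "R ` C \<subseteq> F" using CF fatou_R_iff by blast
  have con: "connected (R ` C)" by (intro connected_continuous_image contR in_components_connected[OF C])
  obtain C' where C': "C' \<in> components F" "R ` C \<subseteq> C'"
    using exists_component_superset[OF sub _ con] CF by auto
  have eq: "R ` C = C' \<inter> closure (R ` C)"
  proof
    show "R ` C \<subseteq> C' \<inter> closure (R ` C)" by (rule Int_greatest[OF C'(2) closure_subset])
    show "C' \<inter> closure (R ` C) \<subseteq> R ` C"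
    proof
      fix y assume y: "y \<in> C' \<inter> closure (R ` C)"
      then obtain x where x: "x \<in> closure C" "y = R x" unfolding closure_image by blast
      then have "x \<in> F" using y C'(1) in_components_subset fatou_R_iff by blast
      then show "y \<in> R ` C" using x comp_closure_F[OF C] by blast
    qed
  qed
  have "openin (top_of_set C') (R ` C)"
    using C'(2) openR[OF open_comp[OF C]] by (simp add: open_subset)
  moreover have "closedin (top_of_set C') (R ` C)"
    unfolding closedin_closed using eq closed_closure by blast
  ultimately have "R ` C = {} \<or> R ` C = C'"
    using in_components_connected[OF C'(1)] unfolding connected_clopen by blast
  then show ?thesis using C' CF by auto
qed

lemma frontier_image: assumes C: "C \<in> components F" shows "frontier (R ` C) = R ` frontier C"
  unfolding frontier_comp[OF C] frontier_comp[OF comp_image[OF C]] closure_image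
  using R_J_iff by auto

lemma compn_image: "C \<in> components F \<Longrightarrow> (R ^^ n) ` C \<in> components F"
proof (induction n)
  case (Suc n)
  then show ?case using comp_image[of "(R ^^ n) ` C"] by (simp add: image_image)
qed auto

lemma frontiern_image: "C \<in> components F \<Longrightarrow> frontier ((R ^^ n) ` C) = (R ^^ n) ` frontier C"
proof (induction n)
  case (Suc n)
  then show ?case using frontier_image[OF compn_image, of C n] by (simp add: image_image)
qed auto

lemma comp_over:
  assumes "C' \<in> components F" "(R ^^ n) x \<in> C'"
  shows "\<exists>C \<in> components F. x \<in> C \<and> (R ^^ n) ` C = C'"
proof -
  have "x \<in> F" using assms in_components_subset fatou_Rn_iff by blast
  then obtain C where C: "C \<in> components F" "x \<in> C" using comp_at by blast
  then have "(R ^^ n) ` C = C'" using comp_unique[OF compn_image[OF C(1)] assms(1)] assms(2) by blast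
  then show ?thesis using C by blast
qed

text \<open>Each of these components contains a point of the finite fibre over a chosen point of
  \<open>C'\<close>.\<close>

lemma finite_comps_over:
  assumes C': "C' \<in> components F"
  shows "finite {C \<in> components F. (R ^^ n) ` C = C'}"
proof -
  obtain c where c: "c \<in> C'" using C' in_components_nonempty by blast
  have "{C \<in> components F. (R ^^ n) ` C = C'} \<subseteq> (\<lambda>x. connected_component_set F x) ` ((R ^^ n) -` {c})"
  proof
    fix C assume C: "C \<in> {C \<in> components F. (R ^^ n) ` C = C'}"
    then obtain x where x: "x \<in> C" "(R ^^ n) x = c" using c by blast
    obtain z where z: "C = connected_component_set F z" using C by (auto simp: components_def)
    have "C = connected_component_set F x" using x(1) unfolding z by (rule connected_component_eq[symmetric])
    then show "C \<in> (\<lambda>x. connected_component_set F x) ` ((R ^^ n) -` {c})" using x(2) by blast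
  qed
  then show ?thesis by (rule finite_subset[OF _ finite_imageI[OF fibreRn]])
qed

text \<open>The traces of the components in the plane are open and disjoint. None is empty, since
  \<open>{Infty}\<close> is not open in the connected sphere.\<close>

lemma countable_comps: "countable (components F)"
proof -
  have nonemp: "Fin -` C \<noteq> {}" if C: "C \<in> components F" for C
  proof
    assume "Fin -` C = {}"
    then have "C \<inter> range Fin = {}" by blast
    then have "C \<subseteq> {Infty}" unfolding range_Fin by blast
    moreover have "C \<noteq> {}" using C in_components_nonempty by blast
    ultimately have "C = {Infty}" by blast
    then have "open {Infty}" using open_comp[OF C] by simp
    then have "{Infty} = UNIV"
      using connected_riemann_sphere unfolding connected_clopen by (metis closed_closedin closed_singleton insert_not_empty open_openin subtopology_UNIV)
    then show False by (metis UNIV_I riemann_sphere.distinct(1) singletonD)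
  qed
  have inj: "inj_on (\<lambda>C. Fin -` C) (components F)"
  proof (rule inj_onI)
    fix C C' assume *: "C \<in> components F" "C' \<in> components F" "Fin -` C = Fin -` C'"
    then obtain z where "Fin z \<in> C" "Fin z \<in> C'" using nonemp[of C] by blast
    then show "C = C'" using * comp_unique by blast
  qed
  have "countable ((\<lambda>C. Fin -` C) ` components F)"
  proof (rule countable_disjoint_open_subsets)
    show "open S" if S: "S \<in> (\<lambda>C. Fin -` C) ` components F" for S
    proof -
      from S obtain C where C: "C \<in> components F" "S = Fin -` C" by blast
      then show ?thesis using open_comp[OF C(1)] continuous_on_open_vimage[of UNIV Fin] continuous_on_Fin[of UNIV] by simp
    qed
    show "pairwise disjnt ((\<lambda>C. Fin -` C) ` components F)"
      unfolding pairwise_def disjnt_def using comp_unique by blast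
  qed
  then show ?thesis using countable_image_inj_on[OF _ inj] by blast
qed

text \<open>Fatness is what Baire's theorem provides and what passes to preimages; a suitable
  iterate turns it into fullness.\<close>

definition "fat C \<longleftrightarrow> C \<in> components F \<and> (\<exists>U. open U \<and> U \<inter> J \<noteq> {} \<and> U \<inter> J \<subseteq> frontier C)"
definition "full C \<longleftrightarrow> C \<in> components F \<and> frontier C = J"

lemma exists_fat:
  assumes J: "J \<noteq> {}" and nb: "\<And>x. \<not> buried_point R x"
  shows "\<exists>C. fat C"
proof (rule ccontr)
  assume no: "\<not> (\<exists>C. fat C)"
  let ?X = "top_of_set J"
  have "compact_space ?X" using closed_julia closed_imp_compact_rs by (simp add: compact_space_subtopology compactin_euclidean_iff)
  then have 1: "locally_compact_space ?X" by (rule compact_imp_locally_compact_space)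
  have 2: "regular_space ?X" by (simp add: regular_space_subtopology metrizable_imp_regular_space metrizable_space_euclidean)
  have "?X interior_of \<Union>(frontier ` components F) = {}"
  proof (rule Baire_category_alt[OF disjI2[OF conjI[OF 1 2]]])
    show "countable (frontier ` components F)" using countable_comps by simp
    fix T assume "T \<in> frontier ` components F"
    then obtain C where C: "C \<in> components F" "T = frontier C" by blast
    have "?X interior_of T = {}"
    proof (rule ccontr)
      assume "?X interior_of T \<noteq> {}"
      then obtain x where x: "x \<in> ?X interior_of T" by blast
      then obtain V where V: "openin ?X V" "x \<in> V" "V \<subseteq> T" unfolding interior_of_def by blast
      then obtain U where "open U" "V = J \<inter> U" unfolding openin_open by blast
      then have "fat C" using V C unfolding fat_def by blast
      then show False using no by blast
    qed
    then show "closedin ?X T \<and> ?X interior_of T = {}"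
      using C frontier_comp_subset by (simp add: closed_subset)
  qed
  moreover have "\<Union>(frontier ` components F) = J"
  proof
    show "\<Union>(frontier ` components F) \<subseteq> J" using frontier_comp_subset by blast
    show "J \<subseteq> \<Union>(frontier ` components F)" using nb unfolding buried_point_def by blast
  qed
  ultimately show False using J by (metis interior_of_topspace topspace_euclidean_subtopology)
qed

lemma exact_Int:
  assumes U: "open U" "U \<inter> J \<noteq> {}"
  shows "\<exists>n. (R ^^ n) ` (U \<inter> J) = J"
proof -
  obtain n where n: "J \<subseteq> (R ^^ n) ` U" using topologically_exact[OF U] by blast
  have "(R ^^ n) ` (U \<inter> J) = J" using n julia_Rn_iff[of n] by blast
  then show ?thesis by blast
qed

lemma fat_image_full: "fat C \<Longrightarrow> \<exists>n. full ((R ^^ n) ` C)"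
proof -
  assume "fat C"
  then obtain U where C: "C \<in> components F" "open U" "U \<inter> J \<noteq> {}" "U \<inter> J \<subseteq> frontier C" unfolding fat_def by blast
  obtain n where "(R ^^ n) ` (U \<inter> J) = J" using exact_Int C by blast
  then have "J \<subseteq> frontier ((R ^^ n) ` C)" unfolding frontiern_image[OF C(1)] using C(4) by blast
  then have "full ((R ^^ n) ` C)" unfolding full_def
    using compn_image[OF C(1)] frontier_comp_subset[of "(R ^^ n) ` C" ] by blast
  then show ?thesis by blast
qed

text \<open>By surjectivity some point of \<open>D\<close> is mapped into \<open>D\<close>, and
  since images of components are components, the image of \<open>D\<close> is then \<open>D\<close>
  itself.\<close>

lemma completely_invariantI:
  assumes D: "D \<in> components F" and sub: "(R \<circ> R) -` D \<subseteq> D"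
  shows "completely_invariant (R \<circ> R) D"
proof -
  obtain y where y: "y \<in> D" using D in_components_nonempty by blast
  obtain x where x: "(R ^^ 2) x = y" using surjRn[of 2] by (metis surjD)
  then have "x \<in> D" using sub y by (auto simp: numeral_2_eq_2)
  then have "(R ^^ 2) ` D = D" using comp_unique[OF compn_image[OF D] D, of y 2] x y by blast
  then have im: "(R \<circ> R) ` D = D" by (simp add: numeral_2_eq_2)
  then show ?thesis unfolding completely_invariant_def using sub by blast
qed

section \<open>Connectedness of the Julia set\<close>

text \<open>The complement of \<open>K\<close> is connected because \<open>D\<close> is;
  unicoherence, applied to \<open>K\<close> and the closure of its complement, makes their
  intersection \<open>frontier K\<close> connected.\<close>

lemma connected_frontier_component_compl:
  fixes D :: "riemann_sphere set"
  assumes D: "open D" "connected D" and K: "K \<in> components (- D)"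
  shows "frontier D \<inter> K = frontier K" "connected (frontier K)"
proof -
  have "closed (- D)" using D by (simp add: closed_Compl)
  then have clK: "closed K" using K closed_components by blast
  have KD: "K \<subseteq> - D" using K in_components_subset by blast
  have fr: "frontier K = K \<inter> closure (- K)" using clK by (simp add: frontier_closures)
  show "frontier D \<inter> K = frontier K"
  proof
    show "frontier D \<inter> K \<subseteq> frontier K"
    proof
      fix x assume x: "x \<in> frontier D \<inter> K"
      have "closure D \<subseteq> closure (- K)" using KD by (intro closure_mono) blast
      moreover have "x \<in> closure D" "x \<in> K" using x by (auto simp: frontier_def)
      ultimately show "x \<in> frontier K" unfolding fr by auto
    qed
    show "frontier K \<subseteq> frontier D \<inter> K"
    proof
      fix x assume x: "x \<in> frontier K"
      then have xK: "x \<in> K" unfolding fr by blast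
      \<comment> \<open>A point away from \<open>closure D\<close> has a connected open
        neighbourhood avoiding \<open>D\<close>, which \<open>K\<close> absorbs by
        maximality.\<close>
      have "x \<in> closure D"
      proof (rule ccontr)
        assume "x \<notin> closure D"
        then have xN: "x \<in> - closure D" by simp
        then obtain N where N: "N \<in> components (- closure D)" "x \<in> N"
          using Union_components[of "- closure D"] by blast
        have "open N" using open_components_rs[OF _ N(1)] by (simp add: open_Compl)
        have "N \<subseteq> - D" using in_components_subset[OF N(1)] closure_subset by blast
        then have "N \<subseteq> K" using components_maximal[OF K in_components_connected[OF N(1)]] xK N(2) by blast
        then have "x \<in> interior K" using \<open>open N\<close> N(2) by (meson interiorI)
        then show False using x by (simp add: frontier_def)
      qed
      then show "x \<in> frontier D \<inter> K" using xK KD D(1) by (auto simp: frontier_def interior_open)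
    qed
  qed
  have "connected (- K)"
    using component_diff_connected[OF D(2) connected_riemann_sphere, of K] K by (simp add: Compl_eq_Diff_UNIV)
  then have "connected (closure (- K))" by (rule connected_imp_connected_closure)
  moreover have "K \<union> closure (- K) = UNIV" using closure_subset[of "- K"] by blast
  ultimately show "connected (frontier K)"
    unfolding fr using unicoherent_rs[OF clK closed_closure in_components_connected[OF K]] by blast
qed

text \<open>A component \<open>C \<noteq> D\<close> over \<open>D\<close> lies in a component
  \<open>K\<close> of \<open>- D\<close>, so its boundary lies in the connected set
  \<open>frontier K \<subseteq> J\<close>. As \<open>R\<close> maps the boundary of \<open>C\<close>
  onto \<open>J\<close>, the set \<open>J\<close> is the image of \<open>frontier K\<close>.\<close>

lemma julia_connected:
  assumes D: "full D" and ni: "\<not> (\<exists>C \<in> components F. completely_invariant (R \<circ> R) C)"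
  shows "connected J"
proof (rule ccontr)
  assume nc: "\<not> connected J"
  have Dc: "D \<in> components F" "frontier D = J" using D unfolding full_def by blast+
  have ne: "R ` C \<noteq> D" if C: "C \<in> components F" "C \<noteq> D" for C
  proof
    assume RC: "R ` C = D"
    have CD: "C \<subseteq> - D" using comp_unique C Dc(1) by blast
    then obtain K where K: "K \<in> components (- D)" "C \<subseteq> K"
      using exists_component_superset[OF CD _ in_components_connected[OF C(1)]] in_components_nonempty[OF C(1)] by blast
    note fK = connected_frontier_component_compl[OF open_comp[OF Dc(1)] in_components_connected[OF Dc(1)] K(1)]
    have "closed K" using K(1) closed_components open_comp[OF Dc(1)] by (metis closed_Compl)
    then have "closure C \<subseteq> K" using K(2) by (rule closure_minimal[rotated])
    then have "frontier C \<subseteq> frontier K" using frontier_comp[OF C(1)] fK(1) Dc(2) by blast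
    then have "J \<subseteq> R ` frontier K" using frontier_image[OF C(1)] RC Dc(2) by blast
    moreover have "R ` frontier K \<subseteq> J" using fK(1) Dc(2) R_J_iff by blast
    ultimately have "J = R ` frontier K" by blast
    then show False using nc fK(2) connected_continuous_image[OF contR] by metis
  qed
  have "R -` D \<subseteq> D"
  proof
    fix x assume "x \<in> R -` D"
    then obtain C where "C \<in> components F" "x \<in> C" "R ` C = D" using comp_over[OF Dc(1), of 1 x] by auto
    then show "x \<in> D" using ne by blast
  qed
  then have "(R \<circ> R) -` D \<subseteq> D" unfolding vimage_comp[symmetric] by blast
  then show False using completely_invariantI[OF Dc(1)] ni Dc(1) by blast
qed

text \<open>Near a point of the image with the largest number of preimages, the map is a finite union of
  homeomorphisms between relatively open sets, hence preserves nowhere density.\<close>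

lemma nowhere_dense_image:
  assumes K: "closed K" "K \<subseteq> J" "\<And>U. open U \<Longrightarrow> U \<inter> J \<noteq> {} \<Longrightarrow> \<not> U \<inter> J \<subseteq> K"
    and V: "open V" "V \<inter> J \<noteq> {}"
  shows "\<not> V \<inter> J \<subseteq> R ` K"
proof
  assume sub: "V \<inter> J \<subseteq> R ` K"
  obtain y0 where "y0 \<in> V \<inter> J" using V(2) by blast
  moreover have "\<forall>y. y \<in> V \<inter> J \<longrightarrow> card (R -` {y}) < d + 2" using fibre_card by (simp add: le_imp_less_Suc)
  ultimately obtain y where y: "y \<in> V \<inter> J" "\<And>y'. y' \<in> V \<inter> J \<Longrightarrow> card (R -` {y'}) \<le> card (R -` {y})"
    using ex_has_greatest_nat[of "\<lambda>y. y \<in> V \<inter> J" y0 "\<lambda>y. card (R -` {y})" "d + 2"] less_imp_le by metis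
  define X where "X = R -` {y}"
  have finX: "finite X" unfolding X_def by (rule fibre)
  obtain e where e: "e > 0" "\<And>x x'. x \<in> X \<Longrightarrow> x' \<in> X \<Longrightarrow> x \<noteq> x' \<Longrightarrow> ball x e \<inter> ball x' e = {}"
  proof -
    define \<D> where "\<D> = insert 1 ((\<lambda>(x, x'). dist x x') ` {p \<in> X \<times> X. fst p \<noteq> snd p})"
    have fD: "finite \<D>" unfolding \<D>_def using finX by simp
    have pos: "0 < Min \<D>" using fD unfolding \<D>_def by (subst Min_gr_iff) auto
    show thesis
    proof (rule that[of "Min \<D> / 2"])
      fix x x' assume x: "x \<in> X" "x' \<in> X" "x \<noteq> x'"
      then have "dist x x' \<in> \<D>" unfolding \<D>_def by force
      then have "Min \<D> \<le> dist x x'" using fD by simp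
      then show "ball x (Min \<D> / 2) \<inter> ball x' (Min \<D> / 2) = {}"
        by (intro disjoint_ballI) simp
    qed (use pos in simp)
  qed
  define W0 where "W0 = V \<inter> (\<Inter>x\<in>X. R ` ball x e)"
  have W0: "open W0" unfolding W0_def using finX V(1) openR by (intro open_Int open_INT) auto
  have yW0: "y \<in> W0" unfolding W0_def using y(1) e(1) by (auto simp: X_def)
  \<comment> \<open>Each ball contains a point of the fibre, and by maximality the fibre has no more
    than \<open>card X\<close> points; so each ball contains exactly one.\<close>
  have sheet: "\<exists>s. inj_on s X \<and> (\<forall>x\<in>X. s x \<in> ball x e) \<and> s ` X = R -` {y'}" if y': "y' \<in> W0 \<inter> J" for y'
  proof -
    have "\<forall>x\<in>X. \<exists>z. z \<in> ball x e \<and> R z = y'" using y' unfolding W0_def by blast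
    then obtain s where s: "\<And>x. x \<in> X \<Longrightarrow> s x \<in> ball x e \<and> R (s x) = y'" by metis
    have inj: "inj_on s X"
    proof (rule inj_onI)
      fix x x' assume "x \<in> X" "x' \<in> X" "s x = s x'"
      then show "x = x'" using e(2)[of x x'] s by (metis IntI empty_iff)
    qed
    have "s ` X \<subseteq> R -` {y'}" using s by auto
    moreover have "card (R -` {y'}) \<le> card (s ` X)"
      using y(2)[of y'] y' card_image[OF inj] unfolding W0_def X_def by auto
    ultimately have "s ` X = R -` {y'}" by (intro card_seteq fibre)
    then show ?thesis using inj s by blast
  qed
  \<comment> \<open>\<open>K\<close> is avoided on one sheet after the other: nowhere density
    supplies a Julia point of the sheet outside \<open>K\<close>, and the image of a piece of the
    sheet without \<open>K\<close> is free of the image of \<open>K\<close> from that sheet.\<close>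
  have "\<exists>W. open W \<and> W \<subseteq> W0 \<and> W \<inter> J \<noteq> {} \<and> (\<forall>x\<in>Z. W \<inter> J \<inter> R ` (K \<inter> ball x e) = {})" if "finite Z" "Z \<subseteq> X" for Z
    using that
  proof (induction Z rule: finite_induct)
    case empty
    show ?case using W0 yW0 y(1) by blast
  next
    case (insert x Z)
    have "Z \<subseteq> X" using insert.prems by simp
    from insert.IH[OF this] obtain W where
      "open W \<and> W \<subseteq> W0 \<and> W \<inter> J \<noteq> {} \<and> (\<forall>x\<in>Z. W \<inter> J \<inter> R ` (K \<inter> ball x e) = {})" by (rule exE)
    then have W: "open W" "W \<subseteq> W0" "W \<inter> J \<noteq> {}" "\<And>x. x \<in> Z \<Longrightarrow> W \<inter> J \<inter> R ` (K \<inter> ball x e) = {}"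
      by simp_all
    have xX: "x \<in> X" using insert by blast
    obtain y' where y': "y' \<in> W \<inter> J" using W(3) by blast
    then obtain p where p: "p \<in> ball x e" "R p = y'" using W(2) xX unfolding W0_def by blast
    define Q where "Q = ball x e \<inter> R -` W"
    have Q: "open Q" unfolding Q_def using open_vimageRn[OF W(1), of 1] by (simp add: open_Int)
    have "p \<in> Q \<inter> J" using p y' R_J_iff[of p] unfolding Q_def by auto
    then obtain q where q: "q \<in> Q \<inter> J" "q \<notin> K" using K(3)[OF Q] by blast
    define W' where "W' = R ` (Q - K)"
    have "open W'" unfolding W'_def by (intro openR open_Diff Q K(1))
    moreover have W'W: "W' \<subseteq> W" unfolding W'_def Q_def by blast
    moreover have "R q \<in> W' \<inter> J" using q R_J_iff unfolding W'_def by blast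
    moreover have "W' \<inter> J \<inter> R ` (K \<inter> ball x e) = {}"
    proof (rule ccontr)
      assume "\<not> ?thesis"
      then obtain k where k: "k \<in> K" "k \<in> ball x e" "R k \<in> W' \<inter> J" by blast
      then obtain q' where q': "q' \<in> Q" "q' \<notin> K" "R q' = R k" unfolding W'_def by auto
      have "R k \<in> W0 \<inter> J" using k(3) W'W W(2) by blast
      from sheet[OF this] obtain s where "inj_on s X \<and> (\<forall>x\<in>X. s x \<in> ball x e) \<and> s ` X = R -` {R k}"
        by (rule exE)
      then have s: "inj_on s X" "\<forall>x\<in>X. s x \<in> ball x e" "s ` X = R -` {R k}" by simp_all
      have un: "z = s x" if "z \<in> ball x e" "R z = R k" for z
      proof -
        have "z \<in> s ` X" using that s(3) by blast
        then obtain x' where x': "x' \<in> X" "z = s x'" by blast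
        then have "x' = x" using e(2)[OF x'(1) xX] s(2) that(1) by blast
        then show ?thesis using x' by simp
      qed
      have "q' = s x" "k = s x" using un q' k(2) unfolding Q_def by blast+
      then show False using q'(2) k(1) by simp
    qed
    ultimately show ?case using W(2,4) by (intro exI[of _ W']) blast
  qed
  from this[OF finX order_refl] obtain W where W: "open W" "W \<subseteq> W0" "W \<inter> J \<noteq> {}"
    "\<And>x. x \<in> X \<Longrightarrow> W \<inter> J \<inter> R ` (K \<inter> ball x e) = {}" by blast
  obtain y' where y': "y' \<in> W \<inter> J" using W(3) by blast
  then obtain k where k: "k \<in> K" "R k = y'" using sub W(2) unfolding W0_def by blast
  have "y' \<in> W0 \<inter> J" using y' W(2) by blast
  from sheet[OF this] obtain s where "inj_on s X \<and> (\<forall>x\<in>X. s x \<in> ball x e) \<and> s ` X = R -` {y'}"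
    by (rule exE)
  then have s: "\<forall>x\<in>X. s x \<in> ball x e" "s ` X = R -` {y'}" by simp_all
  then have "k \<in> s ` X" using k(2) by blast
  then obtain x where "x \<in> X" "k \<in> ball x e" using s(1) by blast
  then show False using W(4) k y' by blast
qed

section \<open>Components sharing a boundary piece\<close>

text \<open>Were the boundary of \<open>C\<close> nowhere dense in \<open>J\<close>, so would be its
  image, which is the boundary of the image of \<open>C\<close>.\<close>

lemma fat_preimage:
  assumes C: "C \<in> components F" and "fat (R ` C)"
  shows "fat C"
proof (rule ccontr)
  assume nf: "\<not> fat C"
  obtain V where V: "open V" "V \<inter> J \<noteq> {}" "V \<inter> J \<subseteq> R ` frontier C"
    using assms unfolding fat_def frontier_image[OF C] by blast
  have "\<not> V \<inter> J \<subseteq> R ` frontier C"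
    by (rule nowhere_dense_image) (use V frontier_comp_subset[OF C] nf C in \<open>auto simp: fat_def\<close>)
  then show False using V by blast
qed

lemma full_imp_fat: "full C \<Longrightarrow> J \<noteq> {} \<Longrightarrow> fat C"
  unfolding full_def fat_def by (intro conjI exI[of _ UNIV]) auto

lemma full_image: "full C \<Longrightarrow> full (R ` C)"
  unfolding full_def using comp_image frontier_image julia_image[of 1] by simp

text \<open>If the piece is not inside \<open>E\<close>, removing the closed set \<open>E\<close>
  leaves a nonempty smaller piece covered by the remaining members.\<close>

lemma finite_closed_cover:
  assumes "finite \<E>" "\<And>E. E \<in> \<E> \<Longrightarrow> closed E" "open U" "U \<inter> J \<noteq> {}" "U \<inter> J \<subseteq> \<Union>\<E>"
  shows "\<exists>E\<in>\<E>. \<exists>V. open V \<and> V \<subseteq> U \<and> V \<inter> J \<noteq> {} \<and> V \<inter> J \<subseteq> E"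
  using assms
proof (induction \<E> arbitrary: U rule: finite_induct)
  case (insert E \<E>)
  show ?case
  proof (cases "U \<inter> J \<subseteq> E")
    case True
    then show ?thesis using insert.prems by blast
  next
    case False
    have "open (U - E)" using insert.prems by (intro open_Diff) auto
    then obtain E' V where "E' \<in> \<E>" "open V" "V \<subseteq> U - E" "V \<inter> J \<noteq> {}" "V \<inter> J \<subseteq> E'"
      using insert.IH[of "U - E"] insert.prems False by blast
    then show ?thesis by blast
  qed
qed auto

text \<open>Assume there is no such triple. If there is a second full component, it and
  \<open>D\<close> are the only fat ones and \<open>R\<close> permutes them. If \<open>D\<close> is
  the only full one, another component \<open>C\<close> over \<open>D\<close> would be fat, and
  pulling \<open>C\<close> back along an iterate that returns some point of its boundary piece to
  this piece yields a third component beside \<open>C\<close> and \<open>D\<close>.\<close>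

lemma three_fat_or_invariant:
  assumes J: "J \<noteq> {}" and D: "full D" and ni: "\<not> (\<exists>C \<in> components F. completely_invariant (R \<circ> R) C)"
  shows "\<exists>U C1 C2 C3. open U \<and> U \<inter> J \<noteq> {} \<and> C1 \<in> components F \<and> C2 \<in> components F \<and> C3 \<in> components F \<and>
    C1 \<noteq> C2 \<and> C1 \<noteq> C3 \<and> C2 \<noteq> C3 \<and> U \<inter> J \<subseteq> frontier C1 \<and> U \<inter> J \<subseteq> frontier C2 \<and> U \<inter> J \<subseteq> frontier C3"
proof (rule ccontr)
  assume no: "\<not> ?thesis"
  have Dc: "D \<in> components F" "frontier D = J" using D unfolding full_def by blast+
  have pre: "\<exists>C. fat C \<and> R ` C = E \<and> x \<in> C" if E: "fat E" "R x \<in> E" for E x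
  proof -
    have "E \<in> components F" using E unfolding fat_def by blast
    then obtain C where C: "C \<in> components F" "x \<in> C" "R ` C = E" using comp_over[of E 1 x] E(2) by auto
    then show ?thesis using fat_preimage E(1) by blast
  qed
  show False
  proof (cases "\<exists>D'. full D' \<and> D' \<noteq> D")
    case True
    then obtain D' where D': "full D'" "D' \<noteq> D" by blast
    have two: "C = D \<or> C = D'" if "fat C" for C
    proof (rule ccontr)
      assume ne: "\<not> ?thesis"
      obtain U where "C \<in> components F" "open U" "U \<inter> J \<noteq> {}" "U \<inter> J \<subseteq> frontier C"
        using \<open>fat C\<close> unfolding fat_def by blast
      moreover have "U \<inter> J \<subseteq> frontier D" "U \<inter> J \<subseteq> frontier D'" using D D' unfolding full_def by auto
      ultimately show False using no ne D' D unfolding full_def by blast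
    qed
    have fD: "fat D" "fat D'" using full_imp_fat D D' J by blast+
    have RD: "R ` D = D \<or> R ` D = D'" "R ` D' = D \<or> R ` D' = D'"
      using two full_imp_fat full_image D D' J by blast+
    have sur: "\<exists>C. fat C \<and> R ` C = E" if "fat E" for E
    proof -
      have "E \<noteq> {}" using that in_components_nonempty[of E F] unfolding fat_def by simp
      then obtain y where "y \<in> E" by blast
      moreover obtain x where "R x = y" using surjR by (metis surjD)
      ultimately show ?thesis using pre[OF that] by blast
    qed
    \<comment> \<open>Every fat component is the image of a fat one, so \<open>R\<close> permutes
      \<open>D\<close> and \<open>D'\<close>, and a permutation of two elements has trivial
      square.\<close>
    have RR: "R ` R ` D = D" "R ` R ` D' = D'"
      using RD sur[OF fD(1)] sur[OF fD(2)] two D'(2) by metis+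
    have "(R \<circ> R) -` D \<subseteq> D"
    proof
      fix x assume "x \<in> (R \<circ> R) -` D"
      then have "R (R x) \<in> D" by simp
      from pre[OF fD(1) this] obtain C where C: "fat C" "R ` C = D" "R x \<in> C" by blast
      from pre[OF C(1,3)] obtain C' where C': "fat C'" "R ` C' = C" "x \<in> C'" by blast
      then have "R ` R ` C' = D" using C by simp
      then have "C' = D" using two[OF C'(1)] RR D'(2) by metis
      then show "x \<in> D" using C' by simp
    qed
    then show False using completely_invariantI[OF Dc(1)] ni Dc(1) by blast
  next
    case False
    have RD: "R ` D = D" using False full_image[OF D] by blast
    have RnD: "(R ^^ n) ` D = D" for n
    proof (induction n)
      case (Suc n)
      have "(R ^^ Suc n) ` D = R ` (R ^^ n) ` D" by (simp add: image_image)
      then show ?case using Suc RD by simp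
    qed auto
    have ne: "C = D" if C: "C \<in> components F" "R ` C = D" for C
    proof (rule ccontr)
      assume CD: "C \<noteq> D"
      have "fat C" using fat_preimage[OF C(1)] C(2) full_imp_fat[OF D J] by simp
      then obtain U where U: "open U" "U \<inter> J \<noteq> {}" "U \<inter> J \<subseteq> frontier C" unfolding fat_def by blast
      obtain n where n: "(R ^^ n) ` (U \<inter> J) = J" using exact_Int[OF U(1,2)] by blast
      obtain y where y: "y \<in> U \<inter> J" using U by blast
      then obtain x where x: "x \<in> U \<inter> J" "(R ^^ n) x = y" using n by (metis IntD2 imageE)
      \<comment> \<open>Points of \<open>U\<close> that are again in \<open>U\<close> after
        \<open>n\<close> steps. The Julia points among them are mapped into the boundary of
        \<open>C\<close>, so components over \<open>C\<close> accumulate at them.\<close>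
      define U' where "U' = U \<inter> (R ^^ n) -` U"
      have U': "open U'" "U' \<inter> J \<noteq> {}" unfolding U'_def using U open_vimageRn x y by auto
      define \<E> where "\<E> = {E \<in> components F. (R ^^ n) ` E = C}"
      have fin: "finite \<E>" unfolding \<E>_def by (rule finite_comps_over[OF C(1)])
      have "U' \<inter> J \<subseteq> \<Union>(closure ` \<E>)"
      proof
        fix z assume z: "z \<in> U' \<inter> J"
        have "z \<in> closure (\<Union>\<E>)"
          unfolding closure_iff_nhds_not_empty
        proof (intro allI impI)
          fix A N assume N: "N \<subseteq> A" "open N" "z \<in> N"
          have "(R ^^ n) z \<in> U \<inter> J" using z julia_Rn_iff[of n z] unfolding U'_def by blast
          then have "(R ^^ n) z \<in> closure C" using U(3) unfolding frontier_def by blast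
          moreover have "(R ^^ n) z \<in> (R ^^ n) ` N" "open ((R ^^ n) ` N)" using N openRn by blast+
          ultimately obtain c where "c \<in> C" "c \<in> (R ^^ n) ` N"
            using open_Int_closure_eq_empty[of "(R ^^ n) ` N" C] by blast
          then obtain w where w: "w \<in> N" "(R ^^ n) w \<in> C" by blast
          then obtain E where "E \<in> components F" "w \<in> E" "(R ^^ n) ` E = C" using comp_over[OF C(1)] by blast
          then show "\<Union>\<E> \<inter> A \<noteq> {}" using w N unfolding \<E>_def by blast
        qed
        moreover have "closure (\<Union>\<E>) \<subseteq> \<Union>(closure ` \<E>)"
          using fin closure_subset by (intro closure_minimal closed_Union) auto
        ultimately show "z \<in> \<Union>(closure ` \<E>)" by blast
      qed
      then have "\<exists>E'\<in>closure ` \<E>. \<exists>V. open V \<and> V \<subseteq> U' \<and> V \<inter> J \<noteq> {} \<and> V \<inter> J \<subseteq> E'"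
        by (rule finite_closed_cover[rotated 4]) (use fin U' in auto)
      then obtain E V where E: "E \<in> \<E>" "open V" "V \<subseteq> U'" "V \<inter> J \<noteq> {}" "V \<inter> J \<subseteq> closure E"
        by blast
      have Ec: "E \<in> components F" "(R ^^ n) ` E = C" using E(1) unfolding \<E>_def by blast+
      have "V \<inter> J \<subseteq> frontier E" using frontier_comp[OF Ec(1)] E(5) by blast
      moreover have "V \<inter> J \<subseteq> frontier C" using E(3) U(3) unfolding U'_def by blast
      moreover have "V \<inter> J \<subseteq> frontier D" using Dc(2) by blast
      moreover have "E \<noteq> D" using Ec(2) RnD CD by blast
      \<comment> \<open>For \<open>n = 0\<close> the boundary of \<open>C\<close> would be all of
        \<open>J\<close>, against the uniqueness of \<open>D\<close>; for \<open>n > 0\<close> the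
        iterate sends \<open>C\<close> to \<open>D\<close>.\<close>
      moreover have "E \<noteq> C"
      proof
        assume "E = C"
        then have RnC: "(R ^^ n) ` C = C" using Ec(2) by simp
        show False
        proof (cases n)
          case 0
          then have "J \<subseteq> frontier C" using n U(3) by simp
          then have "full C" using C(1) frontier_comp_subset unfolding full_def by blast
          then show False using False CD by blast
        next
          case (Suc m)
          have "(R ^^ n) ` C = (R ^^ m) ` R ` C" unfolding Suc funpow_Suc_right by (simp add: image_image)
          then show False using RnC C(2) RnD CD by simp
        qed
      qed
      ultimately show False using no E(2,4) Ec(1) C(1) Dc(1) CD by blast
    qed
    have "R -` D \<subseteq> D"
    proof
      fix x assume "x \<in> R -` D"
      then obtain C where "C \<in> components F" "x \<in> C" "R ` C = D" using comp_over[OF Dc(1), of 1 x] by auto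
      then show "x \<in> D" using ne by blast
    qed
    then have "(R \<circ> R) -` D \<subseteq> D" unfolding vimage_comp[symmetric] by blast
    then show False using completely_invariantI[OF Dc(1)] ni Dc(1) by blast
  qed
qed

end

section \<open>Continuous logarithms and crossing continua\<close>

definition has_log :: "complex set \<Rightarrow> (complex \<Rightarrow> complex) \<Rightarrow> bool" where
  "has_log T f \<longleftrightarrow> (\<exists>g. continuous_on T g \<and> (\<forall>z\<in>T. f z = exp (g z)))"

text \<open>The difference is continuous with values in the integer multiples of
  \<open>2 * pi * \<i>\<close>, which are more than 1 apart.\<close>

lemma logs_differ_by_constant:
  fixes u v :: "'a::topological_space \<Rightarrow> complex"
  assumes "connected T" "continuous_on T u" "continuous_on T v" "\<And>x. x \<in> T \<Longrightarrow> exp (u x) = exp (v x)"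
  shows "\<exists>k::int. \<forall>x\<in>T. u x - v x = of_int k * (2 * of_real pi * \<i>)"
proof (cases "T = {}")
  case False
  have per: "\<exists>k::int. u x - v x = of_int k * (2 * of_real pi * \<i>)" if "x \<in> T" for x
  proof -
    have "\<exists>n::int. u x = v x + (of_int (2 * n) * pi) * \<i>" using assms(4)[OF that] unfolding exp_eq by blast
    then obtain n :: int where "u x = v x + (of_int (2 * n) * pi) * \<i>" by blast
    then show ?thesis by (intro exI[of _ n]) (simp add: algebra_simps)
  qed
  have "(\<lambda>x. u x - v x) constant_on T"
  proof (rule continuous_discrete_range_constant[OF assms(1)])
    show "continuous_on T (\<lambda>x. u x - v x)" using assms by (intro continuous_intros)
    fix x assume x: "x \<in> T"
    have "1 \<le> norm (u y - v y - (u x - v x))" if y: "y \<in> T" "u y - v y \<noteq> u x - v x" for y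
    proof -
      obtain k l :: int where kl: "u x - v x = of_int k * (2 * of_real pi * \<i>)" "u y - v y = of_int l * (2 * of_real pi * \<i>)"
        using per x y by metis
      then have "l \<noteq> k" using y(2) by auto
      then have "1 \<le> \<bar>real_of_int (l - k)\<bar>" by linarith
      moreover have "u y - v y - (u x - v x) = of_int (l - k) * (2 * of_real pi * \<i>)"
        unfolding kl by (simp add: algebra_simps)
      then have "norm (u y - v y - (u x - v x)) = \<bar>real_of_int (l - k)\<bar> * (2 * pi)"
        by (simp add: norm_mult del: of_int_diff)
      moreover have "1 * 1 \<le> \<bar>real_of_int (l - k)\<bar> * (2 * pi)"
        using calculation(1) pi_gt3 by (intro mult_mono) auto
      ultimately show ?thesis by simp
    qed
    then show "\<exists>e>0. \<forall>y. y \<in> T \<and> u y - v y \<noteq> u x - v x \<longrightarrow> e \<le> norm (u y - v y - (u x - v x))"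
      by (intro exI[of _ 1]) auto
  qed
  then obtain c where c: "\<And>x. x \<in> T \<Longrightarrow> u x - v x = c" unfolding constant_on_def by blast
  obtain x0 where "x0 \<in> T" using False by blast
  then show ?thesis using c per by metis
qed auto

text \<open>The function \<open>H\<close> below glues \<open>(z - c') powi b / exp g\<close>, on the closure of \<open>C\<close>, to
  \<open>(z - c) powi (-a)\<close> outside. It has a continuous logarithm on the whole plane, so \<open>a\<close>, its winding
  number on a large circle, vanishes.\<close>

lemma log_of_separated_exponent:
  fixes K C :: "complex set"
  assumes K: "compact K" and C: "open C" "bounded C" "frontier C \<subseteq> K"
    and c: "c \<in> C" "c' \<notin> closure C" "c \<notin> K" "c' \<notin> K"
    and g: "continuous_on K g" "\<And>z. z \<in> K \<Longrightarrow> (z - c) powi a * (z - c') powi b = exp (g z)"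
  shows "a = 0"
proof -
  have "closedin (top_of_set UNIV) K" using K compact_imp_closed by simp
  then obtain G where G: "continuous_on UNIV G" "\<And>z. z \<in> K \<Longrightarrow> G z = g z"
    using Tietze_unbounded[OF g(1)] by blast
  define H where "H z = (if z \<in> closure C then (z - c') powi b * exp (- G z) else (z - c) powi (- a))" for z
  have "continuous_on (closure C \<union> - C) H"
    unfolding H_def
  proof (rule continuous_on_cases)
    show "continuous_on (closure C) (\<lambda>z. (z - c') powi b * exp (- G z))"
      using c(2) by (intro continuous_intros continuous_on_subset[OF G(1)]) auto
    show "continuous_on (- C) (\<lambda>z. (z - c) powi (- a))"
      using c(1) by (intro continuous_intros) auto
    show "\<forall>z. z \<in> closure C \<and> \<not> z \<in> closure C \<or> z \<in> - C \<and> z \<in> closure C \<longrightarrow>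
        (z - c') powi b * exp (- G z) = (z - c) powi (- a)"
    proof (intro allI impI)
      fix z assume "z \<in> closure C \<and> \<not> z \<in> closure C \<or> z \<in> - C \<and> z \<in> closure C"
      then have "z \<in> frontier C" using C(1) by (auto simp: frontier_def interior_open)
      then have z: "z \<in> K" using C(3) by blast
      then have "z \<noteq> c" using c by blast
      have "exp (- G z) = inverse ((z - c) powi a * (z - c') powi b)"
        unfolding exp_minus G(2)[OF z] g(2)[OF z] ..
      moreover have "(z - c') powi b \<noteq> 0" using z c(4) by (auto simp: power_int_eq_0_iff)
      ultimately show "(z - c') powi b * exp (- G z) = (z - c) powi (- a)"
        by (simp add: power_int_minus)
    qed
  qed (use C in \<open>auto simp: closed_Compl\<close>)
  moreover have "closure C \<union> - C = UNIV" using closure_subset by blast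
  ultimately have contH: "continuous_on UNIV H" by simp
  have H0: "H z \<noteq> 0" for z
    using c closure_subset[of C] by (auto simp: H_def power_int_eq_0_iff)
  obtain L where L: "continuous_on UNIV L" "\<And>z. H z = exp (L z)"
    using continuous_logarithm_on_contractible[OF contH convex_imp_contractible[OF convex_UNIV]] H0 by auto
  obtain r where r: "r > 0" "closure C \<subseteq> ball c r"
    using C(2) bounded_closure bounded_subset_ballD by metis
  define \<gamma> where "\<gamma> \<theta> = c + of_real r * exp (\<i> * of_real \<theta>)" for \<theta> :: real
  have \<gamma>: "\<gamma> \<theta> \<notin> closure C" for \<theta>
    using r by (auto simp: \<gamma>_def subset_eq dist_norm norm_mult)
  have "exp (L (\<gamma> \<theta>)) = exp (- (of_int a * (of_real (ln r) + \<i> * of_real \<theta>)))" for \<theta>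
  proof -
    have "exp (L (\<gamma> \<theta>)) = (of_real r * exp (\<i> * of_real \<theta>)) powi (- a)"
      using L(2)[of "\<gamma> \<theta>"] \<gamma>[of \<theta>] by (simp add: H_def) (simp add: \<gamma>_def)
    also have "of_real r * exp (\<i> * of_real \<theta>) = exp (of_real (ln r) + \<i> * of_real \<theta>)"
      using r(1) by (simp add: exp_add exp_of_real)
    also have "\<dots> powi (- a) = exp (of_int (- a) * (of_real (ln r) + \<i> * of_real \<theta>))"
      by (rule exp_power_int)
    finally show ?thesis by simp
  qed
  moreover have "continuous_on UNIV (\<lambda>\<theta>. L (\<gamma> \<theta>))"
    unfolding \<gamma>_def by (intro continuous_on_compose2[OF L(1)] continuous_intros) auto
  moreover have "continuous_on UNIV (\<lambda>\<theta>::real. - (of_int a * (of_real (ln r) + \<i> * of_real \<theta>)))"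
    by (intro continuous_intros)
  ultimately obtain k :: int where k: "\<And>\<theta>. L (\<gamma> \<theta>) - - (of_int a * (of_real (ln r) + \<i> * of_real \<theta>)) = of_int k * (2 * of_real pi * \<i>)"
    using logs_differ_by_constant[OF connected_UNIV, of "\<lambda>\<theta>. L (\<gamma> \<theta>)" "\<lambda>\<theta>. - (of_int a * (of_real (ln r) + \<i> * of_real \<theta>))"] by auto
  have "exp (\<i> * of_real (2 * pi)) = 1" using exp_two_pi_i by (simp add: mult.commute mult.left_commute)
  then have "\<gamma> (2 * pi) = \<gamma> 0" by (simp add: \<gamma>_def)
  then have "of_int a * (of_real (ln r) + \<i> * of_real (2 * pi)) = of_int a * (of_real (ln r) + \<i> * of_real 0)"
    using k[of 0] k[of "2 * pi"] unfolding diff_minus_eq_add by (metis add_left_cancel)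
  then show ?thesis by simp
qed

text \<open>In \<open>z - c' = (z - c) * (1 + (c - c') / (z - c))\<close> the second factor has
  positive real part, so its principal logarithm is continuous.\<close>

lemma has_log_shift:
  assumes "has_log T (\<lambda>z. z - c)" "\<And>z. z \<in> T \<Longrightarrow> dist c c' < dist z c"
  shows "has_log T (\<lambda>z. z - c')"
proof -
  obtain g where g: "continuous_on T g" "\<And>z. z \<in> T \<Longrightarrow> z - c = exp (g z)"
    using assms(1) unfolding has_log_def by blast
  have zc: "z \<noteq> c" if "z \<in> T" for z using assms(2)[OF that] by (metis dist_self not_le zero_le_dist)
  have pos: "1 + (c - c') / (z - c) \<notin> \<real>\<^sub>\<le>\<^sub>0" if "z \<in> T" for z
  proof -
    have "cmod ((c - c') / (z - c)) < 1"
      using assms(2)[OF that] zc[OF that] by (simp add: norm_divide dist_norm)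
    then have "\<bar>Re ((c - c') / (z - c))\<bar> < 1" using abs_Re_le_cmod le_less_trans by blast
    then show ?thesis by (auto simp: complex_nonpos_Reals_iff)
  qed
  have ne: "1 + (c - c') / (z - c) \<noteq> 0" if "z \<in> T" for z
    using pos[OF that] by (metis nonpos_Reals_zero_I)
  show ?thesis unfolding has_log_def
  proof (intro exI conjI ballI)
    show "continuous_on T (\<lambda>z. g z + Ln (1 + (c - c') / (z - c)))"
      using pos zc by (intro continuous_intros g(1)) auto
    fix z assume z: "z \<in> T"
    have "exp (g z + Ln (1 + (c - c') / (z - c))) = (z - c) * (1 + (c - c') / (z - c))"
      using ne[OF z] g(2)[OF z] by (simp add: exp_add)
    also have "\<dots> = z - c'" using zc[OF z] by (simp add: distrib_left)
    finally show "z - c' = exp (g z + Ln (1 + (c - c') / (z - c)))" by simp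
  qed
qed

section \<open>Passage between sphere and plane\<close>

lemma dist_Fin_Infty: "dist (Fin z) Infty * cmod z \<le> 2"
proof -
  have "(z, 1) \<noteq> (0::C2)" "(1, 0) \<noteq> (0::C2)" by (auto simp: zero_prod_def)
  from dist_proj[OF this] have d: "dist (Fin z) Infty = 2 / norm (z, 1::complex)"
    unfolding proj_Fin proj_Infty by (simp add: br_def norm_Pair)
  have "cmod z \<le> norm (z, 1::complex)" by (metis fst_conv norm_fst_le)
  moreover have "norm (z, 1::complex) > 0" by (auto simp: zero_prod_def)
  ultimately show ?thesis unfolding d by (simp add: field_simps)
qed

lemma bounded_Fin_vimage:
  assumes "open U" "Infty \<in> U" "T \<inter> U = {}"
  shows "\<exists>\<rho>>0. \<forall>z \<in> Fin -` T. cmod z < \<rho>"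
proof -
  obtain e where e: "e > 0" "ball Infty e \<subseteq> U" using assms openE by blast
  \<comment> \<open>The numerator 3 exceeds the constant 2 of \<open>dist_Fin_Infty\<close>.\<close>
  have "cmod z < 3 / e" if "z \<in> Fin -` T" for z
  proof (rule ccontr)
    assume "\<not> cmod z < 3 / e"
    then have z: "3 \<le> e * cmod z" using e(1) by (simp add: field_simps)
    have "Fin z \<notin> ball Infty e" using that e assms(3) by blast
    then have "e \<le> dist (Fin z) Infty" by (simp add: dist_commute)
    then have "e * cmod z \<le> dist (Fin z) Infty * cmod z" by (intro mult_right_mono) auto
    then show False using dist_Fin_Infty[of z] z by linarith
  qed
  then show ?thesis using e(1) by (intro exI[of _ "3 / e"]) auto
qed

lemma closed_Fin_vimage: "closed T \<Longrightarrow> closed (Fin -` T)"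
  using continuous_on_closed_vimage[of UNIV Fin] continuous_on_Fin[of UNIV] by simp

lemma open_Fin_vimage: "open T \<Longrightarrow> open (Fin -` T)"
  using continuous_on_open_vimage[of UNIV Fin] continuous_on_Fin[of UNIV] by simp

lemma connected_Fin_vimage:
  assumes "connected T" "Infty \<notin> T" shows "connected (Fin -` T)"
proof -
  have "T \<subseteq> range Fin" unfolding range_Fin using assms by blast
  then have "Fin -` T = coord ` T" by (force simp: image_iff)
  moreover have "connected (coord ` T)"
    using assms by (intro connected_continuous_image continuous_on_subset[OF continuous_on_coord]) auto
  ultimately show ?thesis by simp
qed

lemma compact_Fin_vimage:
  assumes "closed T" "Infty \<notin> T" shows "compact (Fin -` T)"
proof -
  have "open (- T)" "Infty \<in> - T" "T \<inter> - T = {}" using assms by auto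
  from bounded_Fin_vimage[OF this] obtain \<rho> where "\<And>z. z \<in> Fin -` T \<Longrightarrow> cmod z < \<rho>" by blast
  then have "bounded (Fin -` T)" unfolding bounded_iff by (meson less_imp_le)
  then show ?thesis using closed_Fin_vimage[OF assms(1)] compact_eq_bounded_closed by blast
qed

text \<open>The points \<open>c\<close> outside \<open>T\<close> for which \<open>z - c\<close> has a continuous logarithm on \<open>T\<close> form, together with
  the point at infinity, a relatively clopen subset of the complement of \<open>T\<close>.\<close>

lemma has_log_if_connected_to_Infty:
  assumes T: "closed T" and A: "connected A" "A \<inter> T = {}" "Infty \<in> A" "Fin c \<in> A"
  shows "has_log (Fin -` T) (\<lambda>z. z - c)"
proof -
  define T' where "T' = Fin -` T"
  have T': "compact T'" unfolding T'_def by (rule compact_Fin_vimage) (use T A in auto)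
  have "\<exists>\<rho>>0. \<forall>z\<in>T'. cmod z < \<rho>"
    unfolding T'_def by (rule bounded_Fin_vimage[of "- T"]) (use T A in auto)
  then obtain \<rho> where \<rho>: "\<rho> > 0" "\<And>z. z \<in> T' \<Longrightarrow> cmod z < \<rho>" by blast
  define G where "G = {c. c \<notin> T' \<and> has_log T' (\<lambda>z. z - c)}"
  \<comment> \<open>In \<open>z - c = - c * (1 - z / c)\<close> the second factor has positive real
    part for all \<open>z\<close> of modulus less than \<open>\<rho>\<close>.\<close>
  have big: "c \<in> G" if "\<rho> < cmod c" for c
  proof -
    have "c \<notin> T'" using \<rho>(2)[of c] that by auto
    have c0: "c \<noteq> 0" using that \<rho>(1) by auto
    have pos: "1 - z / c \<notin> \<real>\<^sub>\<le>\<^sub>0" if "z \<in> T'" for z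
    proof -
      have "cmod (z / c) < 1" using \<rho>(2)[OF that] \<open>\<rho> < cmod c\<close> c0 by (simp add: norm_divide divide_less_eq)
      then have "\<bar>Re (z / c)\<bar> < 1" using abs_Re_le_cmod le_less_trans by blast
      then show ?thesis by (auto simp: complex_nonpos_Reals_iff)
    qed
    have "has_log T' (\<lambda>z. z - c)" unfolding has_log_def
    proof (intro exI conjI ballI)
      show "continuous_on T' (\<lambda>z. Ln (- c) + Ln (1 - z / c))"
        using pos c0 by (intro continuous_intros) auto
      fix z assume "z \<in> T'"
      then have "1 - z / c \<noteq> 0" using pos by (metis nonpos_Reals_zero_I)
      then show "z - c = exp (Ln (- c) + Ln (1 - z / c))"
        using c0 by (simp add: exp_add field_simps)
    qed
    then show ?thesis using \<open>c \<notin> T'\<close> by (simp add: G_def)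
  qed
  have loc: "\<exists>e>0. \<forall>c'. dist c c' < e \<longrightarrow> c' \<notin> T' \<and> (c' \<in> G \<longleftrightarrow> c \<in> G)" if c: "c \<notin> T'" for c
  proof -
    have "open (- T')" using T' compact_imp_closed by blast
    then obtain e where e: "e > 0" "ball c e \<subseteq> - T'" using c by (meson ComplI openE)
    have far: "e \<le> dist z c" if "z \<in> T'" for z
      using e(2) that by (metis ComplD dist_commute mem_ball not_le subsetD)
    \<comment> \<open>Half the radius makes \<open>c\<close> and \<open>c'\<close> interchangeable
      in \<open>has_log_shift\<close>, so membership in \<open>G\<close> passes both ways.\<close>
    have "c' \<notin> T' \<and> (c' \<in> G \<longleftrightarrow> c \<in> G)" if c': "dist c c' < e / 2" for c'
    proof -
      have "c' \<notin> T'" using far[of c'] c' e(1) by (auto simp: dist_commute)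
      moreover have "dist c c' < dist z c" "dist c' c < dist z c'" if "z \<in> T'" for z
        using far[OF that] c' e(1) dist_triangle[of z c c'] by (simp_all add: dist_commute)
      then have "has_log T' (\<lambda>z. z - c') \<longleftrightarrow> has_log T' (\<lambda>z. z - c)"
        by (intro iffI) (erule has_log_shift, assumption)+
      ultimately show ?thesis using c by (simp add: G_def)
    qed
    then show ?thesis using half_gt_zero[OF e(1)] by blast
  qed
  have oG: "open G"
    unfolding open_dist
  proof
    fix x assume x: "x \<in> G"
    then have "x \<notin> T'" by (simp add: G_def)
    from loc[OF this] obtain e where e: "e > 0" "\<forall>c'. dist x c' < e \<longrightarrow> c' \<notin> T' \<and> (c' \<in> G \<longleftrightarrow> x \<in> G)" by blast
    have "y \<in> G" if "dist y x < e" for y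
      using e(2)[rule_format, of y] that x by (simp only: dist_commute)
    then show "\<exists>e>0. \<forall>y. dist y x < e \<longrightarrow> y \<in> G" using e(1) by blast
  qed
  have oG': "open (- T' - G)"
    unfolding open_dist
  proof
    fix x assume x: "x \<in> - T' - G"
    then have "x \<notin> T'" by blast
    from loc[OF this] obtain e where e: "e > 0" "\<forall>c'. dist x c' < e \<longrightarrow> c' \<notin> T' \<and> (c' \<in> G \<longleftrightarrow> x \<in> G)" by blast
    have "y \<in> - T' - G" if "dist y x < e" for y
      using e(2)[rule_format, of y] that x by (simp only: dist_commute) blast
    then show "\<exists>e>0. \<forall>y. dist y x < e \<longrightarrow> y \<in> - T' - G" using e(1) by blast
  qed
  \<comment> \<open>\<open>U1\<close> adds a neighbourhood of \<open>Infty\<close> to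
    \<open>G\<close>; it is disjoint from \<open>U2\<close> because every point of modulus above
    \<open>\<rho>\<close> belongs to \<open>G\<close>.\<close>
  define U1 where "U1 = Fin ` G \<union> - (Fin ` cball 0 \<rho>)"
  define U2 where "U2 = Fin ` (- T' - G)"
  have "closed (Fin ` cball 0 \<rho>)"
    by (intro compact_imp_closed compact_continuous_image continuous_on_Fin compact_cball)
  then have o1: "open U1" unfolding U1_def by (intro open_Un open_Fin_image oG open_Compl)
  have o2: "open U2" unfolding U2_def by (intro open_Fin_image oG')
  have dis: "U1 \<inter> U2 = {}"
  proof -
    have "z \<in> G" if "Fin z \<notin> Fin ` cball 0 \<rho>" for z
    proof -
      have "z \<notin> cball 0 \<rho>" using that by blast
      then show ?thesis using big[of z] by simp
    qed
    then show ?thesis unfolding U1_def U2_def by auto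
  qed
  have cov: "A \<subseteq> U1 \<union> U2"
  proof
    fix x assume x: "x \<in> A"
    show "x \<in> U1 \<union> U2"
    proof (cases x)
      case Infty
      then show ?thesis unfolding U1_def by auto
    next
      case (Fin z)
      then have "z \<notin> T'" using x A(2) unfolding T'_def by blast
      then show ?thesis unfolding U1_def U2_def Fin by blast
    qed
  qed
  have "Infty \<in> U1" unfolding U1_def by auto
  then have "A \<inter> U2 = {}" using connectedD[OF A(1) o1 o2] dis cov A(3) by blast
  then have "Fin c \<notin> U2" using A(4) by blast
  moreover have "c \<notin> T'" using A(2,4) unfolding T'_def by blast
  ultimately have "c \<in> G" unfolding U2_def by blast
  then show ?thesis unfolding G_def T'_def by blast
qed

text \<open>The difference \<open>m - n\<close> is the monodromy of the logarithm of \<open>f\<close> around the cycle \<open>P\<close>, \<open>P'\<close>, \<open>Q\<close>, \<open>Q'\<close>.\<close>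

lemma crossing_logs:
  fixes P P' Q Q' :: "complex set"
  assumes con: "connected P" "connected P'" "connected Q" "connected Q'"
    and l: "has_log (P \<union> P') f" "has_log (Q \<union> Q') f" "has_log (P' \<union> Q) f" "has_log (P \<union> Q') f"
  shows "\<exists>u v (m::int) (n::int). continuous_on (P \<union> P') u \<and> continuous_on (Q \<union> Q') v \<and>
     (\<forall>z\<in>P \<union> P'. f z = exp (u z)) \<and> (\<forall>z\<in>Q \<union> Q'. f z = exp (v z)) \<and>
     (\<forall>z\<in>P' \<inter> Q. u z - v z = of_int m * (2 * of_real pi * \<i>)) \<and>
     (\<forall>z\<in>P \<inter> Q'. u z - v z = of_int n * (2 * of_real pi * \<i>))"
proof -
  obtain u v w w' where
    u: "continuous_on (P \<union> P') u" "\<And>z. z \<in> P \<union> P' \<Longrightarrow> f z = exp (u z)" and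
    v: "continuous_on (Q \<union> Q') v" "\<And>z. z \<in> Q \<union> Q' \<Longrightarrow> f z = exp (v z)" and
    w: "continuous_on (P' \<union> Q) w" "\<And>z. z \<in> P' \<union> Q \<Longrightarrow> f z = exp (w z)" and
    w': "continuous_on (P \<union> Q') w'" "\<And>z. z \<in> P \<union> Q' \<Longrightarrow> f z = exp (w' z)"
    using l unfolding has_log_def by metis
  have d: "\<exists>k::int. \<forall>x\<in>X. s x - t x = of_int k * (2 * of_real pi * \<i>)"
    if "connected X" "X \<subseteq> A" "X \<subseteq> B" "continuous_on A s" "continuous_on B t"
      "\<And>z. z \<in> A \<Longrightarrow> f z = exp (s z)" "\<And>z. z \<in> B \<Longrightarrow> f z = exp (t z)" for X A B s t
  proof (rule logs_differ_by_constant)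
    show "exp (s x) = exp (t x)" if "x \<in> X" for x
      using \<open>x \<in> X\<close> \<open>X \<subseteq> A\<close> \<open>X \<subseteq> B\<close> \<open>\<And>z. z \<in> A \<Longrightarrow> f z = exp (s z)\<close> \<open>\<And>z. z \<in> B \<Longrightarrow> f z = exp (t z)\<close>
      by (metis subsetD)
  qed (use that in \<open>auto intro: continuous_on_subset\<close>)
  obtain k1 :: int where k1: "\<forall>x\<in>P'. u x - w x = of_int k1 * (2 * of_real pi * \<i>)"
    using d[OF con(2) _ _ u(1) w(1) u(2) w(2)] by blast
  obtain k2 :: int where k2: "\<forall>x\<in>Q. v x - w x = of_int k2 * (2 * of_real pi * \<i>)"
    using d[OF con(3) _ _ v(1) w(1) v(2) w(2)] by blast
  obtain k3 :: int where k3: "\<forall>x\<in>P. u x - w' x = of_int k3 * (2 * of_real pi * \<i>)"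
    using d[OF con(1) _ _ u(1) w'(1) u(2) w'(2)] by blast
  obtain k4 :: int where k4: "\<forall>x\<in>Q'. v x - w' x = of_int k4 * (2 * of_real pi * \<i>)"
    using d[OF con(4) _ _ v(1) w'(1) v(2) w'(2)] by blast
  have "u z - v z = of_int (k1 - k2) * (2 * of_real pi * \<i>)" if "z \<in> P' \<inter> Q" for z
  proof -
    have "u z - v z = (u z - w z) - (v z - w z)" by simp
    also have "\<dots> = of_int (k1 - k2) * (2 * of_real pi * \<i>)" using that k1 k2 by (simp add: algebra_simps)
    finally show ?thesis .
  qed
  moreover have "u z - v z = of_int (k3 - k4) * (2 * of_real pi * \<i>)" if "z \<in> P \<inter> Q'" for z
  proof -
    have "u z - v z = (u z - w' z) - (v z - w' z)" by simp
    also have "\<dots> = of_int (k3 - k4) * (2 * of_real pi * \<i>)" using that k3 k4 by (simp add: algebra_simps)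
    finally show ?thesis .
  qed
  ultimately show ?thesis using u v by blast
qed

text \<open>Some nontrivial integer combination of the monodromies of \<open>f2\<close> and
  \<open>f3\<close> is 0, and for that product of powers the logarithms on the two halves can be
  glued. The conditions \<open>cross\<close> confine the overlap of the halves to
  \<open>P' \<inter> Q\<close> and \<open>P \<inter> Q'\<close>, where the differences of logarithms
  are known.\<close>

lemma crossing_combined_log:
  fixes P P' Q Q' :: "complex set"
  assumes con: "connected P" "connected P'" "connected Q" "connected Q'"
    and cl: "closed P" "closed P'" "closed Q" "closed Q'"
    and cross: "P \<inter> Q \<subseteq> P' \<union> Q'" "P' \<inter> Q' \<subseteq> P \<union> Q"
    and l: "\<And>f. f \<in> {f2, f3} \<Longrightarrow> has_log (P \<union> P') f \<and> has_log (Q \<union> Q') f \<and> has_log (P' \<union> Q) f \<and> has_log (P \<union> Q') f"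
  shows "\<exists>(a::int) (b::int). (a \<noteq> 0 \<or> b \<noteq> 0) \<and> has_log (P \<union> P' \<union> (Q \<union> Q')) (\<lambda>z. f2 z powi a * f3 z powi b)"
proof -
  let ?p = "2 * of_real pi * \<i> :: complex"
  let ?L = "\<lambda>f u v m n. continuous_on (P \<union> P') u \<and> continuous_on (Q \<union> Q') v \<and>
     (\<forall>z\<in>P \<union> P'. f z = exp (u z)) \<and> (\<forall>z\<in>Q \<union> Q'. f z = exp (v z)) \<and>
     (\<forall>z\<in>P' \<inter> Q. u z - v z = of_int m * ?p) \<and> (\<forall>z\<in>P \<inter> Q'. u z - v z = of_int n * ?p)"
  have lg: "\<exists>u v (m::int) (n::int). ?L f u v m n" if "f \<in> {f2, f3}" for f
    by (rule crossing_logs[OF con]) (use l[OF that] in blast)+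
  obtain u2 v2 and m2 n2 :: int where h2: "?L f2 u2 v2 m2 n2" using lg[of f2] by blast
  obtain u3 v3 and m3 n3 :: int where h3: "?L f3 u3 v3 m3 n3" using lg[of f3] by blast
  note c = h2[THEN conjunct1] h2[THEN conjunct2, THEN conjunct1] h3[THEN conjunct1] h3[THEN conjunct2, THEN conjunct1]
  have e: "f2 z = exp (u2 z)" "f3 z = exp (u3 z)" if "z \<in> P \<union> P'" for z using h2 h3 that by blast+
  have e': "f2 z = exp (v2 z)" "f3 z = exp (v3 z)" if "z \<in> Q \<union> Q'" for z using h2 h3 that by blast+
  have d: "u2 z - v2 z = of_int m2 * ?p" "u3 z - v3 z = of_int m3 * ?p" if "z \<in> P' \<inter> Q" for z
    using h2 h3 that by blast+
  have d': "u2 z - v2 z = of_int n2 * ?p" "u3 z - v3 z = of_int n3 * ?p" if "z \<in> P \<inter> Q'" for z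
    using h2 h3 that by blast+
  obtain a b :: int where ab: "a \<noteq> 0 \<or> b \<noteq> 0" "a * (m2 - n2) + b * (m3 - n3) = 0"
  proof (cases "m2 = n2 \<and> m3 = n3")
    case True
    then show ?thesis by (intro that[of 1 0]) auto
  next
    case False
    then show ?thesis by (intro that[of "m3 - n3" "n2 - m2"]) (auto simp: algebra_simps)
  qed
  \<comment> \<open>By the choice of \<open>a\<close> and \<open>b\<close> the combined logarithms
    differ by the same multiple \<open>M\<close> of the period on both overlaps; adding it to
    \<open>v\<close> closes the gap.\<close>
  define M where "M = a * m2 + b * m3"
  have M': "M = a * n2 + b * n3" using ab(2) by (simp add: M_def algebra_simps)
  define u where "u z = of_int a * u2 z + of_int b * u3 z" for z
  define v where "v z = of_int a * v2 z + of_int b * v3 z + of_int M * ?p" for z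
  have uv: "u z = v z" if z: "z \<in> P' \<inter> Q \<or> z \<in> P \<inter> Q'" for z
  proof -
    have "u z - v z = of_int a * (u2 z - v2 z) + of_int b * (u3 z - v3 z) - of_int M * ?p"
      by (simp add: u_def v_def algebra_simps)
    also have "\<dots> = 0" using z
    proof
      assume z: "z \<in> P' \<inter> Q"
      show ?thesis unfolding d[OF z] M_def by (simp add: algebra_simps)
    next
      assume z: "z \<in> P \<inter> Q'"
      show ?thesis unfolding d'[OF z] M' by (simp add: algebra_simps)
    qed
    finally show ?thesis by simp
  qed
  have "continuous_on (P \<union> P' \<union> (Q \<union> Q')) (\<lambda>z. if z \<in> P \<union> P' then u z else v z)"
  proof (rule continuous_on_cases)
    show "continuous_on (P \<union> P') u" unfolding u_def by (intro continuous_intros c)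
    show "continuous_on (Q \<union> Q') v" unfolding v_def by (intro continuous_intros c)
    show "\<forall>z. z \<in> P \<union> P' \<and> z \<notin> P \<union> P' \<or> z \<in> Q \<union> Q' \<and> z \<in> P \<union> P' \<longrightarrow> u z = v z"
    proof (intro allI impI)
      fix z assume "z \<in> P \<union> P' \<and> z \<notin> P \<union> P' \<or> z \<in> Q \<union> Q' \<and> z \<in> P \<union> P'"
      then have "z \<in> P' \<inter> Q \<or> z \<in> P \<inter> Q'" using cross by blast
      then show "u z = v z" by (rule uv)
    qed
  qed (use cl in auto)
  moreover have "f2 z powi a * f3 z powi b = exp (if z \<in> P \<union> P' then u z else v z)" if z: "z \<in> P \<union> P' \<union> (Q \<union> Q')" for z
  proof (cases "z \<in> P \<union> P'")
    case True
    then show ?thesis by (simp add: e[OF True] u_def exp_add exp_power_int)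
  next
    case False
    then have z': "z \<in> Q \<union> Q'" using z by blast
    have "exp (of_int M * ?p) = 1" using exp_integer_2pi[of "of_int M"] by (simp add: mult.assoc mult.left_commute)
    then show ?thesis using False by (simp add: e'[OF z'] v_def exp_add exp_power_int)
  qed
  ultimately show ?thesis unfolding has_log_def using ab(1) by blast
qed

text \<open>Placing the common denominator point at infinity turns the two quotients into
  \<open>z - c2\<close> and \<open>z - c3\<close>, and makes \<open>C2\<close> and \<open>C3\<close>
  bounded regions of the plane.\<close>

lemma no_crossing_Infty:
  fixes J :: "riemann_sphere set"
  assumes J: "closed J"
    and C: "\<And>C. C \<in> {C1, C2, C3} \<Longrightarrow> open C \<and> connected C \<and> C \<noteq> {} \<and> C \<inter> J = {} \<and> closure C \<subseteq> C \<union> J \<and> O' \<inter> J \<subseteq> closure C"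
    and dis: "C1 \<inter> C2 = {}" "C1 \<inter> C3 = {}" "C2 \<inter> C3 = {}" and Inf: "Infty \<in> C1"
    and con: "connected P" "connected P'" "connected Q" "connected Q'"
    and cl: "closed P" "closed P'" "closed Q" "closed Q'"
    and cross: "P \<inter> Q \<subseteq> P' \<union> Q'" "P' \<inter> Q' \<subseteq> P \<union> Q"
    and cov: "P \<union> P' \<union> (Q \<union> Q') = J"
    and miss: "\<not> O' \<inter> J \<subseteq> P \<union> P'" "\<not> O' \<inter> J \<subseteq> Q \<union> Q'" "\<not> O' \<inter> J \<subseteq> P' \<union> Q" "\<not> O' \<inter> J \<subseteq> P \<union> Q'"
  shows False
proof -
  have InfC: "Infty \<notin> C2" "Infty \<notin> C3" "Infty \<notin> J" using Inf dis C[of C1] by blast+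
  have ex: "\<exists>c. Fin c \<in> X" if "X \<noteq> {}" "Infty \<notin> X" for X
    using that by (metis ex_in_conv riemann_sphere.exhaust)
  obtain c2 where c2: "Fin c2 \<in> C2" using ex[of C2] C[of C2] InfC by auto
  obtain c3 where c3: "Fin c3 \<in> C3" using ex[of C3] C[of C3] InfC by auto
  have log: "has_log (Fin -` T) (\<lambda>z. z - c)"
    if T: "closed T" "T \<subseteq> J" "\<not> O' \<inter> J \<subseteq> T" and c: "Fin c \<in> C'" "C' \<in> {C2, C3}" for T c C'
  proof -
    obtain x where x: "x \<in> O' \<inter> J" "x \<notin> T" using T(3) by blast
    have oT: "open (- T)" using T(1) by (simp add: open_Compl)
    \<comment> \<open>As \<open>x\<close> lies in the closures of all three components, its
      component \<open>N\<close> of \<open>- T\<close> meets each of them and joins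
      \<open>C'\<close> to \<open>C1\<close>, which contains \<open>Infty\<close>.\<close>
    obtain N where N: "N \<in> components (- T)" "x \<in> N" using x(2) Union_components[of "- T"] by blast
    have Nc: "open N" "connected N" "N \<inter> T = {}"
      using open_components_rs[OF oT N(1)] in_components_connected[OF N(1)] in_components_subset[OF N(1)] by blast+
    have meet: "X \<inter> N \<noteq> {}" if "X \<in> {C1, C2, C3}" for X
    proof -
      have "x \<in> closure X" using C[OF that] x(1) by blast
      then show ?thesis using open_Int_closure_eq_empty[OF Nc(1), of X] N(2) by blast
    qed
    have "C' \<in> {C1, C2, C3}" using c(2) by blast
    have "connected (C1 \<union> N)" using C[of C1] Nc(2) meet[of C1] by (intro connected_Un) auto
    then have "connected (C1 \<union> N \<union> C')"
    proof (rule connected_Un)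
      show "connected C'" using C[OF \<open>C' \<in> {C1, C2, C3}\<close>] by blast
      show "(C1 \<union> N) \<inter> C' \<noteq> {}" using meet[OF \<open>C' \<in> {C1, C2, C3}\<close>] by blast
    qed
    moreover have "(C1 \<union> N \<union> C') \<inter> T = {}"
      using C[of C1] C[OF \<open>C' \<in> {C1, C2, C3}\<close>] Nc(3) T(2) by auto
    ultimately show ?thesis
      using has_log_if_connected_to_Infty[OF T(1), of "C1 \<union> N \<union> C'" c] Inf c(1) by blast
  qed
  have InfP: "Infty \<notin> P" "Infty \<notin> P'" "Infty \<notin> Q" "Infty \<notin> Q'" using InfC(3) cov by blast+
  have logs: "has_log (Fin -` P \<union> Fin -` P') (\<lambda>z. z - c) \<and> has_log (Fin -` Q \<union> Fin -` Q') (\<lambda>z. z - c) \<and>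
     has_log (Fin -` P' \<union> Fin -` Q) (\<lambda>z. z - c) \<and> has_log (Fin -` P \<union> Fin -` Q') (\<lambda>z. z - c)"
    if "Fin c \<in> C'" "C' \<in> {C2, C3}" for c C'
    unfolding vimage_Un[symmetric]
    by (intro conjI log[OF _ _ _ that]) (use cl cov miss in auto)
  let ?f = "\<lambda>c z::complex. z - c"
  have "\<exists>(a::int) (b::int). (a \<noteq> 0 \<or> b \<noteq> 0) \<and>
      has_log (Fin -` P \<union> Fin -` P' \<union> (Fin -` Q \<union> Fin -` Q')) (\<lambda>z. ?f c2 z powi a * ?f c3 z powi b)"
  proof (rule crossing_combined_log)
    show "Fin -` P \<inter> Fin -` Q \<subseteq> Fin -` P' \<union> Fin -` Q'" "Fin -` P' \<inter> Fin -` Q' \<subseteq> Fin -` P \<union> Fin -` Q"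
      using cross by blast+
    fix f assume "f \<in> {?f c2, ?f c3}"
    then show "has_log (Fin -` P \<union> Fin -` P') f \<and> has_log (Fin -` Q \<union> Fin -` Q') f \<and>
       has_log (Fin -` P' \<union> Fin -` Q) f \<and> has_log (Fin -` P \<union> Fin -` Q') f"
      using logs[OF c2] logs[OF c3] by auto
  qed (intro connected_Fin_vimage con InfP closed_Fin_vimage cl)+
  then obtain a b :: int where ab: "a \<noteq> 0 \<or> b \<noteq> 0" "has_log (Fin -` J) (\<lambda>z. (z - c2) powi a * (z - c3) powi b)"
    unfolding vimage_Un[symmetric] cov by blast
  then obtain g where g: "continuous_on (Fin -` J) g" "\<And>z. z \<in> Fin -` J \<Longrightarrow> (z - c2) powi a * (z - c3) powi b = exp (g z)"
    unfolding has_log_def by blast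
  have g': "(z - c3) powi b * (z - c2) powi a = exp (g z)" if "z \<in> Fin -` J" for z
    using g(2)[OF that] by (simp add: mult.commute)
  have cJ: "compact (Fin -` J)" by (rule compact_Fin_vimage[OF J InfC(3)])
  have reg: "open (Fin -` X) \<and> bounded (Fin -` X) \<and> frontier (Fin -` X) \<subseteq> Fin -` J \<and> z \<in> Fin -` X \<and>
      w \<notin> closure (Fin -` X) \<and> z \<notin> Fin -` J \<and> w \<notin> Fin -` J"
    if X: "X \<in> {C2, C3}" "Y \<in> {C2, C3}" "X \<inter> Y = {}" and zw: "Fin z \<in> X" "Fin w \<in> Y" for X Y z w
  proof -
    have X': "open X" "X \<inter> J = {}" "closure X \<subseteq> X \<union> J" and Y': "open Y" "Y \<inter> J = {}"
      using X C[of X] C[of Y] by auto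
    have "C1 \<inter> X = {}" using X(1) dis by auto
    then have "X \<inter> C1 = {}" by blast
    then obtain \<rho> where "\<And>z. z \<in> Fin -` X \<Longrightarrow> cmod z < \<rho>"
      using bounded_Fin_vimage[of C1 X] C[of C1] Inf by auto
    then have bd: "bounded (Fin -` X)" unfolding bounded_iff by (meson less_imp_le)
    have op: "open (Fin -` X)" by (rule open_Fin_vimage[OF X'(1)])
    have "Fin -` X \<subseteq> Fin -` closure X" using closure_subset by blast
    then have clX: "closure (Fin -` X) \<subseteq> Fin -` closure X" by (intro closure_minimal closed_Fin_vimage) auto
    then have "frontier (Fin -` X) \<subseteq> Fin -` J"
      using X'(3) op by (auto simp: frontier_def interior_open)
    moreover have "w \<notin> closure (Fin -` X)" using clX X'(3) X(3) zw(2) Y'(2) by blast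
    ultimately show ?thesis using bd op X' Y' zw by auto
  qed
  \<comment> \<open>\<open>C2\<close> is bounded, has its boundary in \<open>J\<close> and keeps
    \<open>c3\<close> outside its closure, so the exponent of \<open>z - c2\<close> vanishes;
    \<open>C3\<close> does the same for the other one.\<close>
  have "a = 0"
    using reg[of C2 C3 c2 c3] dis(3) c2 c3 log_of_separated_exponent[OF cJ _ _ _ _ _ _ _ g] by blast
  moreover have "b = 0"
    using reg[of C3 C2 c3 c2] dis(3) c2 c3 log_of_separated_exponent[OF cJ _ _ _ _ _ _ _ g(1) g'] by blast
  ultimately show False using ab(1) by blast
qed

text \<open>A Moebius transformation, written as a linear map of homogeneous coordinates. Being a
  lift of degree 1, it inherits continuity and openness from the lemmas on
  \<open>hom_lift\<close>.\<close>

lemma homeomorphism_to_Infty: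
  fixes p :: riemann_sphere
  obtains M where "continuous_on UNIV M" "inj M" "\<And>U. open U \<Longrightarrow> open (M ` U)" "M p = Infty"
proof -
  obtain rep where rep: "\<And>z. norm (rep z) = 1" "\<And>z. proj (rep z) = z" using proj_surj by metis
  have rep0: "rep z \<noteq> 0" for z using rep(1)[of z] by (metis norm_zero zero_neq_one)
  define b where "b = rep p"
  \<comment> \<open>Chosen so that \<open>br b b'\<close> is the squared norm of \<open>b\<close>,
    which makes \<open>L\<close> invertible.\<close>
  define b' where "b' = (- cnj (snd b), cnj (fst b))"
  have "br b b' = of_real ((norm b)\<^sup>2)"
    unfolding norm_C2 of_real_add complex_norm_square by (simp add: b'_def br_def)
  then have bb: "br b b' \<noteq> 0" using rep(1) by (simp add: b_def)
  define L where "L X = (br X b', br X b)" for X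
  have brL: "br (L X) (L Y) = br b b' * br Y X" for X Y
    by (simp add: L_def br_def algebra_simps)
  have L0: "L X \<noteq> 0" if "X \<noteq> 0" for X
  proof
    assume "L X = 0"
    then have "br X b' = 0" "br X b = 0" by (simp_all add: L_def zero_prod_def)
    moreover have "scl (br b b') X = scl (br X b') b - scl (br X b) b'"
      by (simp add: scl_def br_def prod_eq_iff algebra_simps)
    ultimately show False using bb that by simp
  qed
  define M where "M x = proj (L (rep x))" for x
  have M_proj: "M (proj X) = proj (L X)" if "X \<noteq> 0" for X
  proof -
    have "br X (rep (proj X)) = 0" using proj_eq_iff[OF that rep0] rep(2) by metis
    then have "br (L (rep (proj X))) (L X) = 0" unfolding brL by simp
    then show ?thesis unfolding M_def using proj_eq_iff[OF L0[OF rep0] L0[OF that]] by blast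
  qed
  have inj: "inj M"
  proof (rule injI)
    fix x y assume "M x = M y"
    then have "br (L (rep x)) (L (rep y)) = 0" unfolding M_def using proj_eq_iff[OF L0[OF rep0] L0[OF rep0]] by blast
    then have "br (rep y) (rep x) = 0" unfolding brL using bb by simp
    then have "proj (rep y) = proj (rep x)" using proj_eq_iff[OF rep0 rep0] by blast
    then show "x = y" by (simp add: rep)
  qed
  have lift: "hom_lift L 1 M"
    unfolding hom_lift_def
  proof (intro conjI allI impI)
    show "continuous_on UNIV L" unfolding L_def by (intro continuous_intros)
    show "L (scl c X) = scl (c ^ 1) (L X)" for c X by (simp add: L_def scl_def br_def algebra_simps)
    show "L X \<noteq> 0" "M (proj X) = proj (L X)" if "X \<noteq> 0" for X using L0 M_proj that by blast+
    show "\<exists>p q. \<forall>t. L (poly a t, poly c t) = (poly p t, poly q t)" for a c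
      by (rule exI[of _ "smult (snd b') a - smult (fst b') c"], rule exI[of _ "smult (snd b) a - smult (fst b) c"])
        (simp add: L_def br_def mult.commute)
  qed
  have fin: "finite (M -` {y})" for y using inj by (simp add: finite_vimageI)
  have "M p = proj (L b)" by (simp add: M_def b_def)
  also have "\<dots> = Infty" by (simp add: L_def proj_def)
  finally show thesis
    using that[OF hom_lift_continuous[OF lift] inj hom_lift_open[OF lift fin]] by blast
qed

text \<open>The hypotheses are purely topological, so a homeomorphism that sends a point of
  \<open>C1\<close> to \<open>Infty\<close> carries them over.\<close>

lemma no_crossing:
  fixes J :: "riemann_sphere set"
  assumes J: "closed J"
    and C: "\<And>C. C \<in> {C1, C2, C3} \<Longrightarrow> open C \<and> connected C \<and> C \<noteq> {} \<and> C \<inter> J = {} \<and> closure C \<subseteq> C \<union> J \<and> O' \<inter> J \<subseteq> closure C"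
    and dis: "C1 \<inter> C2 = {}" "C1 \<inter> C3 = {}" "C2 \<inter> C3 = {}"
    and con: "connected P" "connected P'" "connected Q" "connected Q'"
    and cl: "closed P" "closed P'" "closed Q" "closed Q'"
    and cross: "P \<inter> Q \<subseteq> P' \<union> Q'" "P' \<inter> Q' \<subseteq> P \<union> Q"
    and cov: "P \<union> P' \<union> (Q \<union> Q') = J"
    and miss: "\<not> O' \<inter> J \<subseteq> P \<union> P'" "\<not> O' \<inter> J \<subseteq> Q \<union> Q'" "\<not> O' \<inter> J \<subseteq> P' \<union> Q" "\<not> O' \<inter> J \<subseteq> P \<union> Q'"
  shows False
proof -
  obtain p where p: "p \<in> C1" using C[of C1] by blast
  obtain M where M: "continuous_on UNIV M" "inj M" "\<And>U. open U \<Longrightarrow> open (M ` U)" "M p = Infty"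
    using homeomorphism_to_Infty by blast
  note I = image_Int[OF M(2), symmetric] image_Un[symmetric] inj_image_subset_iff[OF M(2)] closure_image_rs[OF M(1)]
  have clM: "closed (M ` X)" if "closed X" for X
    by (rule compact_imp_closed[OF compact_continuous_image[OF continuous_on_subset[OF M(1) subset_UNIV]
        closed_imp_compact_rs[OF that]]])
  have coM: "connected (M ` X)" if "connected X" for X
    using connected_continuous_image[OF continuous_on_subset[OF M(1) subset_UNIV] that] .
  show False
  proof (rule no_crossing_Infty[of "M ` J" "M ` C1" "M ` C2" "M ` C3" "M ` O'" "M ` P" "M ` P'" "M ` Q" "M ` Q'"])
    fix X assume "X \<in> {M ` C1, M ` C2, M ` C3}"
    then obtain Y where Y: "Y \<in> {C1, C2, C3}" "X = M ` Y" by blast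
    show "open X \<and> connected X \<and> X \<noteq> {} \<and> X \<inter> M ` J = {} \<and> closure X \<subseteq> X \<union> M ` J \<and> M ` O' \<inter> M ` J \<subseteq> closure X"
      unfolding Y(2) I using C[OF Y(1)] M(3) coM by simp
  next
    show "Infty \<in> M ` C1" using p M(4) by (metis imageI)
    show "M ` P \<union> M ` P' \<union> (M ` Q \<union> M ` Q') = M ` J" unfolding I cov ..
    show "closed (M ` J)" "closed (M ` P)" "closed (M ` P')" "closed (M ` Q)" "closed (M ` Q')"
      by (intro clM J cl)+
    show "connected (M ` P)" "connected (M ` P')" "connected (M ` Q)" "connected (M ` Q')"
      by (intro coM con)+
    show "M ` C1 \<inter> M ` C2 = {}" "M ` C1 \<inter> M ` C3 = {}" "M ` C2 \<inter> M ` C3 = {}"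
      unfolding I dis by simp_all
    show "M ` P \<inter> M ` Q \<subseteq> M ` P' \<union> M ` Q'" "M ` P' \<inter> M ` Q' \<subseteq> M ` P \<union> M ` Q"
      unfolding I by (rule cross)+
    show "\<not> M ` O' \<inter> M ` J \<subseteq> M ` P \<union> M ` P'" "\<not> M ` O' \<inter> M ` J \<subseteq> M ` Q \<union> M ` Q'"
      "\<not> M ` O' \<inter> M ` J \<subseteq> M ` P' \<union> M ` Q" "\<not> M ` O' \<inter> M ` J \<subseteq> M ` P \<union> M ` Q'"
      unfolding I by (rule miss)+
  qed
qed

section \<open>Decomposing preimages and merging continua\<close>

text \<open>Each nonempty clopen part of \<open>Z\<close> takes a point of the finite set
  \<open>\<Phi>\<close>, so repeated splitting of disconnected parts must stop.\<close>

lemma clopen_pieces: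
  fixes Z :: "riemann_sphere set"
  assumes "finite \<Phi>" and meet: "\<And>W. closed W \<Longrightarrow> closed (Z - W) \<Longrightarrow> W \<subseteq> Z \<Longrightarrow> W \<noteq> {} \<Longrightarrow> W \<inter> \<Phi> \<noteq> {}"
    and W: "closed W" "closed (Z - W)" "W \<subseteq> Z"
  shows "\<exists>\<V>. finite \<V> \<and> pairwise disjnt \<V> \<and> \<Union>\<V> = W \<and> (\<forall>V\<in>\<V>. closed V \<and> connected V)"
  using W
proof (induction "card (W \<inter> \<Phi>)" arbitrary: W rule: less_induct)
  case less
  show ?case
  proof (cases "connected W")
    case True
    then show ?thesis using less.prems by (intro exI[of _ "{W}"]) auto
  next
    case False
    then obtain A B where AB: "closed A" "closed B" "A \<noteq> {}" "B \<noteq> {}" "A \<union> B = W" "A \<inter> B = {}"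
      unfolding connected_closed_set[OF less.prems(1)] by blast
    have "Z - A = (Z - W) \<union> B" "Z - B = (Z - W) \<union> A" using AB less.prems by blast+
    then have cl: "closed (Z - A)" "closed (Z - B)" using AB less.prems by auto
    have sub: "A \<subseteq> Z" "B \<subseteq> Z" using AB less.prems by blast+
    have ne: "A \<inter> \<Phi> \<noteq> {}" "B \<inter> \<Phi> \<noteq> {}" using meet AB cl sub by blast+
    have "A \<inter> \<Phi> \<subset> W \<inter> \<Phi>" "B \<inter> \<Phi> \<subset> W \<inter> \<Phi>" using ne AB by blast+
    then have lt: "card (A \<inter> \<Phi>) < card (W \<inter> \<Phi>)" "card (B \<inter> \<Phi>) < card (W \<inter> \<Phi>)"
      using assms(1) by (simp_all add: psubset_card_mono)
    obtain \<A> where \<A>: "finite \<A>" "pairwise disjnt \<A>" "\<Union>\<A> = A" "\<forall>V\<in>\<A>. closed V \<and> connected V"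
      using less.hyps[OF lt(1) AB(1) cl(1) sub(1)] by blast
    obtain \<B> where \<B>: "finite \<B>" "pairwise disjnt \<B>" "\<Union>\<B> = B" "\<forall>V\<in>\<B>. closed V \<and> connected V"
      using less.hyps[OF lt(2) AB(2) cl(2) sub(2)] by blast
    have "disjnt V V'" if "V \<in> \<A>" "V' \<in> \<B>" for V V'
      using that \<A>(3) \<B>(3) AB(6) unfolding disjnt_def by blast
    then have "pairwise disjnt (\<A> \<union> \<B>)"
      using \<A>(2) \<B>(2) unfolding pairwise_def by (auto simp: disjnt_sym)
    moreover have "\<Union>(\<A> \<union> \<B>) = W" using \<A>(3) \<B>(3) AB(5) by auto
    ultimately show ?thesis using \<A> \<B> by (intro exI[of _ "\<A> \<union> \<B>"]) auto
  qed
qed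

text \<open>A nonempty clopen part of the preimage has a clopen image in \<open>A\<close>, hence is
  mapped onto \<open>A\<close> and meets the finite fibre over a chosen point.\<close>

lemma (in rational_dyn) preimage_pieces:
  assumes A: "closed A" "connected A"
  shows "\<exists>\<V>. finite \<V> \<and> pairwise disjnt \<V> \<and> \<Union>\<V> = (R ^^ n) -` A \<and> (\<forall>V\<in>\<V>. closed V \<and> connected V)"
proof (cases "A = {}")
  case True
  then show ?thesis by (intro exI[of _ "{}"]) auto
next
  case False
  then obtain a where a: "a \<in> A" by blast
  let ?Z = "(R ^^ n) -` A"
  show ?thesis
  proof (rule clopen_pieces[of "(R ^^ n) -` {a}" ?Z])
    fix W assume W: "closed W" "closed (?Z - W)" "W \<subseteq> ?Z" "W \<noteq> {}"
    have im: "(R ^^ n) ` W = A \<inter> (R ^^ n) ` (- (?Z - W))" using W(3) by auto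
    have "openin (top_of_set A) ((R ^^ n) ` W)"
      unfolding im by (rule openin_open_Int[OF openRn[OF open_Compl[OF W(2)]]])
    moreover have "closedin (top_of_set A) ((R ^^ n) ` W)"
      by (rule closed_subset[OF _ compact_imp_closed[OF compact_continuous_image[OF contRn closed_imp_compact_rs[OF W(1)]]]])
        (use W(3) in blast)
    ultimately have "(R ^^ n) ` W = A" using A(2) W(4) unfolding connected_clopen by blast
    then show "W \<inter> (R ^^ n) -` {a} \<noteq> {}" using a by blast
  qed (use fibreRn closed_vimageRn[OF A(1)] in auto)
qed

text \<open>Greedy assignment: as long as some members are unassigned, connectedness of the union provides an
  unassigned member meeting an assigned one.\<close>

lemma merge_continua:
  fixes \<V> :: "'a::topological_space set set"
  assumes fin: "finite \<V>" and V: "\<And>V. V \<in> \<V> \<Longrightarrow> closed V \<and> connected V \<and> V \<noteq> {}"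
    and con: "connected (\<Union>\<V>)" and E: "E \<subseteq> \<V>" "E \<noteq> {}"
  shows "\<exists>\<phi>. (\<forall>V\<in>\<V>. \<phi> V \<in> E) \<and> (\<forall>e\<in>E. \<phi> e = e \<and> connected (\<Union>{V \<in> \<V>. \<phi> V = e}))"
proof -
  define ok where "ok W \<phi> \<longleftrightarrow> E \<subseteq> W \<and> W \<subseteq> \<V> \<and> (\<forall>V\<in>W. \<phi> V \<in> E) \<and>
     (\<forall>e\<in>E. \<phi> e = e \<and> connected (\<Union>{V \<in> W. \<phi> V = e}))" for W and \<phi> :: "'a set \<Rightarrow> 'a set"
  let ?S = "{W. \<exists>\<phi>. ok W \<phi>}"
  have "?S \<subseteq> Pow \<V>" unfolding ok_def by blast
  then have "finite ?S" using fin by (meson finite_Pow_iff finite_subset)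
  moreover have "ok E (\<lambda>V. V)"
    unfolding ok_def
  proof (intro conjI ballI)
    fix e assume "e \<in> E"
    then have "{V \<in> E. V = e} = {e}" by blast
    then show "connected (\<Union>{V \<in> E. V = e})" using V \<open>e \<in> E\<close> E by auto
  qed (use E in auto)
  then have "?S \<noteq> {}" by blast
  ultimately obtain W where W: "W \<in> ?S" "\<And>W'. W' \<in> ?S \<Longrightarrow> W \<subseteq> W' \<Longrightarrow> W = W'"
    by (metis finite_has_maximal)
  then obtain \<phi> where \<phi>: "ok W \<phi>" by blast
  have "W = \<V>"
  proof (rule ccontr)
    assume ne: "W \<noteq> \<V>"
    have Wsub: "W \<subseteq> \<V>" "E \<subseteq> W" using \<phi> unfolding ok_def by blast+
    have cl: "closed (\<Union>W)" "closed (\<Union>(\<V> - W))"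
      using fin Wsub V by (auto intro!: closed_Union finite_subset[OF Wsub(1)])
    have "\<Union>W \<inter> \<Union>(\<V> - W) \<noteq> {}"
    proof
      assume disj: "\<Union>W \<inter> \<Union>(\<V> - W) = {}"
      have "\<Union>\<V> \<subseteq> \<Union>W \<union> \<Union>(\<V> - W)" by blast
      then have "\<Union>W \<inter> \<Union>\<V> = {} \<or> \<Union>(\<V> - W) \<inter> \<Union>\<V> = {}"
        using con cl disj unfolding connected_closed by (metis inf_bot_left)
      moreover obtain e where "e \<in> E" using E by blast
      then have "e \<in> W" "e \<noteq> {}" "e \<in> \<V>" using Wsub V by blast+
      moreover obtain v where "v \<in> \<V> - W" using ne Wsub by blast
      then have "v \<noteq> {}" "v \<in> \<V>" using V by blast+
      ultimately show False using \<open>v \<in> \<V> - W\<close> by blast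
    qed
    then obtain v w where vw: "v \<in> \<V>" "v \<notin> W" "w \<in> W" "w \<inter> v \<noteq> {}" by blast
    define \<psi> where "\<psi> = \<phi>(v := \<phi> w)"
    have "ok (insert v W) \<psi>"
      unfolding ok_def
    proof (intro conjI ballI)
      fix e assume e: "e \<in> E"
      show "\<psi> e = e" using e vw(2) Wsub \<phi> unfolding \<psi>_def ok_def by auto
      have ce: "connected (\<Union>{V \<in> W. \<phi> V = e})" using \<phi> e unfolding ok_def by blast
      show "connected (\<Union>{V \<in> insert v W. \<psi> V = e})"
      proof (cases "e = \<phi> w")
        case True
        then have "{V \<in> insert v W. \<psi> V = e} = insert v {V \<in> W. \<phi> V = e}"
          using vw(2) unfolding \<psi>_def by auto
        then have eq: "\<Union>{V \<in> insert v W. \<psi> V = e} = \<Union>{V \<in> W. \<phi> V = e} \<union> v" by auto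
        show ?thesis unfolding eq
          by (rule connected_Un[OF ce]) (use V vw True in auto)
      next
        case False
        then have "{V \<in> insert v W. \<psi> V = e} = {V \<in> W. \<phi> V = e}"
          using vw(2) unfolding \<psi>_def by auto
        then show ?thesis using ce by simp
      qed
    qed (use \<phi> vw in \<open>auto simp: ok_def \<psi>_def\<close>)
    then have "W = insert v W" using W(2)[of "insert v W"] by blast
    then show False using vw(2) by blast
  qed
  then show ?thesis using \<phi> unfolding ok_def by blast
qed

section \<open>Contradiction from a decomposition\<close>

context rational_dyn
begin

context
  fixes U C1 C2 C3 A B
  assumes Jne: "J \<noteq> {}" and Jcon: "connected J" and U: "open U"
    and C: "C1 \<in> components F" "C2 \<in> components F" "C3 \<in> components F" "C1 \<noteq> C2" "C1 \<noteq> C3" "C2 \<noteq> C3"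
    and fr: "U \<inter> J \<subseteq> frontier C1" "U \<inter> J \<subseteq> frontier C2" "U \<inter> J \<subseteq> frontier C3"
    and AB: "closed A" "connected A" "closed B" "connected B" "A \<union> B = J" "A \<noteq> J" "B \<noteq> J"
begin

lemma no_crossing_julia:
  assumes con: "connected P" "connected P'" "connected Q" "connected Q'"
    and cl: "closed P" "closed P'" "closed Q" "closed Q'"
    and cross: "P \<inter> Q \<subseteq> P' \<union> Q'" "P' \<inter> Q' \<subseteq> P \<union> Q"
    and cov: "P \<union> P' \<union> (Q \<union> Q') = J"
    and miss: "\<not> U \<inter> J \<subseteq> P \<union> P'" "\<not> U \<inter> J \<subseteq> Q \<union> Q'" "\<not> U \<inter> J \<subseteq> P' \<union> Q" "\<not> U \<inter> J \<subseteq> P \<union> Q'"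
  shows False
proof (rule no_crossing[OF closed_julia _ _ _ _ con cl cross cov miss])
  fix C' assume C': "C' \<in> {C1, C2, C3}"
  then have c: "C' \<in> components F" using C by blast
  have "closure C' \<subseteq> C' \<union> J" using comp_closure_F[OF c] F_J by blast
  moreover have "U \<inter> J \<subseteq> closure C'" using C' fr by (auto simp: frontier_def)
  moreover have "C' \<inter> J = {}" using in_components_subset[OF c] F_J by blast
  ultimately show "open C' \<and> connected C' \<and> C' \<noteq> {} \<and> C' \<inter> J = {} \<and> closure C' \<subseteq> C' \<union> J \<and> U \<inter> J \<subseteq> closure C'"
    using open_comp[OF c] in_components_connected[OF c] in_components_nonempty[OF c] by blast
qed (use C comp_unique in blast)+

text \<open>Three pieces of the preimages of \<open>A\<close> and \<open>B\<close> that have private points in \<open>U \<inter> J\<close> would yield three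
  continua contradicting the crossing lemma. So there is exactly one such piece over \<open>A\<close> and one over \<open>B\<close>, and
  these have private points in every open set that iterates onto \<open>J\<close>.\<close>

lemma two_continua:
  assumes O12: "O1 \<subseteq> U" "O2 \<subseteq> U" "(R ^^ n) ` (O1 \<inter> J) = J" "(R ^^ n) ` (O2 \<inter> J) = J"
  obtains P Q where "closed P" "closed Q" "connected P" "connected Q" "P \<union> Q = J"
    "\<not> O1 \<inter> J \<subseteq> P" "\<not> O1 \<inter> J \<subseteq> Q" "\<not> O2 \<inter> J \<subseteq> P" "\<not> O2 \<inter> J \<subseteq> Q"
proof -
  obtain \<A>' where \<A>': "finite \<A>'" "pairwise disjnt \<A>'" "\<Union>\<A>' = (R ^^ n) -` A" "\<And>V. V \<in> \<A>' \<Longrightarrow> closed V \<and> connected V"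
    using preimage_pieces[OF AB(1,2)] by metis
  obtain \<B>' where \<B>': "finite \<B>'" "pairwise disjnt \<B>'" "\<Union>\<B>' = (R ^^ n) -` B" "\<And>V. V \<in> \<B>' \<Longrightarrow> closed V \<and> connected V"
    using preimage_pieces[OF AB(3,4)] by metis
  define \<A> \<B> where "\<A> = \<A>' - {{}}" and "\<B> = \<B>' - {{}}"
  define \<V> where "\<V> = \<A> \<union> \<B>"
  have un: "\<Union>\<A> = (R ^^ n) -` A" "\<Union>\<B> = (R ^^ n) -` B" using \<A>'(3) \<B>'(3) unfolding \<A>_def \<B>_def by auto
  have pw: "pairwise disjnt \<A>" "pairwise disjnt \<B>"
    unfolding \<A>_def \<B>_def by (rule pairwise_subset[OF \<A>'(2)], blast, rule pairwise_subset[OF \<B>'(2)], blast)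
  have "\<Union>\<V> = (R ^^ n) -` (A \<union> B)" using un unfolding \<V>_def by auto
  also have "\<dots> = J" unfolding AB(5) using julia_Rn_iff by blast
  finally have \<V>J: "\<Union>\<V> = J" .
  have con\<V>: "connected (\<Union>\<V>)" unfolding \<V>J by (rule Jcon)
  have fin: "finite \<V>" unfolding \<V>_def \<A>_def \<B>_def using \<A>' \<B>' by simp
  have \<V>: "closed V \<and> connected V \<and> V \<noteq> {}" if "V \<in> \<V>" for V
    using that \<A>'(4) \<B>'(4) unfolding \<V>_def \<A>_def \<B>_def by blast
  define priv where "priv v x \<longleftrightarrow> v \<in> \<V> \<and> x \<in> v \<and> (\<forall>w\<in>\<V>. x \<in> w \<longrightarrow> w = v)" for v x
  have group: "closed (\<Union>{V \<in> \<V>. \<phi> V = e})" for \<phi> :: "riemann_sphere set \<Rightarrow> riemann_sphere set" and e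
    using fin \<V> by (intro closed_Union) auto
  have three: False
    if e: "priv e1 x1" "priv e2 x2" "priv e3 x3" "e1 \<noteq> e2" "e1 \<noteq> e3" "e2 \<noteq> e3" "{x1, x2, x3} \<subseteq> U \<inter> J"
    for e1 e2 e3 x1 x2 x3
  proof -
    have E: "{e1, e2, e3} \<subseteq> \<V>" "{e1, e2, e3} \<noteq> {}" using e unfolding priv_def by auto
    from merge_continua[OF fin \<V> con\<V> E] obtain \<phi> where
      "(\<forall>V\<in>\<V>. \<phi> V \<in> {e1, e2, e3}) \<and> (\<forall>e\<in>{e1, e2, e3}. \<phi> e = e \<and> connected (\<Union>{V \<in> \<V>. \<phi> V = e}))"
      by (rule exE)
    then have \<phi>: "\<And>V. V \<in> \<V> \<Longrightarrow> \<phi> V \<in> {e1, e2, e3}" "\<And>e. e \<in> {e1, e2, e3} \<Longrightarrow> \<phi> e = e"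
      "\<And>e. e \<in> {e1, e2, e3} \<Longrightarrow> connected (\<Union>{V \<in> \<V>. \<phi> V = e})"
      by blast+
    define X where "X e = \<Union>{V \<in> \<V>. \<phi> V = e}" for e
    have clX: "closed (X e)" for e unfolding X_def by (rule group)
    have conX: "connected (X e)" if "e \<in> {e1, e2, e3}" for e unfolding X_def by (rule \<phi>(3)[OF that])
    have "X e1 \<union> X e2 \<union> X e3 = J"
      unfolding \<V>J[symmetric] X_def using \<phi>(1) by blast
    moreover have px: "x \<notin> X f" if "priv e x" "e \<in> {e1, e2, e3}" "f \<noteq> e" for e f x
      using that \<phi>(2)[OF that(2)] unfolding X_def priv_def by blast
    have "x1 \<notin> X e2" "x1 \<notin> X e3" "x2 \<notin> X e1" "x2 \<notin> X e3" "x3 \<notin> X e1" "x3 \<notin> X e2"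
      using px[OF e(1)] px[OF e(2)] px[OF e(3)] e(4-6) by auto
    \<comment> \<open>Three continua are used as a cycle of four in which the last one is
      repeated.\<close>
    ultimately show False
      using no_crossing_julia[of "X e1" "X e2" "X e3" "X e3"] clX conX e(7) by auto
  qed
  \<comment> \<open>Over a point \<open>y\<close> that lies in only one of the two continua, every
    point belongs to exactly one piece, because pieces over the same continuum are disjoint. The
    assumption on \<open>O'\<close> places such a point in \<open>O'\<close>.\<close>
  have ex: "\<exists>v x. v \<in> \<X> \<and> v \<notin> \<Y> \<and> x \<in> O' \<inter> J \<and> priv v x"
    if O': "(R ^^ n) ` (O' \<inter> J) = J" and X: "\<Union>\<X> = (R ^^ n) -` X" "\<Union>\<Y> = (R ^^ n) -` Y" "pairwise disjnt \<X>" "\<V> = \<X> \<union> \<Y>"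
      and y: "y \<in> J" "y \<in> X" "y \<notin> Y" for O' \<X> \<Y> X Y y
  proof -
    obtain x where x: "x \<in> O' \<inter> J" "(R ^^ n) x = y" using O' y(1) by (metis imageE)
    then obtain v where v: "v \<in> \<X>" "x \<in> v" using X(1) y(2) by blast
    have nY: "x \<notin> w" if "w \<in> \<Y>" for w using X(2) that x(2) y(3) by blast
    have "priv v x" unfolding priv_def
    proof (intro conjI ballI impI)
      fix w assume "w \<in> \<V>" "x \<in> w"
      then have "w \<in> \<X>" using nY X(4) by blast
      then show "w = v" using X(3) v \<open>x \<in> w\<close> unfolding pairwise_def disjnt_def by blast
    qed (use v X(4) in auto)
    then show ?thesis using v x nY by blast
  qed
  obtain y where y: "y \<in> J" "y \<in> A" "y \<notin> B" using AB(5,7) by blast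
  obtain y' where y': "y' \<in> J" "y' \<in> B" "y' \<notin> A" using AB(5,6) by blast
  note exA = ex[OF _ un pw(1) \<V>_def y] and exB = ex[OF _ un(2,1) pw(2) _ y', OF _ \<V>_def[unfolded Un_commute[of \<A>]]]
  obtain a1 x1 where a1: "a1 \<in> \<A>" "a1 \<notin> \<B>" "x1 \<in> O1 \<inter> J" "priv a1 x1" using exA[OF O12(3)] by blast
  obtain a2 x2 where a2: "a2 \<in> \<A>" "a2 \<notin> \<B>" "x2 \<in> O2 \<inter> J" "priv a2 x2" using exA[OF O12(4)] by blast
  obtain b1 y1 where b1: "b1 \<in> \<B>" "b1 \<notin> \<A>" "y1 \<in> O1 \<inter> J" "priv b1 y1" using exB[OF O12(3)] by blast
  obtain b2 y2 where b2: "b2 \<in> \<B>" "b2 \<notin> \<A>" "y2 \<in> O2 \<inter> J" "priv b2 y2" using exB[OF O12(4)] by blast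
  have inU: "x1 \<in> U \<inter> J" "x2 \<in> U \<inter> J" "y1 \<in> U \<inter> J" "y2 \<in> U \<inter> J" using a1 a2 b1 b2 O12 by blast+
  have aa: "a1 = a2"
  proof (rule ccontr)
    assume "a1 \<noteq> a2"
    moreover have "a1 \<noteq> b1" "a2 \<noteq> b1" using a1(2) a2(2) b1(1) by blast+
    ultimately show False using three[OF a1(4) a2(4) b1(4)] inU by simp
  qed
  have bb: "b1 = b2"
  proof (rule ccontr)
    assume "b1 \<noteq> b2"
    moreover have "b1 \<noteq> a1" "b2 \<noteq> a1" using b1(2) b2(2) a1(1) by blast+
    ultimately show False using three[OF b1(4) b2(4) a1(4)] inU by simp
  qed
  have ab: "a1 \<noteq> b1" using a1(2) b1(1) by blast
  have E: "{a1, b1} \<subseteq> \<V>" "{a1, b1} \<noteq> {}" using a1(1) b1(1) unfolding \<V>_def by auto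
  from merge_continua[OF fin \<V> con\<V> E] obtain \<phi> where
      "(\<forall>V\<in>\<V>. \<phi> V \<in> {a1, b1}) \<and> (\<forall>e\<in>{a1, b1}. \<phi> e = e \<and> connected (\<Union>{V \<in> \<V>. \<phi> V = e}))"
      by (rule exE)
    then have \<phi>: "\<And>V. V \<in> \<V> \<Longrightarrow> \<phi> V \<in> {a1, b1}" "\<And>e. e \<in> {a1, b1} \<Longrightarrow> \<phi> e = e"
      "\<And>e. e \<in> {a1, b1} \<Longrightarrow> connected (\<Union>{V \<in> \<V>. \<phi> V = e})"
      by blast+
  define X where "X e = \<Union>{V \<in> \<V>. \<phi> V = e}" for e
  have px: "x \<notin> X f" if "priv e x" "e \<in> {a1, b1}" "f \<noteq> e" for e f x
    using that \<phi>(2)[OF that(2)] unfolding X_def priv_def by blast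
  show thesis
  proof (rule that[of "X a1" "X b1"])
    show "closed (X a1)" "closed (X b1)" unfolding X_def by (rule group)+
    show "connected (X a1)" "connected (X b1)" unfolding X_def using \<phi>(3) by blast+
    show "X a1 \<union> X b1 = J" unfolding \<V>J[symmetric] X_def using \<phi>(1) by blast
    have "x1 \<notin> X b1" "x2 \<notin> X b1" "y1 \<notin> X a1" "y2 \<notin> X a1"
      using px[OF a1(4)] px[OF a2(4)] px[OF b1(4)] px[OF b2(4)] aa bb ab by auto
    then show "\<not> O1 \<inter> J \<subseteq> X a1" "\<not> O1 \<inter> J \<subseteq> X b1" "\<not> O2 \<inter> J \<subseteq> X a1" "\<not> O2 \<inter> J \<subseteq> X b1"
      using a1(3) a2(3) b1(3) b2(3) by blast+
  qed
qed

text \<open>The contradiction comes from two such decompositions \<open>P \<union> Q\<close> and \<open>P' \<union> Q'\<close>, the second one for an iterate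
  so high that its members do not cover what the members of the first one miss.\<close>

lemma julia_not_union: "U \<inter> J = {}"
proof (rule ccontr)
  assume "U \<inter> J \<noteq> {}"
  then obtain n where n: "(R ^^ n) ` (U \<inter> J) = J" using exact_Int[OF U] by blast
  obtain P Q where PQ: "closed P" "closed Q" "connected P" "connected Q" "P \<union> Q = J"
    "\<not> U \<inter> J \<subseteq> P" "\<not> U \<inter> J \<subseteq> Q"
    using two_continua[OF order_refl order_refl n n] by metis
  \<comment> \<open>A point of \<open>O1\<close> avoids \<open>Q\<close>; if it also avoids
    \<open>P'\<close> or \<open>Q'\<close>, it is missed by the union of \<open>Q\<close> with that
    set. Together with the same remark for \<open>O2\<close> and \<open>P\<close> this gives the
    four conditions on neighbours in the cycle.\<close>
  define O1 O2 where "O1 = U - Q" and "O2 = U - P"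
  have op: "open O1" "open O2" unfolding O1_def O2_def using U PQ by (auto intro: open_Diff)
  have ne: "O1 \<inter> J \<noteq> {}" "O2 \<inter> J \<noteq> {}" unfolding O1_def O2_def using PQ by blast+
  obtain k where k: "J \<subseteq> (R ^^ k) ` O1" using topologically_exact[OF op(1) ne(1)] by blast
  obtain l where l: "J \<subseteq> (R ^^ l) ` O2" using topologically_exact[OF op(2) ne(2)] by blast
  define m where "m = max k l"
  have m: "J \<subseteq> (R ^^ m) ` O1" "J \<subseteq> (R ^^ m) ` O2"
    unfolding m_def using julia_covered_mono[OF k] julia_covered_mono[OF l] by simp_all
  have "(R ^^ m) ` (O1 \<inter> J) = J" "(R ^^ m) ` (O2 \<inter> J) = J" using m julia_Rn_iff[of m] by blast+
  moreover have "O1 \<subseteq> U" "O2 \<subseteq> U" unfolding O1_def O2_def by blast+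
  ultimately obtain P' Q' where PQ': "closed P'" "closed Q'" "connected P'" "connected Q'" "P' \<union> Q' = J"
    "\<not> O1 \<inter> J \<subseteq> P'" "\<not> O1 \<inter> J \<subseteq> Q'" "\<not> O2 \<inter> J \<subseteq> P'" "\<not> O2 \<inter> J \<subseteq> Q'"
    using two_continua by metis
  show False
  proof (rule no_crossing_julia[of P P' Q Q'])
    show "\<not> U \<inter> J \<subseteq> P \<union> P'" "\<not> U \<inter> J \<subseteq> P \<union> Q'" using PQ'(8,9) unfolding O2_def by blast+
    show "\<not> U \<inter> J \<subseteq> Q \<union> Q'" "\<not> U \<inter> J \<subseteq> P' \<union> Q" using PQ'(6,7) unfolding O1_def by blast+
    show "P \<inter> Q \<subseteq> P' \<union> Q'" "P' \<inter> Q' \<subseteq> P \<union> Q" "P \<union> P' \<union> (Q \<union> Q') = J" using PQ(5) PQ'(5) by blast+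
  qed (use PQ PQ' in auto)
qed

end

text \<open>With an empty Julia set the whole sphere would be a completely invariant Fatou
  component.\<close>

lemma julia_nonempty:
  assumes ni: "\<not> (\<exists>C \<in> components F. completely_invariant (R \<circ> R) C)"
  shows "J \<noteq> {}"
proof
  assume "J = {}"
  then have FU: "F = UNIV" by (simp add: F_J)
  have "(UNIV :: riemann_sphere set) \<in> components UNIV"
    using connected_riemann_sphere components_eq_sing_iff[of "UNIV :: riemann_sphere set"] by auto
  then show False using completely_invariantI[of UNIV] ni FU by auto
qed

theorem julia_indecomposable:
  assumes nb: "\<And>x. \<not> buried_point R x"
    and ni: "\<not> (\<exists>C \<in> components F. completely_invariant (R \<circ> R) C)"
  shows "indecomposable_continuum J"
proof -
  have J: "J \<noteq> {}" by (rule julia_nonempty[OF ni])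
  obtain C where "fat C" using exists_fat[OF J nb] by blast
  then obtain D where D: "full D" using fat_image_full by blast
  have con: "connected J" by (rule julia_connected[OF D ni])
  obtain U C1 C2 C3 where U: "open U" "U \<inter> J \<noteq> {}"
    and C: "C1 \<in> components F" "C2 \<in> components F" "C3 \<in> components F" "C1 \<noteq> C2" "C1 \<noteq> C3" "C2 \<noteq> C3"
    and fr: "U \<inter> J \<subseteq> frontier C1" "U \<inter> J \<subseteq> frontier C2" "U \<inter> J \<subseteq> frontier C3"
    using three_fat_or_invariant[OF J D ni] by blast
  have "\<not> decomposable J"
  proof
    assume "decomposable J"
    then obtain A B where d: "continuum A" "continuum B" "A \<subset> J" "B \<subset> J" "J = A \<union> B"
      unfolding decomposable_def by blast
    have AB: "closed A" "connected A" "closed B" "connected B"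
      using d(1,2) compact_imp_closed unfolding continuum_def by blast+
    have AB': "A \<union> B = J" "A \<noteq> J" "B \<noteq> J" using d(3-5) by blast+
    from julia_not_union[OF J con U(1) C fr AB AB'] U(2) show False by blast
  qed
  moreover have "continuum J"
    unfolding continuum_def using J con closed_julia closed_imp_compact_rs by blast
  ultimately show ?thesis unfolding indecomposable_continuum_def by blast
qed

end

theorem corollary13:
  fixes R :: "riemann_sphere \<Rightarrow> riemann_sphere" and d :: nat
  assumes "rational_function_of_degree R d" and "d \<ge> 2"
    and "\<not> (\<exists>x. buried_point R x)"
    and "\<not> (\<exists>C \<in> components (fatou_set (R \<circ> R)). completely_invariant (R \<circ> R) C)"
  shows "indecomposable_continuum (julia_set R)"
proof -
  obtain H where "rational_dyn R H d" using rational_dyn_exists[OF assms(1,2)] by blast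
  then interpret rational_dyn R H d .
  show ?thesis using julia_indecomposable assms(3,4) unfolding fatou_RR by blast
qed

end
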